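(* The pair $(\tilde{A},\tilde{\sigma}')$ constructed in the context is a complete normal contact algebra; it is CA-isomorphic to the complete normal contact algebra $(RC(\mathbb{I}),\rho_{\mathbb{I}})$, where $\mathbb{I}=[0,1]$ with its natural topology. Thus the pair $(\tilde{A},\tilde{\sigma}')$ completely determines the closed interval $\mathbb{I}$ with its natural topology (i.e. every compact Hausdorff space $Y$ with $(RC(Y),\rho_Y)$ CA-isomorphic to $(\tilde{A},\tilde{\sigma}')$ is homeomorphic to $\mathbb{I}$).
   Context: **Contact algebras.** A contact algebra $(B,C)$ is a Boolean algebra $B$ (complement $a^*$) with a binary relation $C$ such that: (C1) $a\neq 0\Rightarrow aCa$; (C2) $aCb\Rightarrow a\neq 0$ and $b\ne 0$; (C3) $aCb\Rightarrow bCa$; (C4) $aC(b\vee c)$ iff $aCb$ or $aCc$. Write $a(-C)b$ for "not $aCb$". It is a normal contact algebra if also (C5) $a(-C)b$ implies $a(-C)c$ and $b(-C)c^*$ for some $c\in B$; (C6) if $a\neq 1$ there is $b\neq 0$ with $b(-C)a$. It is a complete normal contact algebra (CNCA) if moreover $B$ is complete. $(B_1,C_1)$ and $(B_2,C_2)$ are CA-isomorphic if there is a Boolean isomorphism $\varphi:B_1\to B_2$ with $aC_1b\iff\varphi(a)C_2\varphi(b)$. **Standard algebras.** For a topological space $X$: $RC(X)$ is the complete Boolean algebra of regular closed subsets ($F=\mathrm{cl}(\mathrm{int}F)$), with $F\vee G=F\cup G$, $F\wedge G=\mathrm{cl}(\mathrm{int}(F\cap G))$, $F^*=\mathrm{cl}(X\setminus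 F)$; $F\rho_X G$ iff $F\cap G\neq\emptyset$. For $X$ compact Hausdorff, $(RC(X),\rho_X)$ is a CNCA. **Construction of $(\tilde{A},\tilde{\sigma},\widetilde{\mathbb{B}})$.** Let $\mathbb{Z}_0=\mathbb{Z}\setminus\{0\}$ with the usual order; for $p\in\mathbb{Z}_0$ let $p^-,p^+$ be its immediate predecessor and successor in $\mathbb{Z}_0$ (so $1^-=-1$, $(-1)^+=1$), $succ(p)=\{q\in\mathbb{Z}_0: q>p\}$, $pred(p)=\{q\in\mathbb{Z}_0: q<p\}$. For $i\in\mathbb{N}^+$ let $A_i=P(\mathbb{Z}_0)$ (power set Boolean algebra). Let $(A,(\varphi_i)_{i\in\mathbb{N}^+})$ be the sum (coproduct, free product) of the Boolean algebras $A_i$, with canonical monomorphisms $\varphi_i:A_i\to A$, and let $\tilde{A}\supseteq A$ be the (MacNeille) completion of $A$. Let $B_0$ be the set of all elements $b=\varphi_1(\{n_1\})\wedge\dots\wedge\varphi_k(\{n_k\})$, $k\in\mathbb{N}^+$, $n_1,\dots,n_k\in\mathbb{Z}_0$. For such $b$ put $b_-=\varphi_1(\{n_1\})\wedge\dots\wedge\varphi_{k-1}(\{n_{k-1}\})\wedge\varphi_k(\{n_k^-\})$ and, for $r\in\mathbb{N}^+$, $q_{br}=(b_-\wedge\varphi_{k+1}(succ(r)))\vee(b\wedge\varphi_{k+1}(pred(-r)))$. Let $B_1=\{q_{br}: b\in B_0, r\in\mathbb{N}^+\}$ and let $\widetilde{\mathbb{B}}$ be the ideal of $\tilde{A}$ generated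 by $B_0\cup B_1$. The relation $\tilde{\sigma}$ on $\tilde{A}$ is, by definition, symmetric and is defined as follows. Let $b=\bigwedge_{i=1}^k\varphi_i(\{n_i\})$, $b'=\bigwedge_{i=1}^l\varphi_i(\{n'_i\})$ be in $B_0$ and $r,r'\in\mathbb{N}^+$. (i) If $k\le l$: $b\tilde{\sigma}b'$ iff $n_i=n'_i$ for all $i<k$ and [$n'_k\in\{n_k^-,n_k,n_k^+\}$ if $k=l$; $n'_k=n_k$ if $k<l$]. (ii) If $k\le l$: $q_{br}\tilde{\sigma}q_{b'r'}$ iff $n_i=n'_i$ for all $i<k$ and [$n'_k=n_k$ if $l=k$; ($n'_k=n_k$ and $n'_{k+1}\le -r$) or ($n'_k=n_k^-$ and $n'_{k+1}>r$) if $l=k+1$; ($n'_k=n_k$ and $n'_{k+1}<-r$) or ($n'_k=n_k^-$ and $n'_{k+1}>r$) if $l>k+1$]. (iii) If $k>l$: $q_{br}\tilde{\sigma}b'$ iff $n_i=n'_i$ for all $i\in\{1,\dots,l\}$. If $k\le l$: $q_{br}\tilde{\sigma}b'$ iff $n_i=n'_i$ for all $i<k$ and [$n'_k\in\{n_k^-,n_k\}$ if $l=k$; ($n'_{k+1}\ge r$ and $n'_k=n_k^-$) or ($n'_{k+1}\le -r$ and $n'_k=n_k$) if $l=k+1$; ($n'_{k+1}>r$ and $n'_k=n_k^-$) or ($n'_{k+1}<-r$ and $n'_k=n_k$) if $l>k+1$]. (iv) For $c,d\in\widetilde{\mathbb{B}}$: $c(-\tilde{\sigma})d$ iff there are $k,l\in\mathbb{N}^+$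 and $c_1,\dots,c_k,d_1,\dots,d_l\in B_0\cup B_1$ with $c\le\bigvee_i c_i$, $d\le\bigvee_j d_j$ and $c_i(-\tilde{\sigma})d_j$ for all $i,j$. (v) For $a,b\in\tilde{A}$: $a\tilde{\sigma}b$ iff there are $c,d\in\widetilde{\mathbb{B}}$ with $c\le a$, $d\le b$, $c\tilde{\sigma}d$. **Construction of $\tilde{\sigma}'$.** For $n\in\mathbb{N}^+$ put $u_n^\uparrow=\varphi_1(succ(n))$, $u_n^\downarrow=\varphi_1(pred(-n))$, and $B_2=\{u_n^\uparrow,u_n^\downarrow: n\in\mathbb{N}^+\}$. For $a,b\in B_0\cup B_1\cup B_2$ put $a\tilde{\sigma}'b$ iff $a\tilde{\sigma}b$. Written out for the pairs involving $B_2$, with $n,m',r\in\mathbb{N}^+$ and $b=\bigwedge_{i=1}^k\varphi_i(\{n_i\})\in B_0$, $m=n_1$: $u_n^\uparrow\tilde{\sigma}'u_{m'}^\uparrow$, $u_n^\downarrow\tilde{\sigma}'u_{m'}^\downarrow$, $u_n^\downarrow(-\tilde{\sigma}')u_{m'}^\uparrow$; $b\tilde{\sigma}'u_n^\uparrow$ iff [$m\ge n$ if $k=1$; $m>n$ if $k>1$]; $b\tilde{\sigma}'u_n^\downarrow$ iff [$m\le -n$ if $k=1$; $m<-n$ if $k>1$]; $q_{br}\tilde{\sigma}'u_n^\uparrow$ iff $m>n$; $q_{br}\tilde{\sigma}'u_n^\downarrow$ iff [$m\le -n$ if $k=1$; $m<-n$ if $k>1$]. For $c,d\in\tilde{A}$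 put $c(-\tilde{\sigma}')d$ iff there are $k,l\in\mathbb{N}^+$ and $c_1,\dots,c_k,d_1,\dots,d_l\in B_0\cup B_1\cup B_2$ with $c\le\bigvee_{i=1}^k c_i$, $d\le\bigvee_{j=1}^l d_j$ and $c_i(-\tilde{\sigma}')d_j$ for all $i=1,\dots,k$ and all $j=1,\dots,l$.
   Formalization: In the definition of c(-σ̃')d the numbers k, l may also be 0 (empty joins, equal to 0); with k, l ≥ 1 as written one would get 0 σ̃' 1, against (C2). Only the pairs (0,1) and (1,0) are affected. *)

theory Defs
  imports "HOL-Analysis.Analysis"
begin

section \<open>Boolean algebras with a carrier, contact algebras\<close>

record 'a balg =
  elems :: "'a set"
  join :: "'a \<Rightarrow> 'a \<Rightarrow> 'a"
  meet :: "'a \<Rightarrow> 'a \<Rightarrow> 'a"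
  compl :: "'a \<Rightarrow> 'a"
  zero :: 'a
  one :: 'a

definition ba_le :: "'a balg \<Rightarrow> 'a \<Rightarrow> 'a \<Rightarrow> bool" where
  "ba_le B x y \<longleftrightarrow> join B x y = y"

locale boolean_alg =
  fixes B :: "'a balg"
  assumes zero_closed: "zero B \<in> elems B"
    and one_closed: "one B \<in> elems B"
    and join_closed: "\<lbrakk>x \<in> elems B; y \<in> elems B\<rbrakk> \<Longrightarrow> join B x y \<in> elems B"
    and meet_closed: "\<lbrakk>x \<in> elems B; y \<in> elems B\<rbrakk> \<Longrightarrow> meet B x y \<in> elems B"
    and compl_closed: "x \<in> elems B \<Longrightarrow> compl B x \<in> elems B"
    and join_assoc: "\<lbrakk>x \<in> elems B; y \<in> elems B; z \<in> elems B\<rbrakk>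
          \<Longrightarrow> join B (join B x y) z = join B x (join B y z)"
    and meet_assoc: "\<lbrakk>x \<in> elems B; y \<in> elems B; z \<in> elems B\<rbrakk>
          \<Longrightarrow> meet B (meet B x y) z = meet B x (meet B y z)"
    and join_commute: "\<lbrakk>x \<in> elems B; y \<in> elems B\<rbrakk> \<Longrightarrow> join B x y = join B y x"
    and meet_commute: "\<lbrakk>x \<in> elems B; y \<in> elems B\<rbrakk> \<Longrightarrow> meet B x y = meet B y x"
    and join_absorb: "\<lbrakk>x \<in> elems B; y \<in> elems B\<rbrakk> \<Longrightarrow> join B x (meet B x y) = x"
    and meet_absorb: "\<lbrakk>x \<in> elems B; y \<in> elems B\<rbrakk> \<Longrightarrow> meet B x (join B x y) = x"
    and meet_join_distrib: "\<lbrakk>x \<in> elems B; y \<in> elems B; z \<in> elems B\<rbrakk>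
          \<Longrightarrow> meet B x (join B y z) = join B (meet B x y) (meet B x z)"
    and join_meet_distrib: "\<lbrakk>x \<in> elems B; y \<in> elems B; z \<in> elems B\<rbrakk>
          \<Longrightarrow> join B x (meet B y z) = meet B (join B x y) (join B x z)"
    and join_compl: "x \<in> elems B \<Longrightarrow> join B x (compl B x) = one B"
    and meet_compl: "x \<in> elems B \<Longrightarrow> meet B x (compl B x) = zero B"

locale complete_boolean_alg = boolean_alg B for B :: "'a balg" +
  assumes has_suprema: "S \<subseteq> elems B \<Longrightarrow>
    \<exists>s\<in>elems B. (\<forall>x\<in>S. ba_le B x s) \<and>
      (\<forall>u\<in>elems B. (\<forall>x\<in>S. ba_le B x u) \<longrightarrow> ba_le B s u)"

locale contact_algebra = boolean_alg B for B :: "'a balg" +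
  fixes C :: "'a \<Rightarrow> 'a \<Rightarrow> bool"
  assumes C1: "\<lbrakk>a \<in> elems B; a \<noteq> zero B\<rbrakk> \<Longrightarrow> C a a"
    and C2: "\<lbrakk>a \<in> elems B; b \<in> elems B; C a b\<rbrakk> \<Longrightarrow> a \<noteq> zero B \<and> b \<noteq> zero B"
    and C3: "\<lbrakk>a \<in> elems B; b \<in> elems B; C a b\<rbrakk> \<Longrightarrow> C b a"
    and C4: "\<lbrakk>a \<in> elems B; b \<in> elems B; c \<in> elems B\<rbrakk>
          \<Longrightarrow> C a (join B b c) \<longleftrightarrow> C a b \<or> C a c"

locale normal_contact_algebra = contact_algebra B C
  for B :: "'a balg" and C :: "'a \<Rightarrow> 'a \<Rightarrow> bool" +
  assumes C5: "\<lbrakk>a \<in> elems B; b \<in> elems B; \<not> C a b\<rbrakk>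
          \<Longrightarrow> \<exists>c\<in>elems B. \<not> C a c \<and> \<not> C b (compl B c)"
    and C6: "\<lbrakk>a \<in> elems B; a \<noteq> one B\<rbrakk> \<Longrightarrow> \<exists>b\<in>elems B. b \<noteq> zero B \<and> \<not> C b a"

locale complete_normal_contact_algebra =
  normal_contact_algebra B C + complete_boolean_alg B
  for B :: "'a balg" and C :: "'a \<Rightarrow> 'a \<Rightarrow> bool"

definition boolean_isomorphism :: "'a balg \<Rightarrow> 'b balg \<Rightarrow> ('a \<Rightarrow> 'b) \<Rightarrow> bool" where
  "boolean_isomorphism B1 B2 f \<longleftrightarrow>
     bij_betw f (elems B1) (elems B2) \<and>
     (\<forall>x\<in>elems B1. \<forall>y\<in>elems B1. f (join B1 x y) = join B2 (f x) (f y)) \<and>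
     (\<forall>x\<in>elems B1. \<forall>y\<in>elems B1. f (meet B1 x y) = meet B2 (f x) (f y)) \<and>
     (\<forall>x\<in>elems B1. f (compl B1 x) = compl B2 (f x)) \<and>
     f (zero B1) = zero B2 \<and> f (one B1) = one B2"

definition CA_isomorphic ::
  "'a balg \<Rightarrow> ('a \<Rightarrow> 'a \<Rightarrow> bool) \<Rightarrow> 'b balg \<Rightarrow> ('b \<Rightarrow> 'b \<Rightarrow> bool) \<Rightarrow> bool" where
  "CA_isomorphic B1 C1 B2 C2 \<longleftrightarrow>
     (\<exists>f. boolean_isomorphism B1 B2 f \<and>
          (\<forall>a\<in>elems B1. \<forall>b\<in>elems B1. C1 a b \<longleftrightarrow> C2 (f a) (f b)))"

definition type_balg :: "'a::boolean_algebra balg" where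
  "type_balg = \<lparr>elems = UNIV, join = sup, meet = inf, compl = uminus, zero = bot, one = top\<rparr>"

definition RC :: "'a topology \<Rightarrow> 'a set balg" where
  "RC X = \<lparr>elems = {F. closedin X F \<and> F = X closure_of (X interior_of F)},
           join = (\<lambda>F G. F \<union> G),
           meet = (\<lambda>F G. X closure_of (X interior_of (F \<inter> G))),
           compl = (\<lambda>F. X closure_of (topspace X - F)),
           zero = {}, one = topspace X\<rparr>"

definition rho :: "'a set \<Rightarrow> 'a set \<Rightarrow> bool" where
  "rho F G \<longleftrightarrow> F \<inter> G \<noteq> {}"


section \<open>The MacNeille completion of a Boolean algebra\<close>

definition upper_bounds :: "'a::order set \<Rightarrow> 'a set" where
  "upper_bounds S = {u. \<forall>x\<in>S. x \<le> u}"

definition lower_bounds :: "'a::order set \<Rightarrow> 'a set" where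
  "lower_bounds S = {l. \<forall>x\<in>S. l \<le> x}"

abbreviation cut_hull :: "'a::order set \<Rightarrow> 'a set" where
  "cut_hull S \<equiv> lower_bounds (upper_bounds S)"

lemma cut_hull_extensive: "S \<subseteq> cut_hull S"
  and cut_hull_mono: "S \<subseteq> T \<Longrightarrow> cut_hull S \<subseteq> cut_hull T"
  and cut_hull_idem: "cut_hull (cut_hull S) = cut_hull S"
  unfolding upper_bounds_def lower_bounds_def by auto

typedef (overloaded) ('a::order) macneille = "{I :: 'a set. cut_hull I = I}"
  morphisms cut_of mk_cut
proof
  show "cut_hull {} \<in> {I. cut_hull I = I}"
    by (simp add: cut_hull_idem)
qed

lemma cut_hull_cut_of [simp]: "cut_hull (cut_of x) = cut_of x"
  using cut_of by auto

lemma cut_of_mk_cut: "cut_hull I = I \<Longrightarrow> cut_of (mk_cut I) = I"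
  by (simp add: mk_cut_inverse)

lemma cut_hull_least: "S \<subseteq> cut_of x \<Longrightarrow> cut_hull S \<subseteq> cut_of x"
  using cut_hull_mono[of S "cut_of x"] by simp

lemma cut_hull_Inter: "cut_hull (\<Inter>(cut_of ` X)) = \<Inter>(cut_of ` X)"
  using cut_hull_extensive[of "\<Inter>(cut_of ` X)"] cut_hull_least[of "\<Inter>(cut_of ` X)"]
  by blast

instantiation macneille :: (order) complete_lattice
begin

definition "x \<le> y \<longleftrightarrow> cut_of x \<subseteq> cut_of y"
definition "x < y \<longleftrightarrow> cut_of x \<subset> cut_of y"
definition "Inf X = mk_cut (\<Inter>(cut_of ` X))"
definition "Sup X = mk_cut (cut_hull (\<Union>(cut_of ` X)))"
definition "inf x y = mk_cut (cut_of x \<inter> cut_of y)"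
definition "sup x y = mk_cut (cut_hull (cut_of x \<union> cut_of y))"
definition "bot = mk_cut (cut_hull {})"
definition "top = mk_cut UNIV"

lemma cut_of_Inf: "cut_of (Inf X) = \<Inter>(cut_of ` X)"
  by (simp add: Inf_macneille_def cut_of_mk_cut cut_hull_Inter)

lemma cut_of_Sup: "cut_of (Sup X) = cut_hull (\<Union>(cut_of ` X))"
  by (simp add: Sup_macneille_def cut_of_mk_cut cut_hull_idem)

lemma cut_of_inf: "cut_of (inf x y) = cut_of x \<inter> cut_of y"
  using cut_hull_Inter[of "{x, y}"] by (simp add: inf_macneille_def cut_of_mk_cut)

lemma cut_of_sup: "cut_of (sup x y) = cut_hull (cut_of x \<union> cut_of y)"
  by (simp add: sup_macneille_def cut_of_mk_cut cut_hull_idem)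

lemma cut_of_bot: "cut_of bot = cut_hull {}"
  by (simp add: bot_macneille_def cut_of_mk_cut cut_hull_idem)

lemma cut_of_top: "cut_of top = UNIV"
  unfolding top_macneille_def by (rule cut_of_mk_cut) (use cut_hull_Inter[of "{}"] in simp)

instance
proof
  fix x y z :: "'a macneille" and A :: "'a macneille set"
  show "x < y \<longleftrightarrow> x \<le> y \<and> \<not> y \<le> x"
    by (auto simp: less_macneille_def less_eq_macneille_def)
  show "x \<le> x" by (simp add: less_eq_macneille_def)
  show "x \<le> z" if "x \<le> y" "y \<le> z"
    using that unfolding less_eq_macneille_def by (rule subset_trans)
  show "x = y" if "x \<le> y" "y \<le> x"
    using that unfolding less_eq_macneille_def cut_of_inject[symmetric] by (rule subset_antisym)
  show "inf x y \<le> x" "inf x y \<le> y" by (auto simp: less_eq_macneille_def cut_of_inf)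
  show "x \<le> inf y z" if "x \<le> y" "x \<le> z"
    using that by (auto simp: less_eq_macneille_def cut_of_inf)
  show "x \<le> sup x y" "y \<le> sup x y"
    using cut_hull_extensive[of "cut_of x \<union> cut_of y"]
    by (auto simp: less_eq_macneille_def cut_of_sup)
  show "sup y z \<le> x" if "y \<le> x" "z \<le> x"
    using that cut_hull_least[of "cut_of y \<union> cut_of z" x]
    by (auto simp: less_eq_macneille_def cut_of_sup)
  show "Inf A \<le> x" if "x \<in> A" using that by (auto simp: less_eq_macneille_def cut_of_Inf)
  show "z \<le> Inf A" if "\<And>x. x \<in> A \<Longrightarrow> z \<le> x"
    using that by (auto simp: less_eq_macneille_def cut_of_Inf)
  show "x \<le> Sup A" if "x \<in> A"
    using that cut_hull_extensive[of "\<Union>(cut_of ` A)"]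
    by (auto simp: less_eq_macneille_def cut_of_Sup)
  show "Sup A \<le> z" if "\<And>x. x \<in> A \<Longrightarrow> x \<le> z"
    using that cut_hull_least[of "\<Union>(cut_of ` A)" z]
    by (auto simp: less_eq_macneille_def cut_of_Sup)
  show "Inf {} = (top :: 'a macneille)"
    by (simp add: Inf_macneille_def top_macneille_def)
  show "Sup {} = (bot :: 'a macneille)"
    by (simp add: Sup_macneille_def bot_macneille_def)
qed

end

lemma cut_hull_disjoint:
  "cut_hull {a :: 'a::boolean_algebra. \<forall>x\<in>S. inf a x = bot} = {a. \<forall>x\<in>S. inf a x = bot}"
    (is "cut_hull ?N = ?N")
proof
  show "cut_hull ?N \<subseteq> ?N"
  proof clarify
    fix a x assume a: "a \<in> cut_hull ?N" and x: "x \<in> S"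
    have "- x \<in> upper_bounds ?N"
      using x by (auto simp: upper_bounds_def inf_shunt)
    then have "a \<le> - x" using a by (auto simp: lower_bounds_def)
    then show "inf a x = bot" by (simp add: inf_shunt)
  qed
qed (rule cut_hull_extensive)

lemma cut_of_downward: "\<lbrakk>b \<in> cut_of x; a \<le> b\<rbrakk> \<Longrightarrow> a \<in> cut_of x"
proof -
  assume "b \<in> cut_of x" "a \<le> b"
  then have "b \<in> cut_hull (cut_of x)" by simp
  then have "a \<in> cut_hull (cut_of x)"
    using \<open>a \<le> b\<close> unfolding lower_bounds_def mem_Collect_eq by (blast intro: order_trans)
  then show "a \<in> cut_of x" by simp
qed

lemma inf_diff_eq_bot: "p \<le> u \<Longrightarrow> inf (inf a (- u)) p = bot" for p :: "'a::boolean_algebra"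
proof -
  assume "p \<le> u"
  then have "inf p (- u) = bot" using inf_shunt[of p "- u"] by simp
  moreover have "inf (inf a (- u)) p = inf a (inf p (- u))" by (simp only: inf_aci)
  ultimately show ?thesis by simp
qed

instantiation macneille :: (boolean_algebra) boolean_algebra
begin

definition "- x = mk_cut {a. \<forall>y\<in>cut_of x. inf a y = bot}"
definition "x - y = inf x (- (y :: 'a macneille))"

lemma cut_of_uminus: "cut_of (- x) = {a. \<forall>y\<in>cut_of x. inf a y = bot}"
  by (simp add: uminus_macneille_def cut_of_mk_cut cut_hull_disjoint)

instance
proof
  fix x y z :: "'a macneille"
  show "inf x (- x) = bot"
  proof -
    have bot: "cut_of (bot :: 'a macneille) = {bot}"
      by (auto simp: cut_of_bot upper_bounds_def lower_bounds_def intro: bot.extremum_uniqueI)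
    have "bot \<in> cut_of x"
      using cut_hull_cut_of[of x] by (auto simp: lower_bounds_def)
    then have "cut_of (inf x (- x)) = cut_of bot"
      unfolding bot cut_of_inf cut_of_uminus
      by (auto dest: bspec)
    then show ?thesis by (simp add: cut_of_inject)
  qed
  show "sup x (- x) = top"
  proof -
    have "u = top" if u: "u \<in> upper_bounds (cut_of x \<union> cut_of (- x))" for u
    proof -
      have "inf (- u) y = bot" if "y \<in> cut_of x" for y
      proof -
        have "y \<le> u" using u that by (auto simp: upper_bounds_def)
        then show ?thesis by (simp add: inf_shunt)
      qed
      then have "- u \<in> cut_of (- x)" by (auto simp: cut_of_uminus)
      then have "- u \<le> u" using u by (auto simp: upper_bounds_def)
      then have "sup u (- u) = u" by (rule sup_absorb1)
      then show "u = top" unfolding sup_compl_top by (rule sym)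
    qed
    then have "upper_bounds (cut_of x \<union> cut_of (- x)) \<subseteq> {top}" by blast
    then have "cut_of (sup x (- x)) = cut_of top"
      by (fastforce simp: cut_of_sup cut_of_top lower_bounds_def)
    then show ?thesis by (simp add: cut_of_inject)
  qed
  show "x - y = inf x (- y)" by (rule minus_macneille_def)
  show "sup x (inf y z) = inf (sup x y) (sup x z)"
  proof (rule antisym)
    show "inf (sup x y) (sup x z) \<le> sup x (inf y z)"
      unfolding less_eq_macneille_def
    proof
      fix a assume a: "a \<in> cut_of (inf (sup x y) (sup x z))"
      have a1: "a \<le> w" if "\<And>p. p \<in> cut_of x \<Longrightarrow> p \<le> w" "\<And>p. p \<in> cut_of y \<Longrightarrow> p \<le> w" for w
      proof -
        have "w \<in> upper_bounds (cut_of x \<union> cut_of y)"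
          using that by (auto simp: upper_bounds_def)
        then show ?thesis using a unfolding cut_of_inf cut_of_sup lower_bounds_def by blast
      qed
      have a2: "a \<le> w" if "\<And>p. p \<in> cut_of x \<Longrightarrow> p \<le> w" "\<And>p. p \<in> cut_of z \<Longrightarrow> p \<le> w" for w
      proof -
        have "w \<in> upper_bounds (cut_of x \<union> cut_of z)"
          using that by (auto simp: upper_bounds_def)
        then show ?thesis using a unfolding cut_of_inf cut_of_sup lower_bounds_def by blast
      qed
      show "a \<in> cut_of (sup x (inf y z))"
        unfolding cut_of_sup lower_bounds_def
      proof clarify
        fix u assume u: "u \<in> upper_bounds (cut_of x \<union> cut_of (inf y z))"
        define c where "c = inf a (- u)"
        have cx: "inf c p = bot" if "p \<in> cut_of x" for p
        proof -
          have "p \<le> u" using u that by (auto simp: upper_bounds_def)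
          then show ?thesis unfolding c_def by (rule inf_diff_eq_bot)
        qed
        have cyz: "inf (inf c p) q = bot" if "p \<in> cut_of y" "q \<in> cut_of z" for p q
        proof -
          have "inf p q \<in> cut_of (inf y z)"
            using cut_of_downward[OF that(1) inf_le1] cut_of_downward[OF that(2) inf_le2]
            by (simp add: cut_of_inf)
          then have "inf p q \<le> u" using u by (auto simp: upper_bounds_def)
          then have "inf c (inf p q) = bot" unfolding c_def by (rule inf_diff_eq_bot)
          then show ?thesis by (simp only: inf_assoc)
        qed
        have cy: "inf c p = bot" if p: "p \<in> cut_of y" for p
        proof -
          have "a \<le> - inf c p"
          proof (rule a2)
            show "q \<le> - inf c p" if "q \<in> cut_of x" for q
            proof -
              have "inf q (inf c p) = inf (inf c q) p" by (simp add: inf_aci)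
              then show ?thesis using cx[OF that] inf_shunt[of q "inf c p"] by simp
            qed
            show "q \<le> - inf c p" if "q \<in> cut_of z" for q
            proof -
              have "inf q (inf c p) = bot" using cyz[OF p that] by (simp add: inf_commute)
              then show ?thesis using inf_shunt[of q "inf c p"] by simp
            qed
          qed
          then have "inf a (inf c p) = bot" using inf_shunt[of a "inf c p"] by simp
          moreover have "inf a (inf c p) = inf c p" unfolding c_def by (simp add: inf_aci)
          ultimately show ?thesis by simp
        qed
        have "a \<le> - c"
        proof (rule a1)
          show "p \<le> - c" if "p \<in> cut_of x" for p
            using cx[OF that] inf_shunt[of p c] by (simp add: inf_commute)
          show "p \<le> - c" if "p \<in> cut_of y" for p
            using cy[OF that] inf_shunt[of p c] by (simp add: inf_commute)
        qed
        then have "inf a c = bot" using inf_shunt[of a c] by simp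
        then have "inf a (- u) = bot" unfolding c_def by simp
        then show "a \<le> u" using inf_shunt[of a "- u"] by simp
      qed
    qed
  next
    show "sup x (inf y z) \<le> inf (sup x y) (sup x z)"
      by (intro le_infI sup_mono order_refl inf_le1 inf_le2)
  qed
qed

end

text \<open>The canonical embedding into the completion sends \<open>a\<close> to the principal cut below \<open>a\<close>; it is
  a Boolean embedding with dense image, which determines the completion up to isomorphism.\<close>

definition cut_embed :: "'a::order \<Rightarrow> 'a macneille" where
  "cut_embed a = mk_cut {..a}"

definition boolean_hom :: "('a::boolean_algebra \<Rightarrow> 'b::boolean_algebra) \<Rightarrow> bool" where
  "boolean_hom f \<longleftrightarrow>
     (\<forall>x y. f (sup x y) = sup (f x) (f y)) \<and> (\<forall>x y. f (inf x y) = inf (f x) (f y)) \<and>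
     (\<forall>x. f (- x) = - f x) \<and> f bot = bot \<and> f top = top"

lemma boolean_homI:
  assumes "\<And>x y. f (sup x y) = sup (f x) (f y)" "\<And>x. f (- x) = - f x"
  shows "boolean_hom f"
proof -
  have top: "f top = top"
    by (metis assms sup_compl_top)
  have "f bot = bot"
    by (metis assms(2) top compl_top_eq)
  moreover have "f (inf x y) = inf (f x) (f y)" for x y
  proof -
    have "f (inf x y) = f (- sup (- x) (- y))" by simp
    also have "\<dots> = inf (f x) (f y)" unfolding assms by simp
    finally show ?thesis .
  qed
  ultimately show ?thesis using assms top by (simp add: boolean_hom_def)
qed

lemma cut_of_cut_embed: "cut_of (cut_embed a) = {..a}"
proof -
  have "cut_hull {..a} = {..a}"
    by (auto simp: upper_bounds_def lower_bounds_def)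
  then show ?thesis by (simp add: cut_embed_def cut_of_mk_cut)
qed

lemma cut_embed_le_iff: "cut_embed a \<le> cut_embed b \<longleftrightarrow> a \<le> b"
  by (simp add: less_eq_macneille_def cut_of_cut_embed)

lemma inj_cut_embed: "inj cut_embed"
  by (rule injI) (metis cut_embed_le_iff order_antisym order_refl)

lemma boolean_hom_cut_embed:
  "boolean_hom (cut_embed :: 'a::boolean_algebra \<Rightarrow> 'a macneille)"
proof (rule boolean_homI)
  fix x y :: 'a
  have "cut_of (cut_embed (sup x y)) = cut_of (sup (cut_embed x) (cut_embed y))"
  proof -
    have "upper_bounds ({..x} \<union> {..y}) = {sup x y..}"
      by (auto simp: upper_bounds_def intro: order_trans)
    then have "cut_hull ({..x} \<union> {..y}) = {..sup x y}"
      by (simp only:) (auto simp only: lower_bounds_def atLeast_iff atMost_iff mem_Collect_eq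
          intro: order_trans)
    then show ?thesis
      by (simp add: cut_of_cut_embed cut_of_sup)
  qed
  then show "cut_embed (sup x y) = sup (cut_embed x) (cut_embed y)"
    by (simp add: cut_of_inject)
  have "a \<le> - x \<longleftrightarrow> (\<forall>y\<le>x. inf a y = bot)" for a
    by (metis bot.extremum_uniqueI inf_mono inf_shunt order_refl)
  then have "cut_of (cut_embed (- x)) = cut_of (- cut_embed x)"
    by (auto simp: cut_of_cut_embed cut_of_uminus)
  then show "cut_embed (- x) = - cut_embed x"
    by (simp add: cut_of_inject)
qed

lemmas cut_embed_hom = boolean_hom_cut_embed[unfolded boolean_hom_def]

lemma cut_embed_dense:
  fixes x :: "'a::boolean_algebra macneille"
  assumes "x \<noteq> bot"
  shows "\<exists>a. a \<noteq> bot \<and> cut_embed a \<le> x"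
proof -
  have eq: "cut_of x = {bot}" if "\<And>a. a \<in> cut_of x \<Longrightarrow> a = bot"
    using that cut_hull_cut_of[of x] by (auto simp: lower_bounds_def)
  have "cut_of (bot :: 'a macneille) = {bot}"
    by (auto simp: cut_of_bot upper_bounds_def lower_bounds_def intro: bot.extremum_uniqueI)
  then obtain a where a: "a \<in> cut_of x" "a \<noteq> bot"
    using assms eq cut_of_inject[of x bot] by metis
  have "{..a} \<subseteq> cut_of x"
    using cut_of_downward[OF a(1)] by blast
  then show ?thesis using a(2) by (auto simp: less_eq_macneille_def cut_of_cut_embed)
qed


section \<open>The nonzero integers\<close>

typedef nzint = "{n :: int. n \<noteq> 0}"
  morphisms int_of_nzint nzint
  by (rule exI[of _ 1]) simp

instantiation nzint :: linorder
begin

definition "p \<le> q \<longleftrightarrow> int_of_nzint p \<le> int_of_nzint q"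
definition "p < q \<longleftrightarrow> int_of_nzint p < int_of_nzint q"

instance
  by standard (auto simp: less_eq_nzint_def less_nzint_def int_of_nzint_inject)

end

definition nz_prev :: "nzint \<Rightarrow> nzint" where
  "nz_prev p = (GREATEST q. q < p)"

definition nz_next :: "nzint \<Rightarrow> nzint" where
  "nz_next p = (LEAST q. p < q)"

abbreviation nz_pos :: "nat \<Rightarrow> nzint" where
  "nz_pos r \<equiv> nzint (int r)"

abbreviation nz_neg :: "nat \<Rightarrow> nzint" where
  "nz_neg r \<equiv> nzint (- int r)"

lemma int_of_nzint_next:
  "int_of_nzint (nz_next p) = (if int_of_nzint p = -1 then 1 else int_of_nzint p + 1)"
    (is "_ = ?m")
proof -
  have p: "int_of_nzint p \<noteq> 0" using int_of_nzint by auto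
  then have m: "int_of_nzint (nzint ?m) = ?m" by (auto simp: nzint_inverse)
  have "nz_next p = nzint ?m"
    unfolding nz_next_def
  proof (rule Least_equality)
    show "p < nzint ?m" using m by (auto simp: less_nzint_def)
    show "nzint ?m \<le> q" if "p < q" for q
      using that m int_of_nzint[of q] by (auto simp: less_nzint_def less_eq_nzint_def)
  qed
  then show ?thesis using m by simp
qed

lemma int_of_nzint_prev:
  "int_of_nzint (nz_prev p) = (if int_of_nzint p = 1 then -1 else int_of_nzint p - 1)"
    (is "_ = ?m")
proof -
  have p: "int_of_nzint p \<noteq> 0" using int_of_nzint by auto
  then have m: "int_of_nzint (nzint ?m) = ?m" by (auto simp: nzint_inverse)
  have "nz_prev p = nzint ?m"
    unfolding nz_prev_def
  proof (rule Greatest_equality)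
    show "nzint ?m < p" using m by (auto simp: less_nzint_def)
    show "q \<le> nzint ?m" if "q < p" for q
      using that m int_of_nzint[of q] by (auto simp: less_nzint_def less_eq_nzint_def)
  qed
  then show ?thesis using m by simp
qed


section \<open>The sum of countably many copies of the power set algebra\<close>

text \<open>The sum of the algebras \<open>P(\<int>\<^sub>0)\<close> is realised as the field of sets generated by the
  cylinders in the product of the underlying sets; \<open>sum_universal\<close> below is its universal
  property.  The summands are numbered from 1 and the coordinates of a point from 0, so
  \<open>sum_incl i\<close> is only meaningful for \<open>i \<ge> 1\<close>.\<close>

inductive_set cylinder_field :: "(nat \<Rightarrow> nzint) set set" where
  cylinder: "{x. x i \<in> S} \<in> cylinder_field"
| compl: "U \<in> cylinder_field \<Longrightarrow> - U \<in> cylinder_field"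
| union: "\<lbrakk>U \<in> cylinder_field; V \<in> cylinder_field\<rbrakk> \<Longrightarrow> U \<union> V \<in> cylinder_field"

typedef sum_alg = cylinder_field
  morphisms points_of mk_sum
  using cylinder_field.cylinder by blast

lemma cylinder_field_Int:
  "\<lbrakk>U \<in> cylinder_field; V \<in> cylinder_field\<rbrakk> \<Longrightarrow> U \<inter> V \<in> cylinder_field"
  using cylinder_field.compl[OF cylinder_field.union[of "- U" "- V"]]
  by (simp add: cylinder_field.compl)

lemma cylinder_field_empty: "{} \<in> cylinder_field"
  and cylinder_field_UNIV: "UNIV \<in> cylinder_field"
  using cylinder_field.cylinder[of undefined "{}"] cylinder_field.cylinder[of undefined UNIV]
  by auto

instantiation sum_alg :: boolean_algebra
begin

definition "a \<le> b \<longleftrightarrow> points_of a \<subseteq> points_of b"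
definition "a < b \<longleftrightarrow> points_of a \<subset> points_of b"
definition "inf a b = mk_sum (points_of a \<inter> points_of b)"
definition "sup a b = mk_sum (points_of a \<union> points_of b)"
definition "- a = mk_sum (- points_of a)"
definition "a - b = mk_sum (points_of a \<inter> - points_of b)"
definition "bot = mk_sum {}"
definition "top = mk_sum UNIV"

lemma points_of_simps [simp]:
  "points_of (inf a b) = points_of a \<inter> points_of b"
  "points_of (sup a b) = points_of a \<union> points_of b"
  "points_of (- a) = - points_of a"
  "points_of (a - b) = points_of a - points_of b"
  "points_of bot = {}"
  "points_of top = UNIV"
  unfolding inf_sum_alg_def sup_sum_alg_def uminus_sum_alg_def minus_sum_alg_def
    bot_sum_alg_def top_sum_alg_def
  by (auto simp: mk_sum_inverse points_of cylinder_field.intros cylinder_field_Int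
      cylinder_field_empty cylinder_field_UNIV)

instance
  by standard
    (auto simp: less_eq_sum_alg_def less_sum_alg_def points_of_inject[symmetric])

end

definition sum_incl :: "nat \<Rightarrow> nzint set \<Rightarrow> sum_alg" where
  "sum_incl i S = mk_sum {x. x (i - 1) \<in> S}"

lemma points_of_sum_incl: "points_of (sum_incl i S) = {x. x (i - 1) \<in> S}"
  by (simp add: sum_incl_def mk_sum_inverse cylinder_field.cylinder)

lemma boolean_hom_sum_incl: "boolean_hom (sum_incl i)"
  by (rule boolean_homI) (auto simp: points_of_inject[symmetric] points_of_sum_incl)

lemma inj_sum_incl: "inj (sum_incl i)"
proof (rule injI)
  fix S T assume "sum_incl i S = sum_incl i T"
  then have eq: "{x. x (i - 1) \<in> S} = {x. x (i - 1) \<in> T}"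
    by (metis points_of_sum_incl)
  have "p \<in> S \<longleftrightarrow> p \<in> T" for p
    using eq[THEN eqset_imp_iff, of "\<lambda>_. p"] by simp
  then show "S = T" by blast
qed

inductive sum_lift ::
  "(nat \<Rightarrow> nzint set \<Rightarrow> 'b::boolean_algebra) \<Rightarrow> (nat \<Rightarrow> nzint) set \<Rightarrow> 'b \<Rightarrow> bool" for f where
  cylinder: "sum_lift f {x. x i \<in> S} (f i S)"
| compl: "sum_lift f U b \<Longrightarrow> sum_lift f (- U) (- b)"
| union: "sum_lift f U b \<Longrightarrow> sum_lift f V c \<Longrightarrow> sum_lift f (U \<union> V) (sup b c)"

lemma sum_lift_decide:
  assumes "sum_lift f U b" and f: "\<And>i. boolean_hom (f i)"
  shows "\<And>c R. \<lbrakk>c \<noteq> bot; \<And>i. c \<le> f i (R i)\<rbrakk> \<Longrightarrow>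
    \<exists>c' R'. c' \<noteq> bot \<and> c' \<le> c \<and> (\<forall>i. R' i \<subseteq> R i \<and> c' \<le> f i (R' i)) \<and>
      ({x. \<forall>i. x i \<in> R' i} \<subseteq> U \<and> c' \<le> b \<or> {x. \<forall>i. x i \<in> R' i} \<subseteq> - U \<and> c' \<le> - b)"
  using assms(1)
proof (induction rule: sum_lift.induct)
  case (cylinder i S)
  have split: "\<exists>c' R'. c' \<noteq> bot \<and> c' \<le> c \<and> (\<forall>j. R' j \<subseteq> R j \<and> c' \<le> f j (R' j)) \<and>
      R' i \<subseteq> T \<and> c' \<le> f i T" if "inf c (f i T) \<noteq> bot" for T
  proof (intro exI conjI allI)
    show "inf c (f i T) \<noteq> bot" by (rule that)
    fix j
    show "(R(i := R i \<inter> T)) j \<subseteq> R j" by simp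
    have "f i (R i \<inter> T) = inf (f i (R i)) (f i T)"
      using f[of i] by (simp add: boolean_hom_def)
    then show "inf c (f i T) \<le> f j ((R(i := R i \<inter> T)) j)"
      using cylinder(2) by (auto intro: le_infI1)
  qed simp_all
  have "inf c (f i S) \<noteq> bot \<or> inf c (f i (- S)) \<noteq> bot"
  proof (rule ccontr)
    assume "\<not> ?thesis"
    then have "sup (inf c (f i S)) (inf c (- f i S)) = bot"
      using f[of i] by (simp add: boolean_hom_def)
    then have "c = bot" by (simp flip: inf_sup_distrib1)
    then show False using cylinder(1) by simp
  qed
  then obtain T where T: "T = S \<or> T = - S" "inf c (f i T) \<noteq> bot" by blast
  from split[OF T(2)] obtain c' R' where R': "c' \<noteq> bot" "c' \<le> c"
      "\<forall>j. R' j \<subseteq> R j \<and> c' \<le> f j (R' j)" "R' i \<subseteq> T" "c' \<le> f i T"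
    by (elim exE conjE) metis
  have sub: "{x. \<forall>j. x j \<in> R' j} \<subseteq> {x. x i \<in> T}" using R'(4) by blast
  have compl: "f i (- S) = - f i S" using f[of i] by (simp add: boolean_hom_def)
  from T(1) have "{x. \<forall>j. x j \<in> R' j} \<subseteq> {x. x i \<in> S} \<and> c' \<le> f i S \<or>
      {x. \<forall>j. x j \<in> R' j} \<subseteq> - {x. x i \<in> S} \<and> c' \<le> - f i S"
  proof
    assume "T = S"
    with sub R'(5) show ?thesis by (intro disjI1 conjI) simp_all
  next
    assume T: "T = - S"
    have "{x. \<forall>j. x j \<in> R' j} \<subseteq> - {x. x i \<in> S}" using sub unfolding T by blast
    moreover have "c' \<le> - f i S" using R'(5) unfolding T compl .
    ultimately show ?thesis by (intro disjI2 conjI)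
  qed
  with R'(1,2,3) show ?case by (intro exI[of _ c'] exI[of _ R'] conjI)
next
  case (compl U b)
  from compl.IH[OF compl.prems] show ?case
    unfolding double_complement double_compl disj_commute[of "_ \<subseteq> U \<and> _"] .
next
  case (union U b V d)
  let ?cube = "\<lambda>R. {x :: nat \<Rightarrow> nzint. \<forall>i. x i \<in> R i}"
  from union.IH(1)[OF union.prems] obtain c1 R1 where 1: "c1 \<noteq> bot" "c1 \<le> c"
      "\<forall>i. R1 i \<subseteq> R i \<and> c1 \<le> f i (R1 i)"
      "?cube R1 \<subseteq> U \<and> c1 \<le> b \<or> ?cube R1 \<subseteq> - U \<and> c1 \<le> - b"
    by (elim exE conjE)
  have le1: "c1 \<le> f i (R1 i)" for i using 1(3) by simp
  from union.IH(2)[OF 1(1) le1] obtain c2 R2 where 2: "c2 \<noteq> bot" "c2 \<le> c1"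
      "\<forall>i. R2 i \<subseteq> R1 i \<and> c2 \<le> f i (R2 i)"
      "?cube R2 \<subseteq> V \<and> c2 \<le> d \<or> ?cube R2 \<subseteq> - V \<and> c2 \<le> - d"
    by (elim exE conjE)
  have cube: "?cube R2 \<subseteq> ?cube R1" using 2(3) by blast
  have "?cube R2 \<subseteq> U \<union> V \<and> c2 \<le> sup b d \<or> ?cube R2 \<subseteq> - (U \<union> V) \<and> c2 \<le> - sup b d"
    using 1(4)
  proof
    assume "?cube R1 \<subseteq> U \<and> c1 \<le> b"
    then have "?cube R2 \<subseteq> U" "c2 \<le> b"
      using subset_trans[OF cube, of U] order_trans[OF 2(2), of b] by simp_all
    then show ?thesis by (intro disjI1 conjI le_supI1 le_supI1[where 'a = "(nat \<Rightarrow> nzint) set"])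
  next
    assume "?cube R1 \<subseteq> - U \<and> c1 \<le> - b"
    then have U: "?cube R2 \<subseteq> - U" "c2 \<le> - b"
      using subset_trans[OF cube, of "- U"] order_trans[OF 2(2), of "- b"] by simp_all
    from 2(4) show ?thesis
    proof
      assume "?cube R2 \<subseteq> V \<and> c2 \<le> d"
      then show ?thesis by (intro disjI1 conjI le_supI2 le_supI2[where 'a = "(nat \<Rightarrow> nzint) set"]) auto
    next
      assume "?cube R2 \<subseteq> - V \<and> c2 \<le> - d"
      with U show ?thesis unfolding Compl_Un compl_sup by (intro disjI2 conjI Int_greatest le_infI) auto
    qed
  qed
  moreover have "c2 \<le> c" using 2(2) 1(2) by (rule order_trans)
  moreover have "\<forall>i. R2 i \<subseteq> R i \<and> c2 \<le> f i (R2 i)" using 1(3) 2(3) by blast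
  ultimately show ?case using 2(1) by (intro exI[of _ c2] exI[of _ R2] conjI)
qed

lemma sum_lift_empty:
  assumes "sum_lift f {} b" and f: "\<And>i. boolean_hom (f i)"
  shows "b = bot"
proof (rule ccontr)
  assume b: "b \<noteq> bot"
  have "b \<le> f i UNIV" for i using f[of i] by (simp add: boolean_hom_def)
  from sum_lift_decide[OF assms b, of "\<lambda>_. UNIV", OF this]
  obtain c R where c: "c \<noteq> bot" "c \<le> b" "\<And>i. c \<le> f i (R i)"
      "{x. \<forall>i. x i \<in> R i} \<subseteq> {} \<and> c \<le> b \<or> c \<le> - b"
    by metis
  have "R i \<noteq> {}" for i
  proof
    assume "R i = {}"
    then have "c \<le> bot" using c(3)[of i] f[of i] by (simp add: boolean_hom_def)
    then show False using c(1) by (simp add: bot_unique)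
  qed
  then have "\<exists>x. \<forall>i. x i \<in> R i" by (intro choice) (simp add: ex_in_conv)
  then have "c \<le> - b" using c(4) by blast
  then have "c \<le> inf b (- b)" using c(2) by (intro le_infI)
  then show False using c(1) unfolding inf_compl_bot by (simp add: bot_unique)
qed

theorem sum_universal:
  fixes f :: "nat \<Rightarrow> nzint set \<Rightarrow> 'b::boolean_algebra"
  assumes f: "\<And>i. i \<ge> 1 \<Longrightarrow> boolean_hom (f i)"
  shows "\<exists>!g. boolean_hom g \<and> (\<forall>i\<ge>1. \<forall>S. g (sum_incl i S) = f i S)"
proof -
  define f' where "f' i = f (Suc i)" for i
  have f': "boolean_hom (f' i)" for i using f[of "Suc i"] by (simp add: f'_def)
  have ex: "\<exists>b. sum_lift f' U b" if "U \<in> cylinder_field" for U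
    using that by (induction rule: cylinder_field.induct) (blast intro: sum_lift.intros)+
  have le: "b \<le> c" if "sum_lift f' U b" "sum_lift f' U c" for U b c
  proof -
    have "sum_lift f' (- (- U \<union> U)) (- sup (- b) c)"
      by (intro sum_lift.intros that)
    then have "- sup (- b) c = bot" using f' by (intro sum_lift_empty[of f']) simp_all
    then have "inf b (- c) = bot" by simp
    then show ?thesis using inf_shunt[of b "- c"] by simp
  qed
  have uniq: "b = c" if "sum_lift f' U b" "sum_lift f' U c" for U b c
    using le that by (blast intro: order_antisym)
  define g where "g a = (THE b. sum_lift f' (points_of a) b)" for a
  have gI: "g a = b" if "sum_lift f' (points_of a) b" for a b
    unfolding g_def using that uniq by blast
  have g: "sum_lift f' (points_of a) (g a)" for a
    using ex[OF points_of[of a]] gI by metis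
  show ?thesis
  proof (rule ex1I)
    have "boolean_hom g"
    proof (rule boolean_homI)
      show "g (sup a b) = sup (g a) (g b)" for a b
        by (rule gI) (simp add: sum_lift.union g)
      show "g (- a) = - g a" for a
        by (rule gI) (simp add: sum_lift.compl g)
    qed
    moreover have "g (sum_incl i S) = f i S" if "i \<ge> 1" for i S
    proof (rule gI)
      show "sum_lift f' (points_of (sum_incl i S)) (f i S)"
        using sum_lift.cylinder[of f' "i - 1" S] that by (simp add: f'_def points_of_sum_incl)
    qed
    ultimately show "boolean_hom g \<and> (\<forall>i\<ge>1. \<forall>S. g (sum_incl i S) = f i S)" by blast
  next
    fix h assume h: "boolean_hom h \<and> (\<forall>i\<ge>1. \<forall>S. h (sum_incl i S) = f i S)"
    have lift: "sum_lift f' U (h (mk_sum U))" if "U \<in> cylinder_field" for U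
      using that
    proof (induction rule: cylinder_field.induct)
      case (cylinder i S)
      have "h (sum_incl (Suc i) S) = f' i S" using h by (simp add: f'_def)
      then show ?case using sum_lift.cylinder[of f' i S] by (simp add: sum_incl_def)
    next
      case (compl U)
      have "mk_sum (- U) = - mk_sum U"
        using compl.hyps by (simp add: uminus_sum_alg_def mk_sum_inverse)
      then show ?case using h compl.IH by (simp add: boolean_hom_def sum_lift.compl)
    next
      case (union U V)
      have "mk_sum (U \<union> V) = sup (mk_sum U) (mk_sum V)"
        using union.hyps by (simp add: sup_sum_alg_def mk_sum_inverse)
      then show ?case using h union.IH by (simp add: boolean_hom_def sum_lift.union)
    qed
    have "g a = h a" for a
      using lift[OF points_of[of a]] by (intro gI) (simp only: points_of_inverse)
    then show "h = g" by auto
  qed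
qed


section \<open>The algebra and its two relations\<close>

type_synonym A_tilde = "sum_alg macneille"

definition phi :: "nat \<Rightarrow> nzint set \<Rightarrow> A_tilde" where
  "phi i S = cut_embed (sum_incl i S)"

definition cell :: "nat \<Rightarrow> (nat \<Rightarrow> nzint) \<Rightarrow> A_tilde" where
  "cell k n = (INF i\<in>{1..k}. phi i {n i})"

definition B0 :: "A_tilde set" where
  "B0 = {cell k n | k n. k \<ge> 1}"

definition cell_prev :: "nat \<Rightarrow> (nat \<Rightarrow> nzint) \<Rightarrow> A_tilde" where
  "cell_prev k n = cell k (n(k := nz_prev (n k)))"

definition q_elem :: "nat \<Rightarrow> (nat \<Rightarrow> nzint) \<Rightarrow> nat \<Rightarrow> A_tilde" where
  "q_elem k n r = sup (inf (cell_prev k n) (phi (k + 1) {nz_pos r<..}))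
                 (inf (cell k n) (phi (k + 1) {..<nz_neg r}))"

definition B1 :: "A_tilde set" where
  "B1 = {q_elem k n r | k n r. k \<ge> 1 \<and> r \<ge> 1}"

text \<open>The representation of the elements of \<open>B0 \<union> B1\<close> is unique, up to the irrelevant values
  \<open>n i\<close> with \<open>i > k\<close> (\<open>i < 1\<close>); so the rules defining \<open>sigma_gen\<close> below characterise the
  pairs of generators of the respective forms.\<close>

lemma cell_rep: "\<exists>a. cell k n = cut_embed a \<and> points_of a = {x. \<forall>i\<in>{1..k}. x (i - 1) = n i}"
proof (induction k)
  case 0
  have "cell 0 n = cut_embed top"
    by (simp add: cell_def cut_embed_hom)
  then show ?case by (intro exI[of _ top]) simp
next
  case (Suc k)
  then obtain a where a: "cell k n = cut_embed a"
      "points_of a = {x. \<forall>i\<in>{1..k}. x (i - 1) = n i}" by blast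
  have "{1..Suc k} = insert (Suc k) {1..k}" by auto
  then have "cell (Suc k) n = inf (phi (Suc k) {n (Suc k)}) (cell k n)"
    by (simp add: cell_def)
  also have "\<dots> = cut_embed (inf (sum_incl (Suc k) {n (Suc k)}) a)"
    by (simp add: phi_def cut_embed_hom a(1))
  finally show ?case
    by (intro exI[of _ "inf (sum_incl (Suc k) {n (Suc k)}) a"])
      (auto simp: points_of_sum_incl a(2) atLeastAtMostSuc_conv)
qed

lemma q_elem_rep:
  assumes k: "k \<ge> 1"
  shows "\<exists>a. q_elem k n r = cut_embed a \<and>
    points_of a = {x. (\<forall>i\<in>{1..<k}. x (i - 1) = n i) \<and>
      (x (k - 1) = nz_prev (n k) \<and> x k > nz_pos r \<or> x (k - 1) = n k \<and> x k < nz_neg r)}"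
proof -
  obtain a where a: "cell k n = cut_embed a"
    "points_of a = {x. \<forall>i\<in>{1..k}. x (i - 1) = n i}" using cell_rep[of k n] by (elim exE conjE)
  obtain b where b: "cell_prev k n = cut_embed b"
    "points_of b = {x. \<forall>i\<in>{1..k}. x (i - 1) = (n(k := nz_prev (n k))) i}"
    using cell_rep[of k "n(k := nz_prev (n k))"] unfolding cell_prev_def by (elim exE conjE)
  let ?c = "sup (inf b (sum_incl (k + 1) {nz_pos r<..})) (inf a (sum_incl (k + 1) {..<nz_neg r}))"
  have "q_elem k n r = cut_embed ?c"
    by (simp add: q_elem_def phi_def cut_embed_hom a(1) b(1))
  moreover have "{1..k} = insert k {1..<k}" using k by auto
  then have "points_of ?c = {x. (\<forall>i\<in>{1..<k}. x (i - 1) = n i) \<and>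
      (x (k - 1) = nz_prev (n k) \<and> x k > nz_pos r \<or> x (k - 1) = n k \<and> x k < nz_neg r)}"
    by (auto simp: points_of_sum_incl a(2) b(2))
  ultimately show ?thesis by (intro exI[of _ ?c] conjI)
qed

definition coord_values :: "nat \<Rightarrow> A_tilde \<Rightarrow> nzint set" where
  "coord_values j c = (\<Union>a\<in>{a. c = cut_embed a}. (\<lambda>x. x j) ` points_of a)"

lemma coord_values_cut_embed: "coord_values j (cut_embed a) = (\<lambda>x. x j) ` points_of a"
  by (auto simp: coord_values_def inj_eq[OF inj_cut_embed])

lemma coord_values_cell:
  "coord_values j (cell k n) = (if j < k then {n (j + 1)} else UNIV)"
proof -
  obtain a where a: "cell k n = cut_embed a"
    "points_of a = {x. \<forall>i\<in>{1..k}. x (i - 1) = n i}" using cell_rep[of k n] by (elim exE conjE)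
  have "p \<in> (\<lambda>x. x j) ` points_of a" if "j < k \<Longrightarrow> p = n (j + 1)" for p
    using that by (intro image_eqI[of _ _ "\<lambda>i. if i = j then p else n (i + 1)"])
      (auto simp: a(2))
  moreover have "x j = n (j + 1)" if "x \<in> points_of a" "j < k" for x
    using that bspec[of "{1..k}" "\<lambda>i. x (i - 1) = n i" "j + 1"] by (simp add: a(2))
  ultimately show ?thesis unfolding a(1) coord_values_cut_embed by auto
qed

definition far_values :: "nat \<Rightarrow> nzint set" where
  "far_values r = {nz_pos r<..} \<union> {..<nz_neg r}"

lemma nz_pos_less_iff: "\<lbrakk>1 \<le> r; 1 \<le> s\<rbrakk> \<Longrightarrow> nz_pos r < nz_pos s \<longleftrightarrow> r < s"
  and nz_pos_eq_iff: "\<lbrakk>1 \<le> r; 1 \<le> s\<rbrakk> \<Longrightarrow> nz_pos r = nz_pos s \<longleftrightarrow> r = s"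
  and nz_pos_not_less_neg: "\<lbrakk>1 \<le> r; 1 \<le> s\<rbrakk> \<Longrightarrow> \<not> nz_pos r < nz_neg s"
  and nz_neg_less_iff: "\<lbrakk>1 \<le> r; 1 \<le> s\<rbrakk> \<Longrightarrow> nz_neg r < nz_neg s \<longleftrightarrow> s < r"
  by (auto simp: less_nzint_def nzint_inverse nzint_inject)

lemma nz_pos_in_far_values: "\<lbrakk>1 \<le> r; 1 \<le> s\<rbrakk> \<Longrightarrow> nz_pos s \<in> far_values r \<longleftrightarrow> r < s"
  by (simp add: far_values_def nz_pos_less_iff nz_pos_not_less_neg)

lemma nz_prev_less: "nz_prev p < p"
  by (simp add: less_nzint_def int_of_nzint_prev)

lemma coord_values_q_elem:
  assumes "k \<ge> 1" "r \<ge> 1"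
  shows "coord_values j (q_elem k n r) =
    (if j + 1 < k then {n (j + 1)}
     else if j + 1 = k then {nz_prev (n k), n k}
     else if j = k then far_values r else UNIV)"
proof -
  obtain a where a: "q_elem k n r = cut_embed a"
    "points_of a = {x. (\<forall>i\<in>{1..<k}. x (i - 1) = n i) \<and>
      (x (k - 1) = nz_prev (n k) \<and> x k > nz_pos r \<or> x (k - 1) = n k \<and> x k < nz_neg r)}"
    using q_elem_rep[OF assms(1), of n r] by (elim exE conjE)
  define f where "f p s i = (if i + 1 < k then n (i + 1) else if i + 1 = k then p else s)"
    for p s :: nzint and i :: nat
  have f1: "(f (nz_prev (n k)) s)(j := t) \<in> points_of a"
    if "k < j \<or> j = k \<and> t = s" "nz_pos r < s" for s t
    using that assms by (auto simp: a(2) f_def)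
  have f2: "(f (n k) s)(j := t) \<in> points_of a"
    if "k < j \<or> j = k \<and> t = s" "s < nz_neg r" for s t
    using that assms by (auto simp: a(2) f_def)
  have g1: "f (nz_prev (n k)) (nz_pos (r + 1)) \<in> points_of a"
    using assms by (auto simp: a(2) f_def nz_pos_less_iff simp del: of_nat_add of_nat_Suc)
  have g2: "f (n k) (nz_neg (r + 1)) \<in> points_of a"
    using assms by (auto simp: a(2) f_def nz_neg_less_iff simp del: of_nat_add of_nat_Suc)
  consider "j + 1 < k" | "j + 1 = k" | "j = k" | "j > k" by linarith
  then show ?thesis
  proof cases
    case 1
    have "x j = n (j + 1)" if "x \<in> points_of a" for x
      using that 1 bspec[of "{1..<k}" "\<lambda>i. x (i - 1) = n i" "j + 1"] by (simp add: a(2))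
    then have "(\<lambda>x. x j) ` points_of a = (\<lambda>x. n (j + 1)) ` points_of a"
      by (rule image_cong[OF refl])
    also have "\<dots> = {n (j + 1)}" using g1 by (intro image_constant)
    finally have "(\<lambda>x. x j) ` points_of a = {n (j + 1)}" .
    then show ?thesis using 1 unfolding a(1) coord_values_cut_embed by simp
  next
    case 2
    then have k: "k = j + 1" by simp
    have "(\<lambda>x. x j) ` points_of a \<subseteq> {nz_prev (n k), n k}"
      unfolding a(2) k by auto
    moreover have "nz_prev (n k) \<in> (\<lambda>x. x j) ` points_of a"
      using 2 by (intro image_eqI[OF _ g1]) (auto simp: f_def)
    moreover have "n k \<in> (\<lambda>x. x j) ` points_of a"
      using 2 by (intro image_eqI[OF _ g2]) (auto simp: f_def)
    ultimately show ?thesis using 2 unfolding a(1) coord_values_cut_embed by auto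
  next
    case 3
    have "(\<lambda>x. x j) ` points_of a \<subseteq> far_values r" by (auto simp: a(2) 3 far_values_def)
    moreover have "s \<in> (\<lambda>x. x j) ` points_of a" if s: "s \<in> far_values r" for s
      using s unfolding far_values_def
    proof
      assume "s \<in> {nz_pos r<..}"
      then show ?thesis using 3 by (intro image_eqI[OF _ f1[of s s]]) auto
    next
      assume "s \<in> {..<nz_neg r}"
      then show ?thesis using 3 by (intro image_eqI[OF _ f2[of s s]]) auto
    qed
    ultimately show ?thesis using 3 unfolding a(1) coord_values_cut_embed by auto
  next
    case 4
    have "t \<in> (\<lambda>x. x j) ` points_of a" for t
      using 4 assms by (intro image_eqI[OF _ f1[of t "nz_pos (r + 1)"]]) (auto simp: nz_pos_less_iff simp del: of_nat_add of_nat_Suc)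
    then show ?thesis using 4 unfolding a(1) coord_values_cut_embed by auto
  qed
qed

lemma far_values_not_small: "r \<ge> 1 \<Longrightarrow> \<not> far_values r \<subseteq> {a, b}"
proof
  assume r: "r \<ge> 1" "far_values r \<subseteq> {a, b}"
  have in_ab: "nz_pos (r + i) = a \<or> nz_pos (r + i) = b" if "i \<ge> 1" for i
    using nz_pos_in_far_values[of r "r + i"] r that by auto
  have "nz_pos (r + 1) \<noteq> nz_pos (r + 2)" "nz_pos (r + 1) \<noteq> nz_pos (r + 3)"
    "nz_pos (r + 2) \<noteq> nz_pos (r + 3)"
    using r(1) by (subst nz_pos_eq_iff; simp)+
  moreover have "nz_pos (r + 1) = a \<or> nz_pos (r + 1) = b" by (rule in_ab) simp
  moreover have "nz_pos (r + 2) = a \<or> nz_pos (r + 2) = b" by (rule in_ab) simp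
  moreover have "nz_pos (r + 3) = a \<or> nz_pos (r + 3) = b" by (rule in_ab) simp
  ultimately show False by metis
qed

lemma UNIV_not_small: "\<not> (UNIV :: nzint set) \<subseteq> {a, b}"
  using far_values_not_small[of 1 a b] by blast

lemma cell_eq_iff: "cell k n = cell l m \<longleftrightarrow> k = l \<and> (\<forall>i\<in>{1..k}. n i = m i)"
proof
  assume eq: "cell k n = cell l m"
  have *: "(if j < k then {n (j + 1)} else UNIV) = (if j < l then {m (j + 1)} else UNIV)" for j
    using eq by (metis coord_values_cell)
  have "\<not> k < l" using *[of k] UNIV_not_small[of "m (k + 1)" "m (k + 1)"] by auto
  moreover have "\<not> l < k" using *[of l] UNIV_not_small[of "n (l + 1)" "n (l + 1)"] by auto
  ultimately have kl: "k = l" by simp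
  have "n i = m i" if "i \<in> {1..k}" for i
    using *[of "i - 1"] that kl by (cases i) auto
  then show "k = l \<and> (\<forall>i\<in>{1..k}. n i = m i)" using kl by blast
qed (auto simp: cell_def)

lemma cell_neq_q_elem: "\<lbrakk>1 \<le> k; 1 \<le> r\<rbrakk> \<Longrightarrow> cell l m \<noteq> q_elem k n r"
proof
  assume kr: "1 \<le> k" "1 \<le> r" and eq: "cell l m = q_elem k n r"
  have *: "coord_values (k - 1) (cell l m) = {nz_prev (n k), n k}"
    unfolding eq using kr by (simp add: coord_values_q_elem)
  show False
    using * UNIV_not_small[of "nz_prev (n k)" "n k"] nz_prev_less[of "n k"]
    by (auto simp: coord_values_cell split: if_splits)
qed

lemma q_elem_eq_iff:
  assumes "1 \<le> k" "1 \<le> l" "1 \<le> r" "1 \<le> s"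
  shows "q_elem k n r = q_elem l m s \<longleftrightarrow> k = l \<and> r = s \<and> (\<forall>i\<in>{1..k}. n i = m i)"
proof
  assume eq: "q_elem k n r = q_elem l m s"
  have aux: "\<not> k < l" if "1 \<le> k" "1 \<le> l" "1 \<le> r" "1 \<le> s" "q_elem k n r = q_elem l m s"
    for k l n m r s
  proof
    assume "k < l"
    then have "\<exists>a b. coord_values k (q_elem l m s) \<subseteq> {a, b}"
      using that(2,4) by (auto simp: coord_values_q_elem)
    moreover have "coord_values k (q_elem k n r) = far_values r"
      using that(1,3) by (simp add: coord_values_q_elem)
    ultimately show False using that(5) far_values_not_small[OF that(3)] by auto
  qed
  have kl: "k = l" using aux[OF assms eq] aux[OF assms(2,1,4,3) eq[symmetric]] by simp
  have "far_values r = far_values s"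
    using arg_cong[OF eq, of "coord_values k"] assms kl by (simp add: coord_values_q_elem)
  then have "\<not> r < s" "\<not> s < r"
    using nz_pos_in_far_values[of r s] nz_pos_in_far_values[of s r]
      nz_pos_in_far_values[of s s] nz_pos_in_far_values[of r r] assms by auto
  then have rs: "r = s" by simp
  have "{nz_prev (n k), n k} = {nz_prev (m k), m k}"
    using arg_cong[OF eq, of "coord_values (k - 1)"] assms kl by (simp add: coord_values_q_elem)
  then have nk: "n k = m k"
    using nz_prev_less[of "n k"] nz_prev_less[of "m k"] by (auto simp: doubleton_eq_iff)
  have "n i = m i" if "i \<in> {1..k}" for i
  proof (cases "i = k")
    case False
    then show ?thesis
      using arg_cong[OF eq, of "coord_values (i - 1)"] assms kl that
      by (auto simp: coord_values_q_elem)
  qed (use nk in simp)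
  then show "k = l \<and> r = s \<and> (\<forall>i\<in>{1..k}. n i = m i)" using kl rs by blast
next
  assume A: "k = l \<and> r = s \<and> (\<forall>i\<in>{1..k}. n i = m i)"
  then have "cell k n = cell l m" "cell_prev k n = cell_prev l m"
    using assms by (auto simp: cell_prev_def cell_eq_iff)
  then show "q_elem k n r = q_elem l m s" using A by (simp add: q_elem_def)
qed

inductive sigma_gen :: "A_tilde \<Rightarrow> A_tilde \<Rightarrow> bool" where
  cell_cell: "\<lbrakk>1 \<le> k; k \<le> l; \<forall>i\<in>{1..<k}. n i = n' i;
     if k = l then n' k \<in> {nz_prev (n k), n k, nz_next (n k)} else n' k = n k\<rbrakk>
   \<Longrightarrow> sigma_gen (cell k n) (cell l n')"
| q_elem_q_elem: "\<lbrakk>1 \<le> k; k \<le> l; 1 \<le> r; 1 \<le> r'; \<forall>i\<in>{1..<k}. n i = n' i;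
     if l = k then n' k = n k
     else if l = k + 1 then
       (n' k = n k \<and> n' (k + 1) \<le> nz_neg r) \<or> (n' k = nz_prev (n k) \<and> n' (k + 1) > nz_pos r)
     else
       (n' k = n k \<and> n' (k + 1) < nz_neg r) \<or> (n' k = nz_prev (n k) \<and> n' (k + 1) > nz_pos r)\<rbrakk>
   \<Longrightarrow> sigma_gen (q_elem k n r) (q_elem l n' r')"
| q_elem_cell_gt: "\<lbrakk>1 \<le> l; l < k; 1 \<le> r; \<forall>i\<in>{1..l}. n i = n' i\<rbrakk>
   \<Longrightarrow> sigma_gen (q_elem k n r) (cell l n')"
| q_elem_cell_le: "\<lbrakk>1 \<le> k; k \<le> l; 1 \<le> r; \<forall>i\<in>{1..<k}. n i = n' i;
     if l = k then n' k \<in> {nz_prev (n k), n k}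
     else if l = k + 1 then
       (n' (k + 1) \<ge> nz_pos r \<and> n' k = nz_prev (n k)) \<or> (n' (k + 1) \<le> nz_neg r \<and> n' k = n k)
     else
       (n' (k + 1) > nz_pos r \<and> n' k = nz_prev (n k)) \<or> (n' (k + 1) < nz_neg r \<and> n' k = n k)\<rbrakk>
   \<Longrightarrow> sigma_gen (q_elem k n r) (cell l n')"
| sym: "sigma_gen a b \<Longrightarrow> sigma_gen b a"

definition lattice_ideal :: "'a::{lattice, order_bot} set \<Rightarrow> bool" where
  "lattice_ideal J \<longleftrightarrow> bot \<in> J \<and> (\<forall>x\<in>J. \<forall>y\<in>J. sup x y \<in> J) \<and> (\<forall>x\<in>J. \<forall>y\<le>x. y \<in> J)"

definition B_tilde :: "A_tilde set" where
  "B_tilde = \<Inter>{J. lattice_ideal J \<and> B0 \<union> B1 \<subseteq> J}"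

definition sigma_bounded :: "A_tilde \<Rightarrow> A_tilde \<Rightarrow> bool" where
  "sigma_bounded c d \<longleftrightarrow> \<not> (\<exists>F G. finite F \<and> F \<noteq> {} \<and> F \<subseteq> B0 \<union> B1 \<and>
     finite G \<and> G \<noteq> {} \<and> G \<subseteq> B0 \<union> B1 \<and> c \<le> Sup F \<and> d \<le> Sup G \<and>
     (\<forall>x\<in>F. \<forall>y\<in>G. \<not> sigma_gen x y))"

definition sigma :: "A_tilde \<Rightarrow> A_tilde \<Rightarrow> bool" where
  "sigma a b \<longleftrightarrow> (\<exists>c\<in>B_tilde. \<exists>d\<in>B_tilde. c \<le> a \<and> d \<le> b \<and> sigma_bounded c d)"

definition u_up :: "nat \<Rightarrow> A_tilde" where
  "u_up n = phi 1 {nz_pos n<..}"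

definition u_down :: "nat \<Rightarrow> A_tilde" where
  "u_down n = phi 1 {..<nz_neg n}"

definition B2 :: "A_tilde set" where
  "B2 = {u_up n | n. n \<ge> 1} \<union> {u_down n | n. n \<ge> 1}"

text \<open>The covering families may be empty here, with join \<open>0\<close>.  This matters for the pairs
  \<open>(0, 1)\<close> and \<open>(1, 0)\<close> only: no generator is separated from all members of a cover of \<open>1\<close>,
  so with nonempty families \<open>0\<close> would be in contact with \<open>1\<close>, against axiom \<open>C2\<close>.\<close>

definition sigma' :: "A_tilde \<Rightarrow> A_tilde \<Rightarrow> bool" where
  "sigma' c d \<longleftrightarrow> \<not> (\<exists>F G. finite F \<and> F \<subseteq> B0 \<union> B1 \<union> B2 \<and>
     finite G \<and> G \<subseteq> B0 \<union> B1 \<union> B2 \<and> c \<le> Sup F \<and> d \<le> Sup G \<and>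
     (\<forall>x\<in>F. \<forall>y\<in>G. \<not> sigma x y))"

end

theory Submission
  imports Defs
begin

text \<open>The elements of the completion are pictured as regular closed subsets of the unit interval, in such
  a way that \<open>sigma'\<close> becomes intersection.

  The open unit interval is divided into consecutive intervals that are indexed by the nonzero integers
  in their order and accumulate at the two ends; each of them is divided in the same way, and so on.
  The cell with coordinates \<open>n 1, \<dots>, n k\<close> is given the interval that is reached by choosing the
  \<open>n i\<close>-th subinterval at level \<open>i\<close>.  The open intervals are dense among the open sets of the unit
  interval, the cells are dense in the completion, and two cells are comparable or disjoint exactly if
  their open intervals are.  A complete Boolean algebra is determined by a dense part of it, so
  \<open>region x\<close>, the closure of the union of the open intervals of the cells below \<open>x\<close>, is an isomorphism
  onto the regular closed sets (locale \<open>matched_cells\<close>).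

  Under this isomorphism \<open>q_elem k n r\<close> becomes an interval around the left end of a cell, and \<open>u_up n\<close>
  and \<open>u_down n\<close> become intervals at the ends 1 and 0.  A comparison of end points shows that
  \<open>sigma_gen\<close> holds exactly if the intervals intersect (\<open>sigma_gen_imp_meet\<close> and
  \<open>meet_imp_sigma_gen\<close>).  The generators are arbitrarily small neighbourhoods of every point: a point
  inside cells of all levels has small cells around it, an end point of a cell has the elements
  \<open>q_elem k n r\<close>, and the two ends of the unit interval have the elements of \<open>B2\<close>.  By compactness,
  disjoint regions have disjoint finite covers by generators.  This is the definition of separation
  with respect to \<open>sigma'\<close>, so \<open>sigma'\<close> is intersection of regions (\<open>sigma'_iff\<close>).  The axioms of a
  complete normal contact algebra then hold because the unit interval is compact and Hausdorff.

  Finally, a compact Hausdorff space can be recovered from its regular closed sets and their contact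
  relation (\<open>contact_iso_imp_homeomorphic\<close>): the regular closed neighbourhoods of a point are taken by
  an isomorphism to sets with exactly one common point.\<close>

section \<open>Regular closed sets of a topological space\<close>

lemma RC_elems_iff: "F \<in> elems (RC X) \<longleftrightarrow> closedin X F \<and> F = X closure_of (X interior_of F)"
  by (simp add: RC_def)

lemma RC_closedin: "F \<in> elems (RC X) \<Longrightarrow> closedin X F"
  by (simp add: RC_elems_iff)

lemma RC_closure_of_interior_of: "F \<in> elems (RC X) \<Longrightarrow> X closure_of (X interior_of F) = F"
  by (simp add: RC_elems_iff)

lemma RC_closure_of_open:
  assumes "openin X U"
  shows "X closure_of U \<in> elems (RC X)"
proof -
  have "U \<subseteq> X interior_of (X closure_of U)"
    by (simp add: assms closure_of_subset interior_of_maximal openin_subset)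
  then have "X closure_of U \<subseteq> X closure_of (X interior_of (X closure_of U))"
    by (rule closure_of_mono)
  moreover have "X closure_of (X interior_of (X closure_of U)) \<subseteq> X closure_of U"
    by (intro closure_of_minimal interior_of_subset closedin_closure_of)
  ultimately show ?thesis by (auto simp: RC_elems_iff)
qed

lemma RC_Un:
  assumes "F \<in> elems (RC X)" "G \<in> elems (RC X)"
  shows "F \<union> G \<in> elems (RC X)"
proof -
  have "F \<union> G = X closure_of (X interior_of F \<union> X interior_of G)"
    using assms by (simp add: RC_closure_of_interior_of)
  then show ?thesis using RC_closure_of_open[of X "X interior_of F \<union> X interior_of G"]
    by (simp only: openin_Un openin_interior_of)
qed

lemma RC_subset_closedin:
  assumes "F \<in> elems (RC X)" "closedin X G" "X interior_of F \<subseteq> G"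
  shows "F \<subseteq> G"
  using assms closure_of_minimal[of "X interior_of F" G X] by (simp add: RC_closure_of_interior_of)

text \<open>An open set that meets \<open>F\<close> meets the interior of \<open>F\<close>, because \<open>F\<close> is the closure of its
  interior.\<close>

lemma openin_Int_RC:
  assumes "openin X U" "F \<in> elems (RC X)"
  shows "U \<inter> F = {} \<longleftrightarrow> U \<inter> X interior_of F = {}"
  using openin_Int_closure_of_eq_empty[OF assms(1), of "X interior_of F"] assms(2)
  by (simp add: RC_closure_of_interior_of)

text \<open>In a regular space every neighbourhood contains the closure of a smaller one, and the closure of
  an open set is regular closed.\<close>

lemma RC_base:
  assumes "regular_space X" "openin X V" "x \<in> V"
  obtains F where "F \<in> elems (RC X)" "x \<in> X interior_of F" "F \<subseteq> V"
proof -
  have "closedin X (topspace X - V)" "x \<in> topspace X - (topspace X - V)"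
    using assms openin_subset by blast+
  then obtain U where U: "openin X U" "x \<in> U" "disjnt (topspace X - V) (X closure_of U)"
    using assms(1) unfolding regular_space by metis
  show thesis
  proof
    show "X closure_of U \<in> elems (RC X)" using U(1) by (rule RC_closure_of_open)
    show "x \<in> X interior_of (X closure_of U)"
      using U interior_of_maximal[of U "X closure_of U" X]
      by (meson closure_of_subset openin_subset subsetD)
    show "X closure_of U \<subseteq> V"
      using U(3) closure_of_subset_topspace[of X U] by (auto simp: disjnt_iff)
  qed
qed

lemma RC_closure_of_interior_of_Int:
  assumes "F \<in> elems (RC X)" "x \<in> F" "x \<in> X interior_of G"
  shows "x \<in> X closure_of (X interior_of (F \<inter> G))"
  using openin_Int_closure_of_subset[OF openin_interior_of, of X G "X interior_of F"] assms
  by (auto simp: RC_closure_of_interior_of interior_of_Int Int_commute)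

text \<open>The Boolean operations are determined by the order, so an order isomorphism onto \<open>RC X\<close>
  is a Boolean isomorphism.\<close>

lemma order_iso_RC_imp_boolean_isomorphism:
  fixes f :: "'a::boolean_algebra \<Rightarrow> 'b set"
  assumes bij: "bij_betw f UNIV (elems (RC X))" and le: "\<And>x y. f x \<subseteq> f y \<longleftrightarrow> x \<le> y"
  shows "boolean_isomorphism type_balg (RC X) f"
proof -
  have rc: "f x \<in> elems (RC X)" for x using bij by (auto simp: bij_betw_def)
  have ex: "\<exists>x. f x = F" if "F \<in> elems (RC X)" for F
    using bij that unfolding bij_betw_def by (metis image_iff)
  have sub: "f x \<subseteq> topspace X" for x using rc RC_closedin closedin_subset by metis
  have "{} \<in> elems (RC X)" using RC_closure_of_open[of X "{}"] by simp
  then obtain b where "f b = {}" using ex by blast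
  then have bot: "f bot = {}" using le[of bot b] by simp
  have "topspace X \<in> elems (RC X)" using RC_closure_of_open[of X "topspace X"] by simp
  then obtain t where "f t = topspace X" using ex by blast
  then have top: "f top = topspace X" using le[of t top] sub[of top] by simp
  have sup: "f (sup x y) = f x \<union> f y" for x y
  proof
    obtain z where z: "f z = f x \<union> f y" using ex[OF RC_Un[OF rc[of x] rc[of y]]] by blast
    then have "sup x y \<le> z" using le by (metis Un_upper1 Un_upper2 le_sup_iff)
    then show "f (sup x y) \<subseteq> f x \<union> f y" using le z by metis
    show "f x \<union> f y \<subseteq> f (sup x y)" by (simp add: le)
  qed
  have inf: "f (inf x y) = X closure_of (X interior_of (f x \<inter> f y))" for x y
  proof
    have "f (inf x y) \<subseteq> f x \<inter> f y" by (simp add: le)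
    then have "X interior_of (f (inf x y)) \<subseteq> X interior_of (f x \<inter> f y)" by (rule interior_of_mono)
    then show "f (inf x y) \<subseteq> X closure_of (X interior_of (f x \<inter> f y))"
      using RC_closure_of_interior_of[OF rc] closure_of_mono by metis
    obtain z where z: "f z = X closure_of (X interior_of (f x \<inter> f y))"
      using ex[OF RC_closure_of_open[OF openin_interior_of]] by blast
    have "f z \<subseteq> f x \<inter> f y"
      unfolding z by (intro closure_of_minimal interior_of_subset closedin_Int RC_closedin rc)
    then have "z \<le> inf x y" using le by auto
    then show "X closure_of (X interior_of (f x \<inter> f y)) \<subseteq> f (inf x y)" using le z by metis
  qed
  have compl: "f (- x) = X closure_of (topspace X - f x)" for x
  proof
    have "X closure_of (X interior_of (f x \<inter> f (- x))) = {}" using inf[of x "- x"] bot by simp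
    then have "X interior_of (f x \<inter> f (- x)) = {}"
      using closure_of_subset[OF interior_of_subset_topspace, of X] by blast
    then have "X interior_of (f (- x)) \<inter> f x = {}"
      using openin_Int_RC[OF openin_interior_of rc, of "f (- x)" x] by (auto simp: interior_of_Int)
    then have "X interior_of (f (- x)) \<subseteq> topspace X - f x"
      using interior_of_subset_topspace[of X] by blast
    then show "f (- x) \<subseteq> X closure_of (topspace X - f x)"
      using RC_closure_of_interior_of[OF rc] closure_of_mono by metis
    have "topspace X \<subseteq> f x \<union> f (- x)" using sup[of x "- x"] top by simp
    then show "X closure_of (topspace X - f x) \<subseteq> f (- x)"
      by (intro closure_of_minimal RC_closedin rc) blast
  qed
  show ?thesis
    using bij bot top sup inf compl by (simp add: boolean_isomorphism_def type_balg_def RC_def)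
qed

lemma ba_le_type_balg [simp]: "ba_le type_balg x y \<longleftrightarrow> x \<le> y"
  by (simp add: ba_le_def type_balg_def le_iff_sup)

lemma complete_boolean_alg_type_balg:
  "complete_boolean_alg (type_balg :: 'a::{boolean_algebra, complete_lattice} balg)"
proof -
  have "boolean_alg (type_balg :: 'a balg)"
    by unfold_locales
      (auto simp: type_balg_def sup_assoc inf_assoc
        intro: sup_commute inf_commute inf_sup_distrib1 sup_inf_distrib1)
  moreover have "\<exists>s\<in>elems type_balg. (\<forall>x\<in>S. ba_le type_balg x s) \<and>
      (\<forall>u\<in>elems type_balg. (\<forall>x\<in>S. ba_le type_balg x u) \<longrightarrow> ba_le type_balg s u)" for S :: "'a set"
    by (intro bexI[of _ "Sup S"] conjI ballI impI)
      (simp_all add: Sup_upper Sup_least, simp add: type_balg_def)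
  ultimately show ?thesis by (simp add: complete_boolean_alg_def complete_boolean_alg_axioms_def)
qed

text \<open>The interpolation axiom holds because the space is normal, and the last axiom because it is
  regular: a nonempty open set contains a nonempty regular closed set.\<close>

lemma order_iso_RC_imp_complete_normal_contact_algebra:
  fixes f :: "'a::{boolean_algebra, complete_lattice} \<Rightarrow> 'b set"
  assumes bij: "bij_betw f UNIV (elems (RC X))" and le: "\<And>x y. f x \<subseteq> f y \<longleftrightarrow> x \<le> y"
    and X: "compact_space X" "Hausdorff_space X"
  shows "complete_normal_contact_algebra type_balg (\<lambda>x y. f x \<inter> f y \<noteq> {})"
proof -
  have iso: "boolean_isomorphism type_balg (RC X) f"
    using bij le by (rule order_iso_RC_imp_boolean_isomorphism)
  have rc: "f x \<in> elems (RC X)" for x using bij by (auto simp: bij_betw_def)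
  have ex: "\<exists>x. f x = F" if "F \<in> elems (RC X)" for F
    using bij that unfolding bij_betw_def by (metis image_iff)
  have bot: "f bot = {}" and top: "f top = topspace X"
    and sup: "\<And>x y. f (sup x y) = f x \<union> f y"
    and compl: "\<And>x. f (- x) = X closure_of (topspace X - f x)"
    using iso by (auto simp: boolean_isomorphism_def type_balg_def RC_def)
  have inj: "f x = f y \<longleftrightarrow> x = y" for x y using le[of x y] le[of y x] by auto
  interpret complete_boolean_alg "type_balg :: 'a balg" by (rule complete_boolean_alg_type_balg)
  have reg: "regular_space X" using X by (rule compact_Hausdorff_imp_regular_space)
  have normal: "normal_space X" using X compact_Hausdorff_or_regular_imp_normal_space by blast
  show ?thesis
  proof
    fix a b :: 'a
    assume "\<not> f a \<inter> f b \<noteq> {}"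
    then have ab: "f b \<subseteq> topspace X - f a" using closedin_subset[OF RC_closedin[OF rc]] by blast
    have "openin X (topspace X - f a)" using RC_closedin[OF rc] by blast
    then obtain V where V: "openin X V" "f b \<subseteq> V" "X closure_of V \<subseteq> topspace X - f a"
      using normal RC_closedin[OF rc[of b]] ab unfolding normal_space_alt by metis
    obtain c where c: "f c = X closure_of V" using ex[OF RC_closure_of_open[OF V(1)]] by blast
    have "V \<subseteq> f c" unfolding c by (simp add: V(1) closure_of_subset openin_subset)
    then have "f (- c) \<subseteq> topspace X - V"
      unfolding compl using V(1) by (intro closure_of_minimal) auto
    then have "f a \<inter> f c = {} \<and> f b \<inter> f (- c) = {}" using V c by blast
    then show "\<exists>c\<in>elems type_balg. \<not> f a \<inter> f c \<noteq> {} \<and> \<not> f b \<inter> f (compl type_balg c) \<noteq> {}"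
      by (intro bexI[of _ c]) (simp_all add: type_balg_def)
  next
    fix a :: 'a
    assume "a \<noteq> one type_balg"
    then have "f a \<noteq> topspace X" using inj[of a top] top by (simp add: type_balg_def)
    then obtain x where x: "x \<in> topspace X - f a" using closedin_subset[OF RC_closedin[OF rc]] by blast
    have "openin X (topspace X - f a)" using RC_closedin[OF rc] by blast
    from RC_base[OF reg this x] obtain F where F: "F \<in> elems (RC X)" "x \<in> X interior_of F"
        "F \<subseteq> topspace X - f a" .
    obtain b where b: "f b = F" using ex[OF F(1)] by blast
    have "x \<in> F" using F(2) interior_of_subset by fastforce
    then have "b \<noteq> bot" "f b \<inter> f a = {}" using F b bot by auto
    then show "\<exists>b\<in>elems type_balg. b \<noteq> zero type_balg \<and> \<not> f b \<inter> f a \<noteq> {}"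
      by (intro bexI[of _ b]) (simp_all add: type_balg_def)
  qed (auto simp: type_balg_def bot sup inj[of _ bot, unfolded bot])
qed

section \<open>Completions and regular closed sets\<close>

text \<open>A family of cells \<open>c\<close> in a complete Boolean algebra is matched with a family \<open>J\<close> of open sets of a
  space.  If both families are dense and the matching respects inclusion and disjointness, then the
  algebra is the algebra of regular closed sets: both are the completion of the same partial order.\<close>

locale matched_cells =
  fixes X :: "'p topology" and c :: "'i \<Rightarrow> 'a::{boolean_algebra, complete_lattice}"
    and J :: "'i \<Rightarrow> 'p set"
  assumes dense: "x \<noteq> bot \<Longrightarrow> \<exists>i. c i \<le> x"
    and openin_J: "openin X (J i)"
    and J_nonempty: "J i \<noteq> {}"
    and pi_base: "openin X V \<Longrightarrow> V \<noteq> {} \<Longrightarrow> \<exists>i. J i \<subseteq> V"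
    and J_mono: "c i \<le> c j \<Longrightarrow> J i \<subseteq> J j"
    and J_disjoint: "inf (c i) (c j) = bot \<Longrightarrow> J i \<inter> J j = {}"
begin

definition region :: "'a \<Rightarrow> 'p set" where
  "region x = X closure_of (\<Union>i\<in>{i. c i \<le> x}. J i)"

lemma openin_UN_J: "openin X (\<Union>i\<in>A. J i)"
  by (intro openin_Union) (use openin_J in auto)

lemma region_RC: "region x \<in> elems (RC X)"
  unfolding region_def by (intro RC_closure_of_open openin_UN_J)

lemma J_subset_region: "c i \<le> x \<Longrightarrow> J i \<subseteq> region x"
  unfolding region_def
  using closure_of_subset[OF openin_subset[OF openin_UN_J[of "{i. c i \<le> x}"]]] by blast

lemma region_cell: "region (c i) = X closure_of (J i)"
proof -
  have "(\<Union>j\<in>{j. c j \<le> c i}. J j) = J i" using J_mono by blast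
  then show ?thesis by (simp add: region_def)
qed

lemma region_subset_closedin:
  assumes "closedin X F" "\<And>i. c i \<le> x \<Longrightarrow> J i \<subseteq> F"
  shows "region x \<subseteq> F"
  unfolding region_def using assms by (intro closure_of_minimal) auto

text \<open>If \<open>x\<close> is not below \<open>y\<close>, some cell is below \<open>x\<close> and disjoint from \<open>y\<close>; its open set avoids
  every open set that counts for \<open>y\<close>.\<close>

lemma region_le_iff: "region x \<subseteq> region y \<longleftrightarrow> x \<le> y"
proof
  assume "x \<le> y"
  then show "region x \<subseteq> region y"
    unfolding region_def by (intro closure_of_mono) (auto intro: order_trans)
next
  assume sub: "region x \<subseteq> region y"
  show "x \<le> y"
  proof (rule ccontr)
    assume "\<not> x \<le> y"
    then have "inf x (- y) \<noteq> bot" using inf_shunt[of x "- y"] by simp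
    then obtain i where i: "c i \<le> x" "c i \<le> - y" using dense by fastforce
    have "J i \<subseteq> region y" using J_subset_region[OF i(1)] sub by blast
    then have "J i \<inter> (\<Union>j\<in>{j. c j \<le> y}. J j) \<noteq> {}"
      using openin_Int_closure_of_eq_empty[OF openin_J, of i "\<Union>j\<in>{j. c j \<le> y}. J j"] J_nonempty[of i]
      unfolding region_def by blast
    then obtain j where j: "c j \<le> y" "J i \<inter> J j \<noteq> {}" by blast
    have "inf (c i) (c j) \<le> inf (- y) y" using i(2) j(1) by (rule inf_mono)
    then have "inf (c i) (c j) = bot" by (simp add: bot_unique)
    then show False using J_disjoint j(2) by blast
  qed
qed

lemma common_cell: "J i \<inter> J j \<noteq> {} \<Longrightarrow> \<exists>k. c k \<le> c i \<and> c k \<le> c j"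
  using J_disjoint dense[of "inf (c i) (c j)"] by fastforce

text \<open>A regular closed set \<open>F\<close> is the region of the join \<open>x\<close> of all cells whose open set lies in
  \<open>F\<close>: a cell below \<open>x\<close> whose open set leaves \<open>F\<close> would have a subcell that is disjoint from all the
  cells joined.\<close>

lemma region_surj:
  assumes F: "F \<in> elems (RC X)"
  shows "\<exists>x. region x = F"
proof
  define x where "x = Sup {c i | i. J i \<subseteq> F}"
  have c_le: "c i \<le> x" if "J i \<subseteq> F" for i
    unfolding x_def using that by (intro Sup_upper) blast
  show "region x = F"
  proof
    show "region x \<subseteq> F"
    proof (rule region_subset_closedin)
      show "closedin X F" using F by (rule RC_closedin)
      fix d assume d: "c d \<le> x"
      show "J d \<subseteq> F"
      proof (rule ccontr)
        assume "\<not> J d \<subseteq> F"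
        moreover have "openin X (J d - F)" using RC_closedin[OF F] openin_J by (simp add: openin_diff)
        ultimately obtain i where i: "J i \<subseteq> J d - F" using pi_base by blast
        then obtain e where e: "c e \<le> c i" "c e \<le> c d" using common_cell[of i d] J_nonempty[of i] by blast
        have "c e \<noteq> bot" using J_disjoint[of e e] J_nonempty[of e] by auto
        moreover have "c e \<le> x" using e(2) d by (rule order_trans)
        ultimately have "\<not> x \<le> - c e"
          using inf_shunt[of "c e" "c e"] order_trans[of "c e" x "- c e"] by auto
        then obtain j where j: "J j \<subseteq> F" "\<not> c j \<le> - c e"
          unfolding x_def by (blast intro: Sup_least)
        then have "inf (c j) (c e) \<noteq> bot" by (simp add: inf_shunt)
        then obtain k where k: "c k \<le> c j" "c k \<le> c e" using dense by fastforce
        have "J k \<subseteq> F" using J_mono[OF k(1)] j(1) by (rule order_trans)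
        moreover have "J k \<subseteq> J i" by (rule J_mono[OF order_trans[OF k(2) e(1)]])
        ultimately show False using i J_nonempty[of k] by blast
      qed
    qed
    have "X interior_of F \<subseteq> region x"
    proof
      fix p assume p: "p \<in> X interior_of F"
      show "p \<in> region x"
        unfolding region_def in_closure_of
      proof (intro conjI allI impI)
        show "p \<in> topspace X" by (rule subsetD[OF interior_of_subset_topspace p])
        fix T assume T: "p \<in> T \<and> openin X T"
        obtain i where i: "J i \<subseteq> T \<inter> X interior_of F"
          using pi_base[OF openin_Int[OF _ openin_interior_of], of T F] T p by blast
        then have "c i \<le> x" using interior_of_subset[of X F] by (intro c_le) blast
        then show "\<exists>y. y \<in> (\<Union>i\<in>{i. c i \<le> x}. J i) \<and> y \<in> T" using i J_nonempty[of i] by blast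
      qed
    qed
    then show "F \<subseteq> region x" using RC_subset_closedin[OF F RC_closedin[OF region_RC]] by blast
  qed
qed

lemma bij_betw_region: "bij_betw region UNIV (elems (RC X))"
proof -
  have "inj region" using region_le_iff by (metis injI order_antisym order_refl)
  moreover have "range region = elems (RC X)" 
  proof
    show "range region \<subseteq> elems (RC X)" using region_RC by blast
    show "elems (RC X) \<subseteq> range region" using region_surj by blast
  qed
  ultimately show ?thesis by (simp add: bij_betw_def)
qed

lemma region_isomorphism: "boolean_isomorphism type_balg (RC X) region"
  using bij_betw_region region_le_iff by (rule order_iso_RC_imp_boolean_isomorphism)

lemma region_simps:
  shows region_bot: "region bot = {}"
    and region_sup: "region (sup x y) = region x \<union> region y"
    and region_inf: "region (inf x y) = X closure_of (X interior_of (region x \<inter> region y))"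
  using region_isomorphism by (simp_all add: boolean_isomorphism_def type_balg_def RC_def)

lemma region_Sup: "finite A \<Longrightarrow> region (Sup A) = (\<Union>x\<in>A. region x)"
  by (induction A rule: finite_induct) (simp_all add: region_bot region_sup)

lemma region_eq_empty_iff: "region x = {} \<longleftrightarrow> x = bot"
  using region_le_iff[of x bot] region_bot by (auto simp: bot_unique)

end

section \<open>Nested subdivisions of the unit interval\<close>

text \<open>The position of a nonzero integer if these are numbered, in their order, by all integers; it
  removes the exception that 1 follows -1.\<close>

definition idx :: "nzint \<Rightarrow> int" where
  "idx p = (if int_of_nzint p > 0 then int_of_nzint p - 1 else int_of_nzint p)"

lemma idx_less_iff [simp]: "idx p < idx q \<longleftrightarrow> p < q"
  using int_of_nzint[of p] int_of_nzint[of q] by (auto simp: idx_def less_nzint_def)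

lemma idx_le_iff [simp]: "idx p \<le> idx q \<longleftrightarrow> p \<le> q"
  by (simp flip: not_less)

lemma idx_eq_iff [simp]: "idx p = idx q \<longleftrightarrow> p = q"
  by (metis idx_le_iff order_antisym order_refl)

lemma idx_next [simp]: "idx (nz_next p) = idx p + 1"
  using int_of_nzint[of p] by (auto simp: idx_def int_of_nzint_next)

lemma idx_prev [simp]: "idx (nz_prev p) = idx p - 1"
  using int_of_nzint[of p] by (auto simp: idx_def int_of_nzint_prev)

lemma idx_surj: "\<exists>p. idx p = z"
proof
  show "idx (nzint (if z \<ge> 0 then z + 1 else z)) = z" by (simp add: idx_def nzint_inverse)
qed

lemma next_prev [simp]: "nz_next (nz_prev p) = p" and prev_next [simp]: "nz_prev (nz_next p) = p"
  by (simp_all flip: idx_eq_iff)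

lemma next_le_iff: "nz_next p \<le> q \<longleftrightarrow> p < q"
  unfolding idx_less_iff[symmetric] idx_le_iff[symmetric] idx_next by linarith

lemma next_less_next_iff [simp]: "nz_next p < nz_next q \<longleftrightarrow> p < q"
  and next_le_next_iff [simp]: "nz_next p \<le> nz_next q \<longleftrightarrow> p \<le> q"
  unfolding idx_less_iff[symmetric] idx_le_iff[symmetric] idx_next by linarith+

lemma less_next [simp]: "p < nz_next p"
  unfolding idx_less_iff[symmetric] idx_next by linarith

lemma neg_less_pos: "r \<ge> 1 \<Longrightarrow> s \<ge> 1 \<Longrightarrow> nz_neg r < nz_pos s"
  by (simp add: less_nzint_def nzint_inverse)

text \<open>A strictly increasing map from the nonzero integers into the open unit interval that comes
  arbitrarily close to both ends.  Its steps are at most 1/2, so the lengths of nested intervals tend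
  to 0.\<close>

definition grid :: "nzint \<Rightarrow> real" where
  "grid p = arctan (real_of_int (idx p)) / pi + 1 / 2"

lemma grid_less_iff [simp]: "grid p < grid q \<longleftrightarrow> p < q"
  by (simp add: grid_def divide_less_cancel arctan_less_iff)

lemma grid_bounds: "0 < grid p" "grid p < 1"
proof -
  have "- (1/2) < arctan (real_of_int (idx p)) / pi" "arctan (real_of_int (idx p)) / pi < 1/2"
    using arctan_bounded[of "real_of_int (idx p)"] by (simp_all add: field_simps)
  then show "0 < grid p" "grid p < 1" unfolding grid_def by linarith+
qed

lemma grid_step: "grid (nz_next p) - grid p \<le> 1 / 2"
proof -
  have "\<exists>z>real_of_int (idx p). z < real_of_int (idx p) + 1 \<and>
      arctan (real_of_int (idx p) + 1) - arctan (real_of_int (idx p)) =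
      (real_of_int (idx p) + 1 - real_of_int (idx p)) * inverse (1 + z\<^sup>2)"
    by (rule MVT2) (simp, rule DERIV_arctan)
  then obtain z :: real where "arctan (real_of_int (idx p) + 1) - arctan (real_of_int (idx p)) =
      inverse (1 + z\<^sup>2)" by auto
  moreover have "inverse (1 + z\<^sup>2) \<le> 1" by (simp add: inverse_le_1_iff)
  moreover have "(2::real) \<le> pi" by (rule pi_ge_two)
  ultimately have "arctan (real_of_int (idx p) + 1) - arctan (real_of_int (idx p)) \<le> 1 / 2 * pi" by simp
  moreover have "grid (nz_next p) - grid p =
      (arctan (real_of_int (idx p) + 1) - arctan (real_of_int (idx p))) / pi"
    by (simp add: grid_def diff_divide_distrib)
  ultimately show ?thesis by (simp only: pos_divide_le_eq[OF pi_gt_zero])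
qed

lemma grid_locate:
  assumes "0 < y" "y < 1"
  shows "\<exists>p. grid p \<le> y \<and> y < grid (nz_next p)"
proof -
  define z where "z = tan (pi * (y - 1 / 2))"
  have b: "- (pi / 2) < pi * (y - 1 / 2)" "pi * (y - 1 / 2) < pi / 2"
    using assms by (simp_all add: field_simps)
  have z: "arctan z = pi * (y - 1 / 2)" unfolding z_def using b by (intro arctan_tan) auto
  obtain p where p: "idx p = \<lfloor>z\<rfloor>" using idx_surj by blast
  have "arctan (real_of_int (idx p)) \<le> arctan z" unfolding arctan_le_iff p by linarith
  moreover have "arctan z < arctan (real_of_int (idx p + 1))" unfolding arctan_less_iff p by linarith
  ultimately show ?thesis
    unfolding z by (intro exI[of _ p]) (simp add: grid_def field_simps)
qed

lemma grid_near_ends: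
  assumes "e > 0"
  shows "\<exists>r\<ge>1. \<forall>s\<ge>r. grid (nz_neg s) < e \<and> 1 - e < grid (nz_next (nz_pos s))"
proof -
  define d where "d = min (1 / 2) (e / 2)"
  have d: "0 < d" "d < 1" "d < e" using assms by (auto simp: d_def min_def)
  obtain p where p: "grid p \<le> d" using grid_locate[of d] d by blast
  obtain q where q: "1 - d < grid (nz_next q)" using grid_locate[of "1 - d"] d by auto
  show ?thesis
  proof (intro exI[of _ "nat (1 + \<bar>int_of_nzint p\<bar> + \<bar>int_of_nzint q\<bar>)"] conjI allI impI)
    fix s assume s: "nat (1 + \<bar>int_of_nzint p\<bar> + \<bar>int_of_nzint q\<bar>) \<le> s"
    have "nz_neg s < p" "q < nz_pos s"
      using s by (simp_all add: less_nzint_def nzint_inverse)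
    then have "grid (nz_neg s) < grid p" "grid (nz_next q) < grid (nz_next (nz_pos s))" by simp_all
    then show "grid (nz_neg s) < e" "1 - e < grid (nz_next (nz_pos s))"
      using p q d by linarith+
  qed simp
qed

text \<open>The interval of the cell \<open>n 1, \<dots>, n k\<close> has left end \<open>lo k n\<close> and length \<open>len k n\<close>; the
  points \<open>division k n p\<close> subdivide it into the intervals of the cells of the next level.\<close>

primrec len :: "nat \<Rightarrow> (nat \<Rightarrow> nzint) \<Rightarrow> real" where
  "len 0 n = 1"
| "len (Suc k) n = len k n * (grid (nz_next (n (Suc k))) - grid (n (Suc k)))"

primrec lo :: "nat \<Rightarrow> (nat \<Rightarrow> nzint) \<Rightarrow> real" where
  "lo 0 n = 0"
| "lo (Suc k) n = lo k n + len k n * grid (n (Suc k))"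

definition hi :: "nat \<Rightarrow> (nat \<Rightarrow> nzint) \<Rightarrow> real" where
  "hi k n = lo k n + len k n"

definition division :: "nat \<Rightarrow> (nat \<Rightarrow> nzint) \<Rightarrow> nzint \<Rightarrow> real" where
  "division k n p = lo k n + len k n * grid p"

lemma lo_Suc_eq_division: "lo (Suc k) n = division k n (n (Suc k))"
  by (simp add: division_def)

lemma hi_Suc_eq_division: "hi (Suc k) n = division k n (nz_next (n (Suc k)))"
  by (simp add: division_def hi_def algebra_simps)

lemma len_pos: "0 < len k n"
  by (induction k) simp_all

lemma len_le: "len k n \<le> (1 / 2) ^ k"
proof (induction k)
  case (Suc k)
  have "len k n * (grid (nz_next (n (Suc k))) - grid (n (Suc k))) \<le> (1 / 2) ^ k * (1 / 2)"
    by (intro mult_mono Suc grid_step) (simp_all add: less_imp_le)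
  then show ?case by simp
qed simp

lemma len_le_1: "len k n \<le> 1"
  using len_le[of k n] power_le_one[of "1 / 2 :: real" k] by simp

lemma len_cong: "(\<And>i. 1 \<le> i \<Longrightarrow> i \<le> k \<Longrightarrow> n i = m i) \<Longrightarrow> len k n = len k m"
  by (induction k) simp_all

lemma lo_cong: "(\<And>i. 1 \<le> i \<Longrightarrow> i \<le> k \<Longrightarrow> n i = m i) \<Longrightarrow> lo k n = lo k m"
proof (induction k)
  case (Suc k)
  then show ?case using len_cong[of k n m] by simp
qed simp

lemma hi_cong: "(\<And>i. 1 \<le> i \<Longrightarrow> i \<le> k \<Longrightarrow> n i = m i) \<Longrightarrow> hi k n = hi k m"
  using lo_cong[of k n m] len_cong[of k n m] by (simp add: hi_def)

lemma division_cong: "(\<And>i. 1 \<le> i \<Longrightarrow> i \<le> k \<Longrightarrow> n i = m i) \<Longrightarrow> division k n = division k m"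
  using lo_cong[of k n m] len_cong[of k n m] by (simp add: division_def fun_eq_iff)

lemma lo_less_hi: "lo k n < hi k n"
  by (simp add: hi_def len_pos)

lemma division_less_iff [simp]: "division k n p < division k n q \<longleftrightarrow> p < q"
  by (simp add: division_def len_pos)

lemma division_le_iff [simp]: "division k n p \<le> division k n q \<longleftrightarrow> p \<le> q"
  by (simp flip: not_less)

lemma division_bounds: "lo k n < division k n p" "division k n p < hi k n"
  using len_pos[of k n] grid_bounds[of p] by (simp_all add: division_def hi_def)

lemma division_locate:
  assumes "lo k n < y" "y < hi k n"
  shows "\<exists>p. division k n p \<le> y \<and> y < division k n (nz_next p)"
proof -
  have "0 < (y - lo k n) / len k n" "(y - lo k n) / len k n < 1"
    using assms len_pos[of k n] by (simp_all add: hi_def field_simps)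
  then obtain p where "grid p \<le> (y - lo k n) / len k n" "(y - lo k n) / len k n < grid (nz_next p)"
    using grid_locate by blast
  then show ?thesis
    using len_pos[of k n] by (intro exI[of _ p]) (simp add: division_def field_simps)
qed

lemma strictly_nested: "j < k \<Longrightarrow> lo j n < lo k n \<and> hi k n < hi j n"
proof (induction k)
  case (Suc k)
  have "lo k n < lo (Suc k) n" "hi (Suc k) n < hi k n"
    by (simp_all only: lo_Suc_eq_division hi_Suc_eq_division division_bounds)
  then show ?case using Suc by (cases "j = k") auto
qed simp

lemma nested: "j \<le> k \<Longrightarrow> lo j n \<le> lo k n \<and> hi k n \<le> hi j n"
  using strictly_nested[of j k n] by (cases "j = k") auto

text \<open>At the first place where two sequences differ, their cells lie in different intervals of the
  same subdivision.\<close>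

lemma separated:
  assumes "1 \<le> i" "i \<le> k" "i \<le> l" "n i \<noteq> m i"
  shows "hi k n \<le> lo l m \<or> hi l m \<le> lo k n"
proof -
  have *: "hi k n \<le> lo l m"
    if "Suc j \<le> k" "Suc j \<le> l" "n (Suc j) < m (Suc j)" "\<And>i. 1 \<le> i \<Longrightarrow> i \<le> j \<Longrightarrow> n i = m i"
    for j k l n m
  proof -
    have "hi k n \<le> hi (Suc j) n" using nested that(1) by blast
    also have "\<dots> \<le> lo (Suc j) m"
      using that(3) division_cong[of j n m] that(4)
      by (simp only: hi_Suc_eq_division lo_Suc_eq_division division_le_iff next_le_iff)
    also have "\<dots> \<le> lo l m" using nested that(2) by blast
    finally show ?thesis .
  qed
  define i0 where "i0 = (LEAST i. 1 \<le> i \<and> n i \<noteq> m i)"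
  have i0: "1 \<le> i0" "n i0 \<noteq> m i0" "i0 \<le> i"
    using LeastI[of "\<lambda>i. 1 \<le> i \<and> n i \<noteq> m i" i] Least_le[of "\<lambda>i. 1 \<le> i \<and> n i \<noteq> m i" i] assms
    by (auto simp: i0_def)
  have eq: "n j = m j" if "1 \<le> j" "j < i0" for j
    using not_less_Least[of j "\<lambda>i. 1 \<le> i \<and> n i \<noteq> m i"] that by (auto simp: i0_def)
  obtain j where j: "i0 = Suc j" using i0(1) by (cases i0) auto
  have "Suc j \<le> k" "Suc j \<le> l" using i0(3) assms(2,3) j by auto
  moreover have "n i' = m i'" if "1 \<le> i'" "i' \<le> j" for i' using eq that j by auto
  moreover have "n (Suc j) < m (Suc j) \<or> m (Suc j) < n (Suc j)" using i0(2) j by auto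
  ultimately show ?thesis using *[of j k l n m] *[of j l k m n] by fastforce
qed

text \<open>The intervals of each level are dense: a point of an open set that happens to be a division point
  can be moved slightly to the right, into the open interval of a cell of the next level.\<close>

lemma open_meets_cells:
  assumes W: "open W" "W \<inter> {0<..<1} \<noteq> {}"
  shows "\<exists>n. W \<inter> {lo k n<..<hi k n} \<noteq> {}"
proof (induction k)
  case 0
  then show ?case using W(2) by (simp add: hi_def)
next
  case (Suc k)
  then obtain n y where y: "y \<in> W" "lo k n < y" "y < hi k n" by auto
  obtain p where p: "division k n p \<le> y" "y < division k n (nz_next p)"
    using division_locate[OF y(2,3)] by blast
  obtain d where d: "d > 0" "ball y d \<subseteq> W" using W(1) y(1) open_contains_ball by blast
  define z where "z = min (y + d / 2) ((y + division k n (nz_next p)) / 2)"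
  have z: "y < z" "z < y + d" "z < division k n (nz_next p)"
    using d(1) p(2) by (auto simp: z_def min_def)
  have eq: "division k (n(Suc k := p)) = division k n" by (rule division_cong) simp
  have "z \<in> W" using d(2) z by (auto simp: dist_real_def)
  moreover have "z \<in> {lo (Suc k) (n(Suc k := p))<..<hi (Suc k) (n(Suc k := p))}"
    using z p by (simp add: lo_Suc_eq_division hi_Suc_eq_division eq del: lo.simps)
  ultimately show ?case by blast
qed

lemma cell_interval_in_open:
  assumes W: "open W" "W \<inter> {0<..<1} \<noteq> {}"
  shows "\<exists>k n. {lo k n<..<hi k n} \<subseteq> W"
proof -
  obtain y where y: "y \<in> W" "0 < y" "y < 1" using W by auto
  obtain e where e: "e > 0" "ball y e \<subseteq> W" using W(1) y(1) open_contains_ball by blast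
  obtain k where k: "(1 / 2 :: real) ^ k < e / 2"
    using real_arch_pow_inv[of "e / 2" "1 / 2"] e(1) by auto
  have "ball y (e / 2) \<inter> {0<..<1} \<noteq> {}" using y e(1) by force
  then obtain n z where z: "z \<in> ball y (e / 2)" "lo k n < z" "z < hi k n"
    using open_meets_cells[of "ball y (e / 2)" k] by auto
  have "{lo k n<..<hi k n} \<subseteq> ball y e"
  proof
    fix x assume x: "x \<in> {lo k n<..<hi k n}"
    have "\<bar>y - z\<bar> < e / 2" using z(1) by (simp add: dist_real_def)
    moreover have "hi k n - lo k n < e / 2" using len_le[of k n] k by (simp add: hi_def)
    moreover have "lo k n < x" "x < hi k n" using x by auto
    ultimately have "\<bar>y - x\<bar> < e" using z(2,3) by linarith
    then show "x \<in> ball y e" by (simp add: dist_real_def)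
  qed
  then show ?thesis using e(2) by blast
qed

text \<open>The ends of the interval that belongs to \<open>q_elem k n r\<close>.  It reaches from the right part of the
  preceding cell to the left part of the cell, so it contains the common end of the two.\<close>

definition q_lo :: "nat \<Rightarrow> (nat \<Rightarrow> nzint) \<Rightarrow> nat \<Rightarrow> real" where
  "q_lo k n r = division k (n(k := nz_prev (n k))) (nz_next (nz_pos r))"

definition q_hi :: "nat \<Rightarrow> (nat \<Rightarrow> nzint) \<Rightarrow> nat \<Rightarrow> real" where
  "q_hi k n r = division k n (nz_neg r)"

lemma prev_cell_interval:
  "lo (Suc k) (n(Suc k := nz_prev (n (Suc k)))) = division k n (nz_prev (n (Suc k)))"
  "hi (Suc k) (n(Suc k := nz_prev (n (Suc k)))) = lo (Suc k) n"
proof -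
  have "division k (n(Suc k := nz_prev (n (Suc k)))) = division k n" by (rule division_cong) simp
  then show "lo (Suc k) (n(Suc k := nz_prev (n (Suc k)))) = division k n (nz_prev (n (Suc k)))"
    "hi (Suc k) (n(Suc k := nz_prev (n (Suc k)))) = lo (Suc k) n"
    by (simp_all add: lo_Suc_eq_division hi_Suc_eq_division del: lo.simps)
qed

lemma q_bounds:
  "division k n (nz_prev (n (Suc k))) < q_lo (Suc k) n r"
  "q_lo (Suc k) n r < lo (Suc k) n"
  "lo (Suc k) n < q_hi (Suc k) n r"
  "q_hi (Suc k) n r < hi (Suc k) n"
  using division_bounds[of "Suc k" "n(Suc k := nz_prev (n (Suc k)))" "nz_next (nz_pos r)"]
    division_bounds[of "Suc k" n "nz_neg r"]
  unfolding q_lo_def q_hi_def prev_cell_interval by auto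

text \<open>A point that is not a division point lies inside a cell of every level, and the cells shrink.  A
  division point is the left end of a cell, and the intervals of the elements \<open>q_elem k n r\<close> shrink to
  it as \<open>r\<close> grows.\<close>

lemma generator_neighbourhood:
  assumes y: "0 < y" "y < 1" and e: "e > 0"
  shows "(\<exists>k\<ge>1. \<exists>n. lo k n < y \<and> y < hi k n \<and> y - e < lo k n \<and> hi k n < y + e) \<or>
    (\<exists>k\<ge>1. \<exists>n. \<exists>r\<ge>1. q_lo k n r < y \<and> y < q_hi k n r \<and> y - e < q_lo k n r \<and> q_hi k n r < y + e)"
proof (cases "\<exists>k n p. y = division k n p")
  case True
  then obtain k n p where "y = division k n p" by blast
  moreover have "division k (n(Suc k := p)) = division k n" by (rule division_cong) simp
  ultimately have lo: "lo (Suc k) (n(Suc k := p)) = y" by (simp add: lo_Suc_eq_division del: lo.simps)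
  define m where "m = n(Suc k := p)"
  define m' where "m' = m(Suc k := nz_prev (m (Suc k)))"
  obtain r where r: "r \<ge> 1" "grid (nz_neg r) < e" "1 - e < grid (nz_next (nz_pos r))"
    using grid_near_ends[OF e] by blast
  have len1: "len (Suc k) m \<le> 1" "len (Suc k) m' \<le> 1"
    by (rule len_le_1)+
  have "q_hi (Suc k) m r < y + e"
  proof -
    have "len (Suc k) m * grid (nz_neg r) \<le> 1 * grid (nz_neg r)"
      using len1(1) grid_bounds(1)[of "nz_neg r"] by (intro mult_right_mono) auto
    then show ?thesis using r(2) lo unfolding q_hi_def division_def m_def by linarith
  qed
  moreover have "y - e < q_lo (Suc k) m r"
  proof -
    define a where "a = lo (Suc k) m'"
    define l where "l = len (Suc k) m'"
    define g where "g = grid (nz_next (nz_pos r))"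
    have "a + l = y"
      using prev_cell_interval(2)[of k m] lo by (simp only: m'_def hi_def m_def a_def l_def)
    moreover have "l * (1 - g) \<le> 1 * (1 - g)"
      using len1(2) grid_bounds(2)[of "nz_next (nz_pos r)"] unfolding l_def g_def
      by (intro mult_right_mono) auto
    moreover have "q_lo (Suc k) m r = a + l * g"
      by (simp only: q_lo_def division_def m'_def a_def l_def g_def)
    ultimately have "y - q_lo (Suc k) m r \<le> 1 - g" by (simp add: algebra_simps)
    moreover have "1 - e < g" using r(3) by (simp only: g_def)
    ultimately show ?thesis by linarith
  qed
  moreover have "q_lo (Suc k) m r < y" "y < q_hi (Suc k) m r"
    using q_bounds(2,3)[of k m r] lo unfolding m_def by linarith+
  moreover have "1 \<le> Suc k" by simp
  ultimately show ?thesis using r(1) by blast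
next
  case False
  have "\<exists>n. lo k n < y \<and> y < hi k n" for k
  proof (induction k)
    case 0
    then show ?case using y by (simp add: hi_def)
  next
    case (Suc k)
    then obtain n where n: "lo k n < y" "y < hi k n" by blast
    obtain p where p: "division k n p \<le> y" "y < division k n (nz_next p)"
      using division_locate[OF n] by blast
    have "division k (n(Suc k := p)) = division k n" by (rule division_cong) simp
    then have "lo (Suc k) (n(Suc k := p)) \<le> y" "y < hi (Suc k) (n(Suc k := p))"
      using p by (simp_all add: lo_Suc_eq_division hi_Suc_eq_division del: lo.simps)
    moreover have "lo (Suc k) (n(Suc k := p)) \<noteq> y"
      using False by (metis lo_Suc_eq_division)
    ultimately show ?case by (intro exI[of _ "n(Suc k := p)"]) linarith
  qed
  note inside = this
  obtain j where j: "(1 / 2 :: real) ^ j < e" using real_arch_pow_inv[of e "1 / 2"] e by auto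
  obtain n where n: "lo (Suc j) n < y" "y < hi (Suc j) n" using inside by blast
  have "len (Suc j) n < e" using len_le[of "Suc j" n] j e by simp
  then have "y - e < lo (Suc j) n" "hi (Suc j) n < y + e"
    using n unfolding hi_def by linarith+
  moreover have "1 \<le> Suc j" by simp
  ultimately show ?thesis using n by blast
qed

section \<open>Intersections of the intervals of generators\<close>

declare lo.simps(2) [simp del] len.simps(2) [simp del]

lemma le_prev_iff: "p \<le> nz_prev q \<longleftrightarrow> p < q"
  unfolding idx_less_iff[symmetric] idx_le_iff[symmetric] idx_prev by linarith

lemma adjacent_iff: "p \<le> nz_next q \<and> q \<le> nz_next p \<longleftrightarrow> q \<in> {nz_prev p, p, nz_next p}"
  unfolding insert_iff empty_iff idx_eq_iff[symmetric] idx_le_iff[symmetric] idx_prev idx_next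
  by arith

lemma cell_inside_parent: "lo k n < lo (Suc k) n" "hi (Suc k) n < hi k n"
  using strictly_nested[of k "Suc k" n] by simp_all

lemma q_inside_parent: "lo k n < q_lo (Suc k) n r" "q_hi (Suc k) n r < hi k n"
  using q_bounds(1,4)[of k n r] division_bounds(1)[of k n "nz_prev (n (Suc k))"]
    cell_inside_parent(2)[of k n] by linarith+

lemma separated_parents:
  assumes "\<not> (\<forall>i\<in>{1..<Suc j}. n i = m i)" "j \<le> h"
  shows "hi j n \<le> lo h m \<or> hi h m \<le> lo j n"
proof -
  obtain i where "1 \<le> i" "i \<le> j" "n i \<noteq> m i" using assms(1) by auto
  then show ?thesis using separated[of i j h n m] assms(2) by auto
qed

text \<open>The right hand sides of this and the following equivalences on meeting intervals are the
  conditions under which the rules of \<open>sigma_gen\<close> put two generators into relation.\<close>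

lemma cells_meet_iff:
  assumes "1 \<le> k" "k \<le> l"
  shows "lo k n \<le> hi l m \<and> lo l m \<le> hi k n \<longleftrightarrow> (\<forall>i\<in>{1..<k}. n i = m i) \<and>
    (if k = l then m k \<in> {nz_prev (n k), n k, nz_next (n k)} else m k = n k)"
proof -
  obtain j h where k: "k = Suc j" and l: "l = Suc h" and jh: "j \<le> h"
    using assms by (cases k; cases l) auto
  show ?thesis
  proof (cases "\<forall>i\<in>{1..<k}. n i = m i")
    case False
    then have "hi j n \<le> lo h m \<or> hi h m \<le> lo j n" using separated_parents jh unfolding k by blast
    then show ?thesis
      using cell_inside_parent[of j n] cell_inside_parent[of h m] False unfolding k l by auto
  next
    case True
    then have D: "division j m = division j n" unfolding k by (intro division_cong) auto
    have parent: "lo k m = division j n (m k)" "hi k m = division j n (nz_next (m k))"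
      "lo k n = division j n (n k)" "hi k n = division j n (nz_next (n k))"
      unfolding k lo_Suc_eq_division hi_Suc_eq_division D by simp_all
    show ?thesis
    proof (cases "k = l")
      case True
      then show ?thesis
        using \<open>\<forall>i\<in>{1..<k}. n i = m i\<close> parent adjacent_iff[of "n k" "m k"] by simp
    next
      case False
      then have inside: "lo k m < lo l m" "hi l m < hi k m"
        using strictly_nested[of k l m] assms(2) by auto
      have "m k = n k" if "lo k n \<le> hi l m" "lo l m \<le> hi k n"
      proof -
        have "division j n (n k) < division j n (nz_next (m k))"
          "division j n (m k) < division j n (nz_next (n k))"
          using that inside unfolding parent by linarith+
        then have "n k \<le> m k" "m k \<le> n k" unfolding division_less_iff by (simp_all flip: next_le_iff)
        then show ?thesis by simp
      qed
      moreover have "lo k n \<le> hi l m" "lo l m \<le> hi k n" if "m k = n k"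
        using inside lo_less_hi[of l m] unfolding parent that by linarith+
      ultimately show ?thesis using True False by auto
    qed
  qed
qed

text \<open>The part of the interval of \<open>q_elem (Suc j) n r\<close> to the right of the left end of the cell can
  only meet what lies inside the cell, the part to the left only what lies inside the preceding cell.\<close>

lemma q_meets_deeper_iff:
  assumes "\<forall>i\<in>{1..<Suc j}. n i = m i" and h: "Suc j \<le> h"
    and ab: "lo h m < a" "a < b" "b < hi h m"
  shows "q_lo (Suc j) n r \<le> b \<and> a \<le> q_hi (Suc j) n r \<longleftrightarrow>
    m (Suc j) = n (Suc j) \<and> a \<le> q_hi (Suc j) n r \<or>
    m (Suc j) = nz_prev (n (Suc j)) \<and> q_lo (Suc j) n r \<le> b"
proof -
  let ?p = "n (Suc j)" and ?q = "m (Suc j)"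
  have D: "division j m = division j n" using assms(1) by (intro division_cong) auto
  have parent: "lo (Suc j) m = division j n ?q" "hi (Suc j) m = division j n (nz_next ?q)"
    "lo (Suc j) n = division j n ?p" "hi (Suc j) n = division j n (nz_next ?p)"
    unfolding lo_Suc_eq_division hi_Suc_eq_division D by simp_all
  have inside: "division j n ?q < a" "b < division j n (nz_next ?q)"
    using nested[OF h, of m] ab unfolding parent by linarith+
  note q = q_bounds[of j n r, unfolded parent]
  have "?q = ?p \<or> ?q = nz_prev ?p" if "q_lo (Suc j) n r \<le> b" "a \<le> q_hi (Suc j) n r"
  proof -
    have "division j n (nz_prev ?p) < division j n (nz_next ?q)"
      "division j n ?q < division j n (nz_next ?p)"
      using that inside q by linarith+
    then have "nz_prev ?p < nz_next ?q" "?q < nz_next ?p" by simp_all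
    then show ?thesis
      unfolding idx_less_iff[symmetric] idx_eq_iff[symmetric] idx_prev idx_next by linarith
  qed
  moreover have "q_lo (Suc j) n r \<le> b" if "?q = ?p"
    using that inside ab(2) q by simp
  moreover have "a \<le> q_hi (Suc j) n r" if "?q = nz_prev ?p"
    using that inside ab(2) q by simp
  ultimately show ?thesis by blast
qed

lemma q_ends_in_subcell:
  assumes "\<forall>i\<in>{1..<Suc j}. n i = m i"
  shows "m (Suc j) = n (Suc j) \<Longrightarrow> q_hi (Suc j) n r = division (Suc j) m (nz_neg r)"
    and "m (Suc j) = nz_prev (n (Suc j)) \<Longrightarrow>
      q_lo (Suc j) n r = division (Suc j) m (nz_next (nz_pos r))"
proof -
  have "division (Suc j) n = division (Suc j) m" if "m (Suc j) = n (Suc j)"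
    using assms that by (intro division_cong) (auto simp: le_Suc_eq)
  then show "m (Suc j) = n (Suc j) \<Longrightarrow> q_hi (Suc j) n r = division (Suc j) m (nz_neg r)"
    by (simp add: q_hi_def)
  have "division (Suc j) (n(Suc j := nz_prev (n (Suc j)))) = division (Suc j) m"
    if "m (Suc j) = nz_prev (n (Suc j))"
    using assms that by (intro division_cong) (auto simp: le_Suc_eq)
  then show "m (Suc j) = nz_prev (n (Suc j)) \<Longrightarrow>
      q_lo (Suc j) n r = division (Suc j) m (nz_next (nz_pos r))"
    by (simp add: q_lo_def)
qed

text \<open>What lies strictly inside a subcell of a cell cannot touch a division point of the cell, so the
  inequalities between indices are strict.\<close>

lemma strictly_inside_meets_iff:
  assumes "Suc k \<le> h" and ab: "lo h m < a" "a < b" "b < hi h m"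
  shows "a \<le> division k m p \<longleftrightarrow> m (Suc k) < p"
    and "division k m (nz_next p) \<le> b \<longleftrightarrow> p < m (Suc k)"
proof -
  have inside: "division k m (m (Suc k)) < a" "b < division k m (nz_next (m (Suc k)))"
    using nested[OF assms(1), of m] ab unfolding lo_Suc_eq_division hi_Suc_eq_division by linarith+
  show "a \<le> division k m p \<longleftrightarrow> m (Suc k) < p"
  proof
    assume "a \<le> division k m p"
    then have "division k m (m (Suc k)) < division k m p" using inside by linarith
    then show "m (Suc k) < p" by simp
  next
    assume "m (Suc k) < p"
    then have "division k m (nz_next (m (Suc k))) \<le> division k m p" by (simp add: next_le_iff)
    then show "a \<le> division k m p" using inside ab(2) by linarith
  qed
  show "division k m (nz_next p) \<le> b \<longleftrightarrow> p < m (Suc k)"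
  proof
    assume "division k m (nz_next p) \<le> b"
    then have "division k m (nz_next p) < division k m (nz_next (m (Suc k)))" using inside by linarith
    then show "p < m (Suc k)" by simp
  next
    assume "p < m (Suc k)"
    then have "division k m (nz_next p) \<le> division k m (m (Suc k))" by (simp add: next_le_iff)
    then show "division k m (nz_next p) \<le> b" using inside ab(2) by linarith
  qed
qed

lemma q_meets_cell_above_iff:
  assumes "1 \<le> l" "l < k"
  shows "q_lo k n r \<le> hi l m \<and> lo l m \<le> q_hi k n r \<longleftrightarrow> (\<forall>i\<in>{1..l}. n i = m i)"
proof -
  obtain j where k: "k = Suc j" and lj: "l \<le> j" using assms(2) by (cases k) auto
  have q: "lo j n < q_lo k n r" "q_lo k n r < q_hi k n r" "q_hi k n r < hi j n"
    using q_inside_parent[of j n r] q_bounds(2,3)[of j n r] unfolding k by linarith+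
  show ?thesis
  proof
    assume meets: "q_lo k n r \<le> hi l m \<and> lo l m \<le> q_hi k n r"
    show "\<forall>i\<in>{1..l}. n i = m i"
    proof (rule ccontr)
      assume "\<not> ?thesis"
      then obtain i where "1 \<le> i" "i \<le> l" "n i \<noteq> m i" by auto
      then have "hi j n \<le> lo l m \<or> hi l m \<le> lo j n" using separated[of i j l n m] lj by auto
      then show False using meets q by linarith
    qed
  next
    assume "\<forall>i\<in>{1..l}. n i = m i"
    then have "lo l m = lo l n" "hi l m = hi l n" by (auto intro!: lo_cong hi_cong)
    then show "q_lo k n r \<le> hi l m \<and> lo l m \<le> q_hi k n r"
      using nested[OF lj, of n] q by linarith
  qed
qed

lemma q_meets_cell_iff:
  assumes "1 \<le> k" "k \<le> l"
  shows "q_lo k n r \<le> hi l m \<and> lo l m \<le> q_hi k n r \<longleftrightarrow> (\<forall>i\<in>{1..<k}. n i = m i) \<and>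
    (if l = k then m k \<in> {nz_prev (n k), n k}
     else if l = k + 1 then
       (m (k + 1) \<ge> nz_pos r \<and> m k = nz_prev (n k)) \<or> (m (k + 1) \<le> nz_neg r \<and> m k = n k)
     else
       (m (k + 1) > nz_pos r \<and> m k = nz_prev (n k)) \<or> (m (k + 1) < nz_neg r \<and> m k = n k))"
proof -
  obtain j h where k: "k = Suc j" and l: "l = Suc h" and jh: "j \<le> h"
    using assms by (cases k; cases l) auto
  show ?thesis
  proof (cases "\<forall>i\<in>{1..<k}. n i = m i")
    case False
    then have "hi j n \<le> lo h m \<or> hi h m \<le> lo j n" using separated_parents jh unfolding k by blast
    then have "\<not> (q_lo k n r \<le> hi l m \<and> lo l m \<le> q_hi k n r)"
      using q_inside_parent[of j n r] cell_inside_parent[of h m] unfolding k l by linarith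
    then show ?thesis using False by blast
  next
    case agree: True
    consider "l = k" | "l = k + 1" | "l > k + 1" using assms(2) by linarith
    then show ?thesis
    proof cases
      case 1
      have D: "division j m = division j n" using agree unfolding k by (intro division_cong) auto
      have parent: "lo k m = division j n (m k)" "hi k m = division j n (nz_next (m k))"
        "lo k n = division j n (n k)" "hi k n = division j n (nz_next (n k))"
        unfolding k lo_Suc_eq_division hi_Suc_eq_division D by simp_all
      note q = q_bounds[of j n r, folded k, unfolded parent]
      have "m k \<in> {nz_prev (n k), n k}" if "q_lo k n r \<le> hi k m" "lo k m \<le> q_hi k n r"
      proof -
        have "division j n (nz_prev (n k)) < division j n (nz_next (m k))"
          "division j n (m k) < division j n (nz_next (n k))"
          using that q unfolding parent by linarith+
        then have "nz_prev (n k) < nz_next (m k)" "m k < nz_next (n k)" by simp_all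
        then show ?thesis
          unfolding insert_iff empty_iff idx_less_iff[symmetric] idx_eq_iff[symmetric] idx_prev idx_next
          by linarith
      qed
      moreover have "q_lo k n r \<le> hi k m \<and> lo k m \<le> q_hi k n r" if "m k \<in> {nz_prev (n k), n k}"
        using that q unfolding parent by auto
      ultimately show ?thesis using agree 1 by auto
    next
      case 2
      then have h: "h = Suc j" using k l by simp
      have "m k = n k \<Longrightarrow> lo l m \<le> q_hi k n r \<longleftrightarrow> m (k + 1) \<le> nz_neg r"
        "m k = nz_prev (n k) \<Longrightarrow> q_lo k n r \<le> hi l m \<longleftrightarrow> m (k + 1) \<ge> nz_pos r"
        using q_ends_in_subcell[of j n m r] agree
        unfolding k l h lo_Suc_eq_division[of "Suc j"] hi_Suc_eq_division[of "Suc j"] by auto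
      moreover have "q_lo k n r \<le> hi l m \<and> lo l m \<le> q_hi k n r \<longleftrightarrow>
          m k = n k \<and> lo l m \<le> q_hi k n r \<or> m k = nz_prev (n k) \<and> q_lo k n r \<le> hi l m"
        using q_meets_deeper_iff[of j n m h "lo l m" "hi l m" r] agree h cell_inside_parent[of h m] lo_less_hi[of l m]
        unfolding k l by simp
      ultimately have "q_lo k n r \<le> hi l m \<and> lo l m \<le> q_hi k n r \<longleftrightarrow>
          m k = n k \<and> m (k + 1) \<le> nz_neg r \<or> m k = nz_prev (n k) \<and> m (k + 1) \<ge> nz_pos r" by blast
      then show ?thesis using agree 2 by auto
    next
      case 3
      then have h: "Suc (Suc j) \<le> h" using k l by simp
      have "m k = n k \<Longrightarrow> lo l m \<le> q_hi k n r \<longleftrightarrow> m (k + 1) < nz_neg r"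
        "m k = nz_prev (n k) \<Longrightarrow> q_lo k n r \<le> hi l m \<longleftrightarrow> m (k + 1) > nz_pos r"
        using q_ends_in_subcell[of j n m r] agree cell_inside_parent[of h m] lo_less_hi[of l m]
          strictly_inside_meets_iff[OF h, of m "lo l m" "hi l m"]
        unfolding k l by auto
      moreover have "q_lo k n r \<le> hi l m \<and> lo l m \<le> q_hi k n r \<longleftrightarrow>
          m k = n k \<and> lo l m \<le> q_hi k n r \<or> m k = nz_prev (n k) \<and> q_lo k n r \<le> hi l m"
        using q_meets_deeper_iff[of j n m h "lo l m" "hi l m" r] agree h cell_inside_parent[of h m] lo_less_hi[of l m]
        unfolding k l by simp
      ultimately have "q_lo k n r \<le> hi l m \<and> lo l m \<le> q_hi k n r \<longleftrightarrow>
          m k = n k \<and> m (k + 1) < nz_neg r \<or> m k = nz_prev (n k) \<and> m (k + 1) > nz_pos r" by blast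
      then show ?thesis using agree 3 by auto
    qed
  qed
qed

lemma qs_meet_iff:
  assumes "1 \<le> k" "k \<le> l" "1 \<le> r" "1 \<le> r'"
  shows "q_lo k n r \<le> q_hi l m r' \<and> q_lo l m r' \<le> q_hi k n r \<longleftrightarrow> (\<forall>i\<in>{1..<k}. n i = m i) \<and>
    (if l = k then m k = n k
     else if l = k + 1 then
       (m k = n k \<and> m (k + 1) \<le> nz_neg r) \<or> (m k = nz_prev (n k) \<and> m (k + 1) > nz_pos r)
     else
       (m k = n k \<and> m (k + 1) < nz_neg r) \<or> (m k = nz_prev (n k) \<and> m (k + 1) > nz_pos r))"
proof -
  obtain j h where k: "k = Suc j" and l: "l = Suc h" and jh: "j \<le> h"
    using assms by (cases k; cases l) auto
  let ?a = "q_lo l m r'" and ?b = "q_hi l m r'"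
  have ab: "lo h m < ?a" "?a < ?b" "?b < hi h m"
    using q_inside_parent[of h m r'] q_bounds(2,3)[of h m r'] unfolding l by linarith+
  show ?thesis
  proof (cases "\<forall>i\<in>{1..<k}. n i = m i")
    case False
    then have "hi j n \<le> lo h m \<or> hi h m \<le> lo j n" using separated_parents jh unfolding k by blast
    then have "\<not> (q_lo k n r \<le> ?b \<and> ?a \<le> q_hi k n r)"
      using q_inside_parent[of j n r] ab unfolding k by linarith
    then show ?thesis using False by blast
  next
    case agree: True
    consider "l = k" | "l = k + 1" | "l > k + 1" using assms(2) by linarith
    then show ?thesis
    proof cases
      case 1
      \<comment> \<open>If the cells are adjacent, both intervals reach into the first one, but the interval at its
        left end stops at subcells of negative index and the other one at subcells of positive index.\<close>
      have disjoint: "q_hi (Suc j) n r < q_lo (Suc j) m r'"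
        if "n (Suc j) < m (Suc j)" "\<forall>i\<in>{1..<Suc j}. n i = m i" "1 \<le> r" "1 \<le> r'" for n m r r'
      proof (cases "m (Suc j) = nz_next (n (Suc j))")
        case True
        then have "n (Suc j) = nz_prev (m (Suc j))" by simp
        then have "q_lo (Suc j) m r' = division (Suc j) n (nz_next (nz_pos r'))"
          using q_ends_in_subcell(2)[of j m n r'] that(2) by simp
        moreover have "nz_neg r < nz_next (nz_pos r')"
          using neg_less_pos[OF that(3,4)] less_next order_less_trans by blast
        ultimately show ?thesis by (simp add: q_hi_def)
      next
        case False
        then have "nz_next (n (Suc j)) \<le> nz_prev (m (Suc j))"
          using that(1) unfolding le_prev_iff by (simp add: next_le_iff order_less_le[of "nz_next _"])
        moreover have "division j m = division j n" using that(2) by (intro division_cong) auto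
        ultimately have "hi (Suc j) n \<le> division j m (nz_prev (m (Suc j)))"
          by (simp add: hi_Suc_eq_division)
        then show ?thesis using q_bounds(4)[of j n r] q_bounds(1)[of j m r'] by linarith
      qed
      have "m k = n k" if "q_lo k n r \<le> ?b" "?a \<le> q_hi k n r"
        using disjoint[of n m r r'] disjoint[of m n r' r] that agree assms(3,4) 1
        unfolding k by fastforce
      moreover have "q_lo k n r \<le> ?b \<and> ?a \<le> q_hi k n r" if "m k = n k"
      proof -
        have "lo k m = lo k n" using agree that unfolding k by (intro lo_cong) (auto simp: le_Suc_eq)
        then show ?thesis using q_bounds(2,3)[of j n r] q_bounds(2,3)[of j m r'] 1 unfolding k by auto
      qed
      ultimately show ?thesis using agree 1 by auto
    next
      case 2
      then have h: "h = Suc j" using k l by simp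
      have q: "division (Suc j) m (nz_prev (m (k + 1))) < ?a" "?a < division (Suc j) m (m (k + 1))"
        "division (Suc j) m (m (k + 1)) < ?b" "?b < division (Suc j) m (nz_next (m (k + 1)))"
        using q_bounds[of "Suc j" m r', unfolded lo_Suc_eq_division hi_Suc_eq_division]
        unfolding k l h by simp_all
      have "?a \<le> division (Suc j) m (nz_neg r) \<longleftrightarrow> m (k + 1) \<le> nz_neg r"
      proof
        assume "?a \<le> division (Suc j) m (nz_neg r)"
        then have "division (Suc j) m (nz_prev (m (k + 1))) < division (Suc j) m (nz_neg r)"
          using q by linarith
        then show "m (k + 1) \<le> nz_neg r"
          unfolding division_less_iff using le_prev_iff[of "nz_neg r" "m (k + 1)"] by auto
      next
        assume "m (k + 1) \<le> nz_neg r"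
        then have "division (Suc j) m (m (k + 1)) \<le> division (Suc j) m (nz_neg r)" by simp
        then show "?a \<le> division (Suc j) m (nz_neg r)" using q by linarith
      qed
      moreover have "division (Suc j) m (nz_next (nz_pos r)) \<le> ?b \<longleftrightarrow> m (k + 1) > nz_pos r"
      proof
        assume "division (Suc j) m (nz_next (nz_pos r)) \<le> ?b"
        then have "division (Suc j) m (nz_next (nz_pos r)) < division (Suc j) m (nz_next (m (k + 1)))"
          using q by linarith
        then show "m (k + 1) > nz_pos r" by simp
      next
        assume "m (k + 1) > nz_pos r"
        then have "division (Suc j) m (nz_next (nz_pos r)) \<le> division (Suc j) m (m (k + 1))"
          by (simp add: next_le_iff)
        then show "division (Suc j) m (nz_next (nz_pos r)) \<le> ?b" using q by linarith
      qed
      ultimately have "m k = n k \<Longrightarrow> ?a \<le> q_hi k n r \<longleftrightarrow> m (k + 1) \<le> nz_neg r"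
        "m k = nz_prev (n k) \<Longrightarrow> q_lo k n r \<le> ?b \<longleftrightarrow> m (k + 1) > nz_pos r"
        using q_ends_in_subcell[of j n m r] agree unfolding k by simp_all
      moreover have "q_lo k n r \<le> ?b \<and> ?a \<le> q_hi k n r \<longleftrightarrow>
          m k = n k \<and> ?a \<le> q_hi k n r \<or> m k = nz_prev (n k) \<and> q_lo k n r \<le> ?b"
        using q_meets_deeper_iff[of j n m h "?a" "?b" r] agree h ab
        unfolding k l by simp
      ultimately have "q_lo k n r \<le> ?b \<and> ?a \<le> q_hi k n r \<longleftrightarrow>
          m k = n k \<and> m (k + 1) \<le> nz_neg r \<or> m k = nz_prev (n k) \<and> m (k + 1) > nz_pos r" by blast
      then show ?thesis using agree 2 by auto
    next
      case 3
      then have h: "Suc (Suc j) \<le> h" using k l by simp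
      have "m k = n k \<Longrightarrow> ?a \<le> q_hi k n r \<longleftrightarrow> m (k + 1) < nz_neg r"
        "m k = nz_prev (n k) \<Longrightarrow> q_lo k n r \<le> ?b \<longleftrightarrow> m (k + 1) > nz_pos r"
        using q_ends_in_subcell[of j n m r] agree ab strictly_inside_meets_iff[OF h, of m ?a ?b]
        unfolding k l by auto
      moreover have "q_lo k n r \<le> ?b \<and> ?a \<le> q_hi k n r \<longleftrightarrow>
          m k = n k \<and> ?a \<le> q_hi k n r \<or> m k = nz_prev (n k) \<and> q_lo k n r \<le> ?b"
        using q_meets_deeper_iff[of j n m h "?a" "?b" r] agree h ab
        unfolding k l by simp
      ultimately have "q_lo k n r \<le> ?b \<and> ?a \<le> q_hi k n r \<longleftrightarrow>
          m k = n k \<and> m (k + 1) < nz_neg r \<or> m k = nz_prev (n k) \<and> m (k + 1) > nz_pos r" by blast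
      then show ?thesis using agree 3 by auto
    qed
  qed
qed

section \<open>Cells of the completion and their intervals\<close>

lemma cell_le_cut_embed_iff:
  "cell k n \<le> cut_embed a \<longleftrightarrow> {x. \<forall>i\<in>{1..k}. x (i - 1) = n i} \<subseteq> points_of a"
proof -
  obtain b where b: "cell k n = cut_embed b" "points_of b = {x. \<forall>i\<in>{1..k}. x (i - 1) = n i}"
    using cell_rep[of k n] by (elim exE conjE)
  show ?thesis unfolding b(1) cut_embed_le_iff less_eq_sum_alg_def b(2) by (rule refl)
qed

lemma cell_0: "cell 0 n = top"
  by (simp add: cell_def)

lemma cell_le_phi_iff:
  assumes "S \<noteq> UNIV"
  shows "cell l m \<le> phi (k + 1) S \<longleftrightarrow> k < l \<and> m (k + 1) \<in> S"
proof -
  have "{x. \<forall>i\<in>{1..l}. x (i - 1) = m i} \<subseteq> {x. x k \<in> S} \<longleftrightarrow> k < l \<and> m (k + 1) \<in> S"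
  proof
    assume "k < l \<and> m (k + 1) \<in> S"
    then show "{x. \<forall>i\<in>{1..l}. x (i - 1) = m i} \<subseteq> {x. x k \<in> S}" by (auto dest: bspec[of _ _ "Suc k"])
  next
    assume sub: "{x. \<forall>i\<in>{1..l}. x (i - 1) = m i} \<subseteq> {x. x k \<in> S}"
    obtain s where s: "s \<notin> S" using assms by blast
    define x where "x i = (if i < l then m (i + 1) else s)" for i
    have "x \<in> {x. \<forall>i\<in>{1..l}. x (i - 1) = m i}" by (auto simp: x_def)
    then have "x k \<in> S" using sub by blast
    then show "k < l \<and> m (k + 1) \<in> S" using s by (auto simp: x_def split: if_splits)
  qed
  then show ?thesis by (simp add: phi_def cell_le_cut_embed_iff points_of_sum_incl)
qed

lemma cell_le_cell_iff: "cell k n \<le> cell l m \<longleftrightarrow> l \<le> k \<and> (\<forall>i\<in>{1..l}. n i = m i)"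
proof -
  have "cell k n \<le> cell l m \<longleftrightarrow> (\<forall>i\<in>{1..l}. cell k n \<le> phi ((i - 1) + 1) {m i})"
    by (simp add: cell_def[of l] le_INF_iff)
  also have "\<dots> \<longleftrightarrow> (\<forall>i\<in>{1..l}. i - 1 < k \<and> n (i - 1 + 1) \<in> {m i})"
    using UNIV_not_small by (intro ball_cong refl cell_le_phi_iff) (metis insert_absorb2 subset_refl)
  also have "\<dots> \<longleftrightarrow> l \<le> k \<and> (\<forall>i\<in>{1..l}. n i = m i)" by (cases l) force+
  finally show ?thesis .
qed

lemma cylinder_field_finite_support:
  "U \<in> cylinder_field \<Longrightarrow> \<exists>k. \<forall>x y. (\<forall>i<k. x i = y i) \<longrightarrow> (x \<in> U \<longleftrightarrow> y \<in> U)"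
proof (induction rule: cylinder_field.induct)
  case (cylinder i S)
  show ?case by (rule exI[of _ "Suc i"]) auto
next
  case (compl U)
  then show ?case by simp
next
  case (union U V)
  then obtain k l where kl: "\<forall>x y. (\<forall>i<k. x i = y i) \<longrightarrow> (x \<in> U \<longleftrightarrow> y \<in> U)"
    "\<forall>x y. (\<forall>i<l. x i = y i) \<longrightarrow> (x \<in> V \<longleftrightarrow> y \<in> V)" by blast
  show ?case
  proof (intro exI[of _ "max k l"] allI impI)
    fix x y :: "nat \<Rightarrow> nzint" assume "\<forall>i<max k l. x i = y i"
    then have "\<forall>i<k. x i = y i" "\<forall>i<l. x i = y i" by simp_all
    then show "x \<in> U \<union> V \<longleftrightarrow> y \<in> U \<union> V" using kl by blast
  qed
qed

text \<open>An element of the cylinder field depends on finitely many coordinates, so it contains a cell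
  around each of its points.\<close>

lemma cell_dense:
  assumes "x \<noteq> bot"
  shows "\<exists>k n. cell k n \<le> x"
proof -
  obtain a where a: "a \<noteq> bot" "cut_embed a \<le> x" using cut_embed_dense[OF assms] by blast
  then obtain y where y: "y \<in> points_of a" using points_of_inject[of a bot] by auto
  obtain k where k: "\<forall>x y. (\<forall>i<k. x i = y i) \<longrightarrow> (x \<in> points_of a \<longleftrightarrow> y \<in> points_of a)"
    using cylinder_field_finite_support[OF points_of[of a]] by blast
  have "cell k (\<lambda>i. y (i - 1)) \<le> cut_embed a"
    unfolding cell_le_cut_embed_iff
  proof
    fix x assume x: "x \<in> {x. \<forall>i\<in>{1..k}. x (i - 1) = y (i - 1)}"
    have "x i = y i" if "i < k" for i using x that by (auto dest: bspec[of _ _ "Suc i"])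
    then show "x \<in> points_of a" using k y by blast
  qed
  then show ?thesis using a(2) by (meson order_trans)
qed

lemma cells_compatible:
  assumes "\<And>i. 1 \<le> i \<Longrightarrow> i \<le> k \<Longrightarrow> i \<le> l \<Longrightarrow> n i = m i"
  shows "inf (cell k n) (cell l m) \<noteq> bot"
proof -
  have *: "inf (cell k n) (cell l m) \<noteq> bot"
    if "k \<le> l" "\<And>i. 1 \<le> i \<Longrightarrow> i \<le> k \<Longrightarrow> n i = m i" for k l n m
  proof -
    have "cell l m \<le> cell k n" using that by (simp add: cell_le_cell_iff)
    moreover have "cell l m \<noteq> bot"
    proof
      assume "cell l m = bot"
      then have "cell l m \<le> cut_embed bot" by simp
      then have "{x. \<forall>i\<in>{1..l}. x (i - 1) = m i} = {}" by (simp add: cell_le_cut_embed_iff)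
      moreover have "(\<lambda>i. m (i + 1)) \<in> {x. \<forall>i\<in>{1..l}. x (i - 1) = m i}" by simp
      ultimately show False by (metis empty_iff)
    qed
    ultimately show ?thesis by (simp add: inf_absorb2)
  qed
  show ?thesis
  proof (cases "k \<le> l")
    case True
    then show ?thesis using assms by (intro *) simp_all
  next
    case False
    then have "inf (cell l m) (cell k n) \<noteq> bot" using assms by (intro *) simp_all
    then show ?thesis by (simp add: inf_commute)
  qed
qed

lemma cell_interval_bounds: "0 \<le> lo k n" "hi k n \<le> 1"
  using nested[of 0 k n] by (simp_all add: hi_def)

lemma interval_in_unit: "{lo k n<..<hi k n} \<subseteq> {0<..<1}"
  using cell_interval_bounds[of k n] by auto

text \<open>The open interval belongs to a cell; closing the union of these intervals gives the region of an
  arbitrary element of the completion.\<close>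

global_interpretation unit_cells: matched_cells "top_of_set {0..1::real}" "\<lambda>(k, n). cell k n"
    "\<lambda>(k, n). {lo k n<..<hi k n}"
  defines region = unit_cells.region
proof (unfold_locales, goal_cases)
  case (1 x)
  then show ?case using cell_dense by fastforce
next
  case (2 i)
  obtain k n where "i = (k, n)" by (cases i)
  then show ?case using interval_in_unit[of k n] by (auto intro!: open_subset)
next
  case (3 i)
  obtain k n where "i = (k, n)" by (cases i)
  then show ?case using lo_less_hi[of k n] by simp
next
  case (4 V)
  then obtain W where W: "open W" "V = {0..1} \<inter> W" by (auto simp: openin_open)
  have "W \<inter> closure {0<..<1} \<noteq> {}" using 4(2) W(2) by (simp add: Int_commute)
  then have "W \<inter> {0<..<1} \<noteq> {}" using open_Int_closure_eq_empty[OF W(1)] by blast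
  then obtain k n where "{lo k n<..<hi k n} \<subseteq> W" using cell_interval_in_open[OF W(1)] by blast
  moreover have "{0<..<1} \<subseteq> {0..1::real}" by auto
  ultimately have "{lo k n<..<hi k n} \<subseteq> V" using interval_in_unit[of k n] W(2) by blast
  then show ?case by (intro exI[of _ "(k, n)"]) simp
next
  case (5 i j)
  obtain k n l m where ij: "i = (k, n)" "j = (l, m)" by (cases i; cases j)
  then have "l \<le> k" "lo l n = lo l m" "hi l n = hi l m"
    using 5 by (auto simp: cell_le_cell_iff intro!: lo_cong hi_cong)
  then show ?case using nested[of l k n] ij by auto
next
  case (6 i j)
  obtain k n l m where ij: "i = (k, n)" "j = (l, m)" by (cases i; cases j)
  then obtain i' where "1 \<le> i'" "i' \<le> k" "i' \<le> l" "n i' \<noteq> m i'"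
    using 6 cells_compatible[of k l n m] by auto
  then have "hi k n \<le> lo l m \<or> hi l m \<le> lo k n" by (rule separated)
  then show ?case unfolding ij by auto
qed

lemma region_subset_unit: "region x \<subseteq> {0..1}"
  using closedin_subset[OF RC_closedin[OF unit_cells.region_RC]] by simp

lemma compact_region: "compact (region x)"
  by (rule closedin_compact[OF compact_Icc RC_closedin[OF unit_cells.region_RC]])

lemma closed_region: "closed (region x)"
  using compact_region by (rule compact_imp_closed)

lemma region_cell: "region (cell k n) = {lo k n..hi k n}"
proof -
  have "region (cell k n) = top_of_set {0..1} closure_of {lo k n<..<hi k n}"
    using unit_cells.region_cell[of "(k, n)"] by simp
  also have "\<dots> = {0..1} \<inter> closure ({0..1} \<inter> {lo k n<..<hi k n})"
    by (simp add: closure_of_subtopology)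
  also have "{0..1} \<inter> {lo k n<..<hi k n} = {lo k n<..<hi k n}"
    using cell_interval_bounds[of k n] by auto
  also have "closure {lo k n<..<hi k n} = {lo k n..hi k n}" using lo_less_hi by simp
  also have "{0..1} \<inter> {lo k n..hi k n} = {lo k n..hi k n}"
    using cell_interval_bounds[of k n] by auto
  finally show ?thesis .
qed

lemma closed_interval_subset_region:
  assumes "a < b" "{a<..<b} \<subseteq> region x"
  shows "{a..b} \<subseteq> region x"
  using closure_minimal[OF assms(2) closed_region] assms(1) by simp

lemma cell_le_slab_iff:
  assumes "S \<noteq> UNIV"
  shows "cell l m \<le> inf (cell k n) (phi (k + 1) S) \<longleftrightarrow>
    k < l \<and> (\<forall>i\<in>{1..k}. m i = n i) \<and> m (k + 1) \<in> S"
  using cell_le_phi_iff[OF assms, of l m k] by (auto simp: cell_le_cell_iff)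

text \<open>The subcells of a cell whose next coordinate lies in a final segment fill the interval of the
  cell from a division point to the right end; for an initial segment they fill it from the left end.\<close>

lemma region_slab_subset:
  assumes "S \<noteq> UNIV" and ab: "{a..b} \<subseteq> {0..1}"
    and sub: "\<And>q. q \<in> S \<Longrightarrow> a \<le> division k n q \<and> division k n (nz_next q) \<le> b"
  shows "region (inf (cell k n) (phi (k + 1) S)) \<subseteq> {a..b}"
proof (rule unit_cells.region_subset_closedin)
  show "closedin (top_of_set {0..1}) {a..b}" using ab by (rule closed_subset) simp
  fix i assume i: "(case i of (k, n) \<Rightarrow> cell k n) \<le> inf (cell k n) (phi (k + 1) S)"
  obtain l m where lm: "i = (l, m)" by (cases i)
  then have *: "k < l" "\<forall>i\<in>{1..k}. m i = n i" "m (Suc k) \<in> S"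
    using i cell_le_slab_iff[OF assms(1)] by auto
  have "division k m = division k n" using *(2) by (intro division_cong) auto
  then have "lo (Suc k) m = division k n (m (Suc k))" "hi (Suc k) m = division k n (nz_next (m (Suc k)))"
    by (simp_all add: lo_Suc_eq_division hi_Suc_eq_division)
  then have "a \<le> lo l m" "hi l m \<le> b"
    using nested[of "Suc k" l m] *(1) sub[OF *(3)] by linarith+
  then show "(case i of (k, n) \<Rightarrow> {lo k n<..<hi k n}) \<subseteq> {a..b}" using lm by auto
qed

lemma subcell_in_region_slab:
  assumes "q \<in> S" "S \<noteq> UNIV" "division k n q \<le> y" "y \<le> division k n (nz_next q)"
  shows "y \<in> region (inf (cell k n) (phi (k + 1) S))"
proof -
  have "division k (n(Suc k := q)) = division k n" by (rule division_cong) simp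
  then have "y \<in> region (cell (Suc k) (n(Suc k := q)))"
    using assms(3,4) by (simp add: region_cell lo_Suc_eq_division hi_Suc_eq_division)
  moreover have "cell (Suc k) (n(Suc k := q)) \<le> inf (cell k n) (phi (k + 1) S)"
    unfolding cell_le_slab_iff[OF assms(2)] using assms(1) by simp
  ultimately show ?thesis using unit_cells.region_le_iff by blast
qed

lemma region_upper_slab:
  "region (inf (cell k n) (phi (k + 1) {p<..})) = {division k n (nz_next p)..hi k n}"
proof
  have S: "{p<..} \<noteq> UNIV" by blast
  show "region (inf (cell k n) (phi (k + 1) {p<..})) \<subseteq> {division k n (nz_next p)..hi k n}"
  proof (rule region_slab_subset[OF S])
    show "{division k n (nz_next p)..hi k n} \<subseteq> {0..1}"
      using cell_interval_bounds[of k n] division_bounds(1)[of k n "nz_next p"] by auto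
    fix q assume "q \<in> {p<..}"
    then show "division k n (nz_next p) \<le> division k n q \<and> division k n (nz_next q) \<le> hi k n"
      using division_bounds(2)[of k n "nz_next q"] by (simp add: next_le_iff less_imp_le)
  qed
  show "{division k n (nz_next p)..hi k n} \<subseteq> region (inf (cell k n) (phi (k + 1) {p<..}))"
  proof (rule closed_interval_subset_region[OF division_bounds(2)], rule)
    fix y assume y: "y \<in> {division k n (nz_next p)<..<hi k n}"
    then have "lo k n < y" "y < hi k n" using division_bounds(1)[of k n "nz_next p"] by auto
    then obtain q where q: "division k n q \<le> y" "y < division k n (nz_next q)"
      using division_locate by blast
    have "division k n (nz_next p) < y" using y by simp
    then have "division k n (nz_next p) < division k n (nz_next q)" using q(2) by (rule order_less_trans)
    then have "q \<in> {p<..}" by simp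
    then show "y \<in> region (inf (cell k n) (phi (k + 1) {p<..}))"
      using S q(1) less_imp_le[OF q(2)] by (rule subcell_in_region_slab)
  qed
qed

lemma region_lower_slab:
  "region (inf (cell k n) (phi (k + 1) {..<p})) = {lo k n..division k n p}"
proof
  have S: "{..<p} \<noteq> UNIV" by blast
  show "region (inf (cell k n) (phi (k + 1) {..<p})) \<subseteq> {lo k n..division k n p}"
  proof (rule region_slab_subset[OF S])
    show "{lo k n..division k n p} \<subseteq> {0..1}"
      using cell_interval_bounds[of k n] division_bounds(2)[of k n p] by auto
    fix q assume "q \<in> {..<p}"
    then show "lo k n \<le> division k n q \<and> division k n (nz_next q) \<le> division k n p"
      using division_bounds(1)[of k n q] by (simp add: next_le_iff less_imp_le)
  qed
  show "{lo k n..division k n p} \<subseteq> region (inf (cell k n) (phi (k + 1) {..<p}))"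
  proof (rule closed_interval_subset_region[OF division_bounds(1)], rule)
    fix y assume y: "y \<in> {lo k n<..<division k n p}"
    then have "lo k n < y" "y < hi k n" using division_bounds(2)[of k n p] by auto
    then obtain q where q: "division k n q \<le> y" "y < division k n (nz_next q)"
      using division_locate by blast
    have "y < division k n p" using y by simp
    then have "division k n q < division k n p" by (rule order_le_less_trans[OF q(1)])
    then have "q \<in> {..<p}" by simp
    then show "y \<in> region (inf (cell k n) (phi (k + 1) {..<p}))"
      using S q(1) less_imp_le[OF q(2)] by (rule subcell_in_region_slab)
  qed
qed

lemma region_q_elem:
  assumes "1 \<le> k"
  shows "region (q_elem k n r) = {q_lo k n r..q_hi k n r}"
proof -
  obtain j where k: "k = Suc j" using assms by (cases k) auto
  have "region (q_elem k n r) = {q_lo k n r..lo k n} \<union> {lo k n..q_hi k n r}"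
    unfolding q_elem_def cell_prev_def unit_cells.region_sup region_upper_slab region_lower_slab
      q_lo_def q_hi_def k prev_cell_interval(2) ..
  also have "\<dots> = {q_lo k n r..q_hi k n r}" using q_bounds(2,3)[of j n r] unfolding k by auto
  finally show ?thesis .
qed

lemma region_u_up: "region (u_up r) = {grid (nz_next (nz_pos r))..1}"
  using region_upper_slab[of 0 undefined "nz_pos r"]
  by (simp add: u_up_def cell_0 division_def hi_def)

lemma region_u_down: "region (u_down r) = {0..grid (nz_neg r)}"
  using region_lower_slab[of 0 undefined "nz_neg r"]
  by (simp add: u_down_def cell_0 division_def)

lemma bounded_generator_inside: "g \<in> B0 \<union> B1 \<Longrightarrow> region g \<subseteq> {0<..<1}"
proof -
  have cell: "{lo (Suc j) n..hi (Suc j) n} \<subseteq> {0<..<1}" for j n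
    using cell_inside_parent[of j n] cell_interval_bounds[of j n] by auto
  have q: "{q_lo (Suc j) n r..q_hi (Suc j) n r} \<subseteq> {0<..<1}" for j n r
    using q_inside_parent[of j n r] cell_interval_bounds[of j n] by auto
  assume "g \<in> B0 \<union> B1"
  then show ?thesis
  proof
    assume "g \<in> B0"
    then obtain k n where "g = cell k n" "k \<ge> 1" by (auto simp: B0_def)
    then show ?thesis using cell[of "k - 1" n] by (simp add: region_cell)
  next
    assume "g \<in> B1"
    then obtain k n r where "g = q_elem k n r" "k \<ge> 1" by (auto simp: B1_def)
    then show ?thesis using q[of "k - 1" n r] by (simp add: region_q_elem)
  qed
qed

lemma q_lo_le_q_hi: "1 \<le> k \<Longrightarrow> q_lo k n r \<le> q_hi k n r"
  using q_bounds(2,3)[of "k - 1" n r] by (cases k) auto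

lemma generator_nonzero:
  assumes "g \<in> B0 \<union> B1 \<union> B2"
  shows "g \<noteq> bot"
proof -
  have "region (cell k n) \<noteq> {}" for k n using lo_less_hi[of k n] by (simp add: region_cell)
  moreover have "region (q_elem k n r) \<noteq> {}" if "k \<ge> 1" for k n r
    using q_lo_le_q_hi[OF that] that by (simp add: region_q_elem)
  moreover have "region (u_up r) \<noteq> {}" "region (u_down r) \<noteq> {}" for r
    using grid_bounds by (simp_all add: region_u_up region_u_down less_imp_le)
  ultimately have "region g \<noteq> {}" using assms unfolding B0_def B1_def B2_def by blast
  then show ?thesis by (simp add: unit_cells.region_eq_empty_iff)
qed

section \<open>Contact of generators\<close>

lemma intervals_meet_iff:
  fixes a b c d :: real
  assumes "a \<le> b" "c \<le> d"
  shows "{a..b} \<inter> {c..d} \<noteq> {} \<longleftrightarrow> a \<le> d \<and> c \<le> b"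
  using assms by auto

lemma region_cells_meet_iff:
  "region (cell k n) \<inter> region (cell l m) \<noteq> {} \<longleftrightarrow> lo k n \<le> hi l m \<and> lo l m \<le> hi k n"
  unfolding region_cell using lo_less_hi by (intro intervals_meet_iff) (auto intro: less_imp_le)

lemma region_q_cell_meet_iff:
  "1 \<le> k \<Longrightarrow> region (q_elem k n r) \<inter> region (cell l m) \<noteq> {} \<longleftrightarrow>
    q_lo k n r \<le> hi l m \<and> lo l m \<le> q_hi k n r"
  unfolding region_cell region_q_elem using lo_less_hi q_lo_le_q_hi
  by (intro intervals_meet_iff) (auto intro: less_imp_le)

lemma region_qs_meet_iff:
  "1 \<le> k \<Longrightarrow> 1 \<le> l \<Longrightarrow> region (q_elem k n r) \<inter> region (q_elem l m r') \<noteq> {} \<longleftrightarrow>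
    q_lo k n r \<le> q_hi l m r' \<and> q_lo l m r' \<le> q_hi k n r"
  unfolding region_q_elem using q_lo_le_q_hi by (intro intervals_meet_iff) auto

text \<open>On the generators in \<open>B0\<close> and \<open>B1\<close> the inductively defined relation is intersection of the
  regions.\<close>

lemma sigma_gen_imp_meet: "sigma_gen a b \<Longrightarrow> region a \<inter> region b \<noteq> {}"
proof (induction rule: sigma_gen.induct)
  case (cell_cell k l n n')
  then show ?case unfolding region_cells_meet_iff cells_meet_iff[OF cell_cell(1,2)] by blast
next
  case (q_elem_q_elem k l r r' n n')
  then have "1 \<le> l" by linarith
  then show ?case
    unfolding region_qs_meet_iff[OF q_elem_q_elem(1) \<open>1 \<le> l\<close>] qs_meet_iff[OF q_elem_q_elem(1-4)]
    using q_elem_q_elem(5,6) by blast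
next
  case (q_elem_cell_gt l k r n n')
  then have "1 \<le> k" by linarith
  then show ?case
    unfolding region_q_cell_meet_iff[OF \<open>1 \<le> k\<close>] q_meets_cell_above_iff[OF q_elem_cell_gt(1,2)]
    using q_elem_cell_gt(4) by blast
next
  case (q_elem_cell_le k l r n n')
  then show ?case
    unfolding region_q_cell_meet_iff[OF q_elem_cell_le(1)] q_meets_cell_iff[OF q_elem_cell_le(1,2)]
    by blast
next
  case (sym a b)
  then show ?case by (simp add: Int_commute)
qed

lemma meet_imp_sigma_gen:
  assumes "a \<in> B0 \<union> B1" "b \<in> B0 \<union> B1" "region a \<inter> region b \<noteq> {}"
  shows "sigma_gen a b"
proof -
  have cells: "sigma_gen (cell k n) (cell l m)"
    if "region (cell k n) \<inter> region (cell l m) \<noteq> {}" "1 \<le> k" "k \<le> l" for k n l m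
    using that(1) unfolding region_cells_meet_iff cells_meet_iff[OF that(2,3)]
    by (elim conjE) (rule sigma_gen.cell_cell[OF that(2,3)])
  have qs: "sigma_gen (q_elem k n r) (q_elem l m r')"
    if "region (q_elem k n r) \<inter> region (q_elem l m r') \<noteq> {}" "1 \<le> k" "k \<le> l" "1 \<le> r" "1 \<le> r'" for k n l m r r'
    using that(1) unfolding region_qs_meet_iff[OF that(2) order_trans[OF that(2,3)]] qs_meet_iff[OF that(2-5)]
    by (elim conjE) (rule sigma_gen.q_elem_q_elem[OF that(2-5)])
  have q_cell: "sigma_gen (q_elem k n r) (cell l m)"
    if "region (q_elem k n r) \<inter> region (cell l m) \<noteq> {}" "1 \<le> k" "1 \<le> l" "1 \<le> r" for k n l m r
  proof (cases "k \<le> l")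
    case True
    show ?thesis
      using that(1) unfolding region_q_cell_meet_iff[OF that(2)] q_meets_cell_iff[OF that(2) True]
      by (elim conjE) (rule sigma_gen.q_elem_cell_le[OF that(2) True that(4)])
  next
    case False
    then have "l < k" by simp
    show ?thesis
      using that(1) unfolding region_q_cell_meet_iff[OF that(2)] q_meets_cell_above_iff[OF that(3) \<open>l < k\<close>]
      by (rule sigma_gen.q_elem_cell_gt[OF that(3) \<open>l < k\<close> that(4)])
  qed
  consider (cc) k n l m where "a = cell k n" "b = cell l m" "1 \<le> k" "1 \<le> l"
    | (qq) k n r l m r' where "a = q_elem k n r" "b = q_elem l m r'" "1 \<le> k" "1 \<le> l" "1 \<le> r" "1 \<le> r'"
    | (qc) k n r l m where "a = q_elem k n r" "b = cell l m" "1 \<le> k" "1 \<le> l" "1 \<le> r"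
    | (cq) k n r l m where "a = cell l m" "b = q_elem k n r" "1 \<le> k" "1 \<le> l" "1 \<le> r"
    using assms(1,2) unfolding B0_def B1_def by blast
  then show ?thesis
  proof cases
    case cc
    then show ?thesis
      using cells[of k n l m] cells[of l m k n] sigma_gen.sym assms(3) by (metis Int_commute nat_le_linear)
  next
    case qq
    then show ?thesis
      using qs[of k n r l m r'] qs[of l m r' k n r] sigma_gen.sym assms(3) by (metis Int_commute nat_le_linear)
  next
    case qc
    then show ?thesis using q_cell assms(3) by blast
  next
    case cq
    then show ?thesis using q_cell[of k n r l m] sigma_gen.sym assms(3) by (simp add: Int_commute)
  qed
qed

section \<open>Covers by small generators\<close>

text \<open>The neighbourhoods are those of the subspace, so that a region may be one of an end point.\<close>

definition is_nbhd :: "A_tilde \<Rightarrow> real \<Rightarrow> bool" where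
  "is_nbhd g y \<longleftrightarrow> (\<exists>W. open W \<and> y \<in> W \<and> {0..1} \<inter> W \<subseteq> region g)"

lemma small_bounded_generator:
  assumes y: "0 < y" "y < 1" and e: "e > 0"
  shows "\<exists>g\<in>B0 \<union> B1. is_nbhd g y \<and> region g \<subseteq> ball y e"
proof -
  have nbhd: "is_nbhd g y \<and> region g \<subseteq> ball y e"
    if "region g = {a..b}" "a < y" "y < b" "y - e < a" "b < y + e" for g a b
  proof
    have "{0..1} \<inter> {a<..<b} \<subseteq> region g" unfolding that(1) by auto
    then show "is_nbhd g y"
      unfolding is_nbhd_def using that(2,3) by (intro exI[of _ "{a<..<b}"]) simp
    show "region g \<subseteq> ball y e"
      unfolding that(1) ball_eq_greaterThanLessThan using that(4,5) by auto
  qed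
  from generator_neighbourhood[OF y e] show ?thesis
  proof (elim disjE exE conjE)
    fix k n assume k: "1 \<le> k" and *: "lo k n < y" "y < hi k n" "y - e < lo k n" "hi k n < y + e"
    have "cell k n \<in> B0" using k by (auto simp: B0_def)
    then show ?thesis using nbhd[OF region_cell *] by blast
  next
    fix k n r assume k: "1 \<le> k" "1 \<le> r"
      and *: "q_lo k n r < y" "y < q_hi k n r" "y - e < q_lo k n r" "q_hi k n r < y + e"
    have "q_elem k n r \<in> B1" using k by (auto simp: B1_def)
    then show ?thesis using nbhd[OF region_q_elem[OF k(1)] *] by blast
  qed
qed

text \<open>The two ends of the unit interval are reached by the elements of \<open>B2\<close> only.\<close>

lemma small_generator:
  assumes y: "y \<in> {0..1}" and e: "e > 0"
  shows "\<exists>g\<in>B0 \<union> B1 \<union> B2. is_nbhd g y \<and> region g \<subseteq> ball y e"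
proof -
  consider "y = 0" | "y = 1" | "0 < y" "y < 1" using y by fastforce
  then show ?thesis
  proof cases
    case 1
    obtain r where r: "r \<ge> 1" "grid (nz_neg r) < e" using grid_near_ends[OF e] by blast
    have "is_nbhd (u_down r) y"
      unfolding is_nbhd_def region_u_down
      using 1 grid_bounds(1)[of "nz_neg r"] by (intro exI[of _ "{..<grid (nz_neg r)}"]) auto
    moreover have "region (u_down r) \<subseteq> ball y e" 
      unfolding region_u_down ball_eq_greaterThanLessThan using 1 r e by auto
    moreover have "u_down r \<in> B2" using r by (auto simp: B2_def)
    ultimately show ?thesis by blast
  next
    case 2
    obtain r where r: "r \<ge> 1" "1 - e < grid (nz_next (nz_pos r))" using grid_near_ends[OF e] by blast
    have "is_nbhd (u_up r) y"
      unfolding is_nbhd_def region_u_up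
      using 2 grid_bounds(2)[of "nz_next (nz_pos r)"]
      by (intro exI[of _ "{grid (nz_next (nz_pos r))<..}"]) auto
    moreover have "region (u_up r) \<subseteq> ball y e" 
      unfolding region_u_up ball_eq_greaterThanLessThan using 2 r e by auto
    moreover have "u_up r \<in> B2" using r by (auto simp: B2_def)
    ultimately show ?thesis by blast
  next
    case 3
    then show ?thesis using small_bounded_generator[OF _ _ e] by blast
  qed
qed

lemma finite_small_cover:
  assumes K: "compact K" "K \<subseteq> {0..1}"
    and small: "\<And>y. y \<in> K \<Longrightarrow> \<exists>g\<in>A. is_nbhd g y \<and> region g \<subseteq> ball y e"
  shows "\<exists>F. finite F \<and> F \<subseteq> A \<and> K \<subseteq> \<Union>(region ` F) \<and> (\<forall>f\<in>F. \<exists>y\<in>K. region f \<subseteq> ball y e)"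
proof -
  have "\<forall>y\<in>K. \<exists>W. open W \<and> y \<in> W \<and> (\<exists>g\<in>A. {0..1} \<inter> W \<subseteq> region g \<and> region g \<subseteq> ball y e)"
  proof
    fix y assume "y \<in> K"
    then obtain g where "g \<in> A" "is_nbhd g y" "region g \<subseteq> ball y e" using small by blast
    then show "\<exists>W. open W \<and> y \<in> W \<and> (\<exists>g\<in>A. {0..1} \<inter> W \<subseteq> region g \<and> region g \<subseteq> ball y e)"
      unfolding is_nbhd_def by blast
  qed
  from bchoice[OF this] obtain W where W: "\<And>y. y \<in> K \<Longrightarrow> open (W y)" "\<And>y. y \<in> K \<Longrightarrow> y \<in> W y"
    "\<And>y. y \<in> K \<Longrightarrow> \<exists>g\<in>A. {0..1} \<inter> W y \<subseteq> region g \<and> region g \<subseteq> ball y e" by blast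
  obtain C where C: "C \<subseteq> K" "finite C" "K \<subseteq> (\<Union>y\<in>C. W y)"
    by (rule compactE_image[OF K(1), of K W]) (use W(1,2) in auto)
  have "\<forall>y\<in>C. \<exists>g. g \<in> A \<and> {0..1} \<inter> W y \<subseteq> region g \<and> region g \<subseteq> ball y e"
    using W(3) C(1) by blast
  from bchoice[OF this] obtain g where g: "\<And>y. y \<in> C \<Longrightarrow> g y \<in> A"
    "\<And>y. y \<in> C \<Longrightarrow> {0..1} \<inter> W y \<subseteq> region (g y)" "\<And>y. y \<in> C \<Longrightarrow> region (g y) \<subseteq> ball y e" by blast
  have "K \<subseteq> \<Union>(region ` g ` C)" using C(3) K(2) g(2) by blast
  moreover have "\<forall>f\<in>g ` C. \<exists>y\<in>K. region f \<subseteq> ball y e" using C(1) g(3) by blast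
  moreover have "finite (g ` C)" "g ` C \<subseteq> A" using C(2) g(1) by auto
  ultimately show ?thesis by blast
qed

text \<open>A generator near \<open>K\<close> and one near \<open>L\<close> cannot meet if both lie within half of the distance of the
  two sets.\<close>

lemma disjoint_finite_covers:
  assumes K: "compact K" "compact L" "K \<subseteq> {0..1}" "L \<subseteq> {0..1}" "K \<inter> L = {}"
    and small: "\<And>y e. y \<in> K \<union> L \<Longrightarrow> e > 0 \<Longrightarrow> \<exists>g\<in>A. is_nbhd g y \<and> region g \<subseteq> ball y e"
  shows "\<exists>F G. finite F \<and> F \<subseteq> A \<and> finite G \<and> G \<subseteq> A \<and> K \<subseteq> \<Union>(region ` F) \<and> L \<subseteq> \<Union>(region ` G) \<and>
    (\<forall>f\<in>F. \<forall>g\<in>G. region f \<inter> region g = {})"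
proof -
  obtain d where d: "d > 0" "\<And>x y. x \<in> K \<Longrightarrow> y \<in> L \<Longrightarrow> d \<le> dist x y"
    using separate_compact_closed[OF K(1) compact_imp_closed[OF K(2)] K(5)] by blast
  have "d / 2 > 0" using d(1) by simp
  obtain F where F: "finite F" "F \<subseteq> A" "K \<subseteq> \<Union>(region ` F)" "\<forall>f\<in>F. \<exists>y\<in>K. region f \<subseteq> ball y (d / 2)"
    using finite_small_cover[OF K(1,3), of A "d / 2"] small[OF _ \<open>d / 2 > 0\<close>] by auto
  obtain G where G: "finite G" "G \<subseteq> A" "L \<subseteq> \<Union>(region ` G)" "\<forall>f\<in>G. \<exists>y\<in>L. region f \<subseteq> ball y (d / 2)"
    using finite_small_cover[OF K(2,4), of A "d / 2"] small[OF _ \<open>d / 2 > 0\<close>] by auto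
  have "region f \<inter> region g = {}" if fg: "f \<in> F" "g \<in> G" for f g
  proof (rule ccontr)
    assume "region f \<inter> region g \<noteq> {}"
    then obtain z where z: "z \<in> region f" "z \<in> region g" by blast
    obtain x where x: "x \<in> K" "z \<in> ball x (d / 2)" using bspec[OF F(4) fg(1)] z(1) by blast
    obtain y where y: "y \<in> L" "z \<in> ball y (d / 2)" using bspec[OF G(4) fg(2)] z(2) by blast
    have "dist x y < d" using x(2) y(2) dist_triangle_half_l[of x z d y] by (simp add: dist_commute)
    then show False using d(2)[OF x(1) y(1)] by simp
  qed
  then show ?thesis using F(1-3) G(1-3) by blast
qed

section \<open>The relations in terms of regions\<close>

lemma le_Sup_iff_region:
  assumes "finite F"
  shows "c \<le> Sup F \<longleftrightarrow> region c \<subseteq> \<Union>(region ` F)"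
  unfolding unit_cells.region_le_iff[symmetric] unit_cells.region_Sup[OF assms] ..

lemma lattice_ideal_B_tilde: "lattice_ideal B_tilde"
  unfolding B_tilde_def lattice_ideal_def by blast

lemma generator_in_B_tilde: "g \<in> B0 \<union> B1 \<Longrightarrow> g \<in> B_tilde"
  unfolding B_tilde_def by blast

lemma B_tilde_region: "c \<in> B_tilde \<Longrightarrow> region c \<subseteq> {0<..<1}"
proof -
  have "region c \<subseteq> region d" if "c \<le> d" for c d using that unit_cells.region_le_iff by blast
  then have "lattice_ideal {c. region c \<subseteq> {0<..<1}}"
    unfolding lattice_ideal_def by (auto simp: unit_cells.region_sup unit_cells.region_bot)
  moreover have "B0 \<union> B1 \<subseteq> {c. region c \<subseteq> {0<..<1}}" using bounded_generator_inside by blast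
  ultimately have "B_tilde \<subseteq> {c. region c \<subseteq> {0<..<1}}" unfolding B_tilde_def by blast
  then show "c \<in> B_tilde \<Longrightarrow> region c \<subseteq> {0<..<1}" by blast
qed

lemma meet_imp_sigma_bounded:
  assumes "region c \<inter> region d \<noteq> {}"
  shows "sigma_bounded c d"
  unfolding sigma_bounded_def
proof (intro notI, elim exE conjE)
  fix F G
  assume F: "finite F" "F \<subseteq> B0 \<union> B1" "c \<le> Sup F" and G: "finite G" "G \<subseteq> B0 \<union> B1" "d \<le> Sup G"
    and sep: "\<forall>x\<in>F. \<forall>y\<in>G. \<not> sigma_gen x y"
  obtain z where z: "z \<in> region c" "z \<in> region d" using assms by blast
  obtain f where "f \<in> F" "z \<in> region f" using F(3) z(1) unfolding le_Sup_iff_region[OF F(1)] by blast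
  moreover obtain g where "g \<in> G" "z \<in> region g" using G(3) z(2) unfolding le_Sup_iff_region[OF G(1)] by blast
  ultimately show False using meet_imp_sigma_gen[of f g] F(2) G(2) sep by blast
qed

lemma region_has_inner_point:
  assumes "a \<noteq> bot"
  shows "\<exists>z. z \<in> region a \<and> 0 < z \<and> z < 1"
proof -
  obtain k n where "cell k n \<le> a" using cell_dense[OF assms] by blast
  then have "region (cell k n) \<subseteq> region a" using unit_cells.region_le_iff by blast
  then have "{lo k n..hi k n} \<subseteq> region a" by (simp only: region_cell)
  moreover obtain z where "lo k n < z" "z < hi k n" using dense[OF lo_less_hi] by blast
  moreover have "0 < z" "z < 1" using interval_in_unit[of k n] calculation by auto
  ultimately show ?thesis by (intro exI[of _ z]) auto
qed

text \<open>The definition of \<open>sigma_bounded\<close> asks for nonempty covering families.  Adding to each of the two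
  regions one inner point of the surrounding element makes the covers nonempty also if one of the two
  bounded elements is \<open>0\<close>.\<close>

lemma disjoint_imp_not_sigma_bounded:
  assumes "c \<in> B_tilde" "d \<in> B_tilde" "c \<le> a" "d \<le> b" "a \<noteq> bot" "b \<noteq> bot"
    and disj: "region a \<inter> region b \<inter> {0<..<1} = {}"
  shows "\<not> sigma_bounded c d"
proof -
  obtain z w where z: "z \<in> region a" "0 < z" "z < 1" and w: "w \<in> region b" "0 < w" "w < 1"
    using region_has_inner_point assms(5,6) by meson
  define K L where "K = insert z (region c)" and "L = insert w (region d)"
  have inner: "K \<subseteq> {0<..<1}" "L \<subseteq> {0<..<1}"
    using z w B_tilde_region[OF assms(1)] B_tilde_region[OF assms(2)] by (auto simp: K_def L_def)
  have "K \<subseteq> region a" "L \<subseteq> region b"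
    using z w assms(3,4) unit_cells.region_le_iff unfolding K_def L_def by blast+
  then have "K \<inter> L = {}" using disj inner by blast
  moreover have "compact K" "compact L" by (simp_all add: K_def L_def compact_region)
  moreover have "K \<subseteq> {0..1}" "L \<subseteq> {0..1}" using inner by fastforce+
  moreover have "\<exists>g\<in>B0 \<union> B1. is_nbhd g y \<and> region g \<subseteq> ball y e" if "y \<in> K \<union> L" "e > 0" for y e
    using small_bounded_generator[of y e] that inner by auto
  ultimately have "\<exists>F G. finite F \<and> F \<subseteq> B0 \<union> B1 \<and> finite G \<and> G \<subseteq> B0 \<union> B1 \<and>
      K \<subseteq> \<Union>(region ` F) \<and> L \<subseteq> \<Union>(region ` G) \<and> (\<forall>f\<in>F. \<forall>g\<in>G. region f \<inter> region g = {})"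
    by (intro disjoint_finite_covers) blast+
  then obtain F G where FG: "finite F" "F \<subseteq> B0 \<union> B1" "finite G" "G \<subseteq> B0 \<union> B1"
      "K \<subseteq> \<Union>(region ` F)" "L \<subseteq> \<Union>(region ` G)" "\<forall>f\<in>F. \<forall>g\<in>G. region f \<inter> region g = {}"
    by (elim exE conjE)
  have "F \<noteq> {}" "G \<noteq> {}" using FG(5,6) by (auto simp: K_def L_def)
  moreover have "c \<le> Sup F" "d \<le> Sup G"
    using FG(5,6) unfolding le_Sup_iff_region[OF FG(1)] le_Sup_iff_region[OF FG(3)] K_def L_def by blast+
  moreover have "\<forall>f\<in>F. \<forall>g\<in>G. \<not> sigma_gen f g" using sigma_gen_imp_meet FG(7) by blast
  ultimately show ?thesis unfolding sigma_bounded_def using FG(1-4) by blast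
qed

text \<open>Near an inner point that the two regions share, both elements can be cut down to a bounded
  generator.\<close>

lemma sigma_iff:
  assumes "a \<noteq> bot" "b \<noteq> bot"
  shows "sigma a b \<longleftrightarrow> region a \<inter> region b \<inter> {0<..<1} \<noteq> {}"
proof
  assume "sigma a b"
  show "region a \<inter> region b \<inter> {0<..<1} \<noteq> {}"
  proof -
    obtain c d where "c \<in> B_tilde" "d \<in> B_tilde" "c \<le> a" "d \<le> b" "sigma_bounded c d"
      using \<open>sigma a b\<close> unfolding sigma_def by blast
    then show ?thesis using disjoint_imp_not_sigma_bounded[of c d a b] assms by blast
  qed
next
  assume "region a \<inter> region b \<inter> {0<..<1} \<noteq> {}"
  then obtain y where y: "y \<in> region a" "y \<in> region b" "0 < y" "y < 1" by auto
  obtain g where g: "g \<in> B0 \<union> B1" "is_nbhd g y"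
    using small_bounded_generator[OF y(3,4), of 1] by auto
  then obtain W where W: "open W" "y \<in> W" "{0..1} \<inter> W \<subseteq> region g" by (auto simp: is_nbhd_def)
  have "openin (top_of_set {0..1}) ({0..1} \<inter> W)" using W(1) by (simp add: openin_open_Int)
  then have "{0..1} \<inter> W \<subseteq> top_of_set {0..1} interior_of (region g)" by (rule interior_of_maximal[OF W(3)])
  then have int: "y \<in> top_of_set {0..1} interior_of (region g)" using W(2) y(3,4) by auto
  have "y \<in> region (inf x g)" if "y \<in> region x" for x
    unfolding unit_cells.region_inf
    using RC_closure_of_interior_of_Int[OF unit_cells.region_RC that int] .
  then have "region (inf a g) \<inter> region (inf b g) \<noteq> {}" using y(1,2) by blast
  then have "sigma_bounded (inf a g) (inf b g)" by (rule meet_imp_sigma_bounded)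
  moreover have "inf x g \<in> B_tilde" for x
    using lattice_ideal_B_tilde generator_in_B_tilde[OF g(1)] unfolding lattice_ideal_def by auto
  ultimately show "sigma a b" unfolding sigma_def by (meson inf_le1)
qed

text \<open>While \<open>sigma\<close> only takes inner points into account, this makes no difference for generators: two
  that share an end point are both elements of \<open>B2\<close> at that end and overlap.\<close>

lemma generators_meet_inside:
  assumes "a \<in> B0 \<union> B1 \<union> B2" "b \<in> B0 \<union> B1 \<union> B2" "region a \<inter> region b \<noteq> {}"
  shows "region a \<inter> region b \<inter> {0<..<1} \<noteq> {}"
proof (cases "a \<in> B0 \<union> B1 \<or> b \<in> B0 \<union> B1")
  case True
  then show ?thesis using bounded_generator_inside assms(3) by blast
next
  case False
  have up: "(1 + max (grid p) (grid q)) / 2 \<in> {grid p..1} \<inter> {grid q..1} \<inter> {0<..<1}" for p q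
    using grid_bounds[of p] grid_bounds[of q] by (auto simp: max_def)
  have down: "min (grid p) (grid q) \<in> {0..grid p} \<inter> {0..grid q} \<inter> {0<..<1}" for p q
    using grid_bounds[of p] grid_bounds[of q] by (auto simp: min_def)
  have apart: "{grid (nz_next (nz_pos r))..1} \<inter> {0..grid (nz_neg s)} = {}" if "r \<ge> 1" "s \<ge> 1" for r s
  proof -
    have "nz_neg s < nz_next (nz_pos r)" using neg_less_pos[OF that(2,1)] less_next by (rule order_less_trans)
    then have "grid (nz_neg s) < grid (nz_next (nz_pos r))" by (simp only: grid_less_iff)
    then show ?thesis by (auto simp del: grid_less_iff)
  qed
  from False have "a \<in> B2" "b \<in> B2" using assms(1,2) by blast+
  then consider r s where "a = u_up r" "b = u_up s" "r \<ge> 1" "s \<ge> 1"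
    | r s where "a = u_down r" "b = u_down s" "r \<ge> 1" "s \<ge> 1"
    | r s where "a = u_up r" "b = u_down s" "r \<ge> 1" "s \<ge> 1"
    | r s where "a = u_down s" "b = u_up r" "r \<ge> 1" "s \<ge> 1"
    unfolding B2_def by blast
  then show ?thesis
  proof cases
    case 1
    then show ?thesis unfolding 1 region_u_up using up by blast
  next
    case 2
    then show ?thesis unfolding 2 region_u_down using down by blast
  next
    case 3
    then show ?thesis using assms(3) apart unfolding 3 region_u_up region_u_down by blast
  next
    case 4
    then show ?thesis using assms(3) apart unfolding 4 region_u_up region_u_down by blast
  qed
qed

text \<open>Here the end points count: disjoint regions are compact, so they have disjoint finite covers by
  generators; conversely, a point that two regions share lies in a member of either cover, and
  these two members are in relation.\<close>

lemma sigma'_iff: "sigma' c d \<longleftrightarrow> region c \<inter> region d \<noteq> {}"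
proof
  assume contact: "sigma' c d"
  show "region c \<inter> region d \<noteq> {}"
  proof
    assume disj: "region c \<inter> region d = {}"
    have "\<exists>g\<in>B0 \<union> B1 \<union> B2. is_nbhd g y \<and> region g \<subseteq> ball y e" if "y \<in> region c \<union> region d" "e > 0" for y e
      using small_generator[of y e] that region_subset_unit by blast
    then have "\<exists>F G. finite F \<and> F \<subseteq> B0 \<union> B1 \<union> B2 \<and> finite G \<and> G \<subseteq> B0 \<union> B1 \<union> B2 \<and>
        region c \<subseteq> \<Union>(region ` F) \<and> region d \<subseteq> \<Union>(region ` G) \<and>
        (\<forall>f\<in>F. \<forall>g\<in>G. region f \<inter> region g = {})"
      by (rule disjoint_finite_covers[OF compact_region compact_region region_subset_unit
            region_subset_unit disj])
    then obtain F G where FG: "finite F" "F \<subseteq> B0 \<union> B1 \<union> B2" "finite G" "G \<subseteq> B0 \<union> B1 \<union> B2"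
        "region c \<subseteq> \<Union>(region ` F)" "region d \<subseteq> \<Union>(region ` G)"
        "\<forall>f\<in>F. \<forall>g\<in>G. region f \<inter> region g = {}"
      by (elim exE conjE)
    have sep: "\<not> sigma f g" if "f \<in> F" "g \<in> G" for f g
    proof -
      have "f \<noteq> bot" "g \<noteq> bot" using that FG(2,4) generator_nonzero by blast+
      then show ?thesis using sigma_iff[of f g] FG(7) that by blast
    qed
    have "c \<le> Sup F" "d \<le> Sup G"
      using FG(5,6) unfolding le_Sup_iff_region[OF FG(1)] le_Sup_iff_region[OF FG(3)] .
    then have "\<exists>G. finite F \<and> F \<subseteq> B0 \<union> B1 \<union> B2 \<and> finite G \<and> G \<subseteq> B0 \<union> B1 \<union> B2 \<and>
        c \<le> Sup F \<and> d \<le> Sup G \<and> (\<forall>x\<in>F. \<forall>y\<in>G. \<not> sigma x y)"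
      using FG(1-4) sep by (intro exI[of _ G] conjI ballI)
    then show False using contact unfolding sigma'_def by (metis (no_types))
  qed
next
  assume "region c \<inter> region d \<noteq> {}"
  then obtain z where z: "z \<in> region c" "z \<in> region d" by blast
  show "sigma' c d"
    unfolding sigma'_def
  proof (intro notI, elim exE conjE)
    fix F G
    assume F: "finite F" "F \<subseteq> B0 \<union> B1 \<union> B2" "c \<le> Sup F"
      and G: "finite G" "G \<subseteq> B0 \<union> B1 \<union> B2" "d \<le> Sup G"
      and sep: "\<forall>x\<in>F. \<forall>y\<in>G. \<not> sigma x y"
    obtain f where f: "f \<in> F" "z \<in> region f" using F(3) z(1) unfolding le_Sup_iff_region[OF F(1)] by blast
    obtain g where g: "g \<in> G" "z \<in> region g" using G(3) z(2) unfolding le_Sup_iff_region[OF G(1)] by blast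
    have gens: "f \<in> B0 \<union> B1 \<union> B2" "g \<in> B0 \<union> B1 \<union> B2" using f g F(2) G(2) by blast+
    then have "region f \<inter> region g \<inter> {0<..<1} \<noteq> {}" using f g by (intro generators_meet_inside) blast+
    then have "sigma f g" using sigma_iff generator_nonzero gens by blast
    then show False using sep f g by blast
  qed
qed

section \<open>Contact isomorphic compact Hausdorff spaces are homeomorphic\<close>

text \<open>A point \<open>x\<close> of \<open>X\<close> corresponds to the points of \<open>Y\<close> whose regular closed neighbourhoods are in
  contact with the images of all those of \<open>x\<close>.  Contact is tested in \<open>X\<close>, which is the same for a
  contact isomorphism \<open>f\<close>.  In this form the relation is closed in the product of the spaces, and the
  inverse isomorphism gives the converse relation.\<close>

definition corresponding :: "'a topology \<Rightarrow> 'b topology \<Rightarrow> ('a set \<Rightarrow> 'b set) \<Rightarrow> 'a \<Rightarrow> 'b \<Rightarrow> bool" where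
  "corresponding X Y f x y \<longleftrightarrow> (\<forall>F\<in>elems (RC X). \<forall>G\<in>elems (RC X).
     x \<in> X interior_of F \<longrightarrow> y \<in> Y interior_of (f G) \<longrightarrow> F \<inter> G \<noteq> {})"

definition contact_iso :: "'a topology \<Rightarrow> 'b topology \<Rightarrow> ('a set \<Rightarrow> 'b set) \<Rightarrow> bool" where
  "contact_iso X Y f \<longleftrightarrow> bij_betw f (elems (RC X)) (elems (RC Y)) \<and>
     (\<forall>F\<in>elems (RC X). \<forall>G\<in>elems (RC X). (f F \<subseteq> f G \<longleftrightarrow> F \<subseteq> G) \<and>
       (f F \<inter> f G \<noteq> {} \<longleftrightarrow> F \<inter> G \<noteq> {}))"

lemma contact_iso_inverse:
  assumes "contact_iso X Y f"
  shows "contact_iso Y X (inv_into (elems (RC X)) f)"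
proof -
  let ?g = "inv_into (elems (RC X)) f"
  have f: "bij_betw f (elems (RC X)) (elems (RC Y))" using assms by (simp add: contact_iso_def)
  have g: "bij_betw ?g (elems (RC Y)) (elems (RC X))" using f by (rule bij_betw_inv_into)
  have "f (?g G) = G" "?g G \<in> elems (RC X)" if "G \<in> elems (RC Y)" for G
    using f g that by (auto simp: bij_betw_inv_into_right bij_betw_apply)
  then show ?thesis using assms g unfolding contact_iso_def by metis
qed

lemma corresponding_inverse:
  assumes "contact_iso X Y f"
  shows "corresponding Y X (inv_into (elems (RC X)) f) y x \<longleftrightarrow> corresponding X Y f x y"
proof -
  let ?g = "inv_into (elems (RC X)) f"
  have f: "bij_betw f (elems (RC X)) (elems (RC Y))" using assms by (simp add: contact_iso_def)
  have fg: "f (?g G) = G" "?g G \<in> elems (RC X)" if "G \<in> elems (RC Y)" for G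
    using f bij_betw_inv_into[OF f] that by (auto simp: bij_betw_inv_into_right bij_betw_apply)
  have gf: "?g (f F) = F" "f F \<in> elems (RC Y)" if "F \<in> elems (RC X)" for F
    using f that by (auto simp: bij_betw_inv_into_left bij_betw_apply)
  have contact: "f F \<inter> f G \<noteq> {} \<longleftrightarrow> F \<inter> G \<noteq> {}" if "F \<in> elems (RC X)" "G \<in> elems (RC X)" for F G
    using assms that by (simp add: contact_iso_def)
  show ?thesis
    unfolding corresponding_def
  proof (intro iffI ballI impI)
    fix F G
    assume R: "\<forall>F\<in>elems (RC Y). \<forall>G\<in>elems (RC Y).
        y \<in> Y interior_of F \<longrightarrow> x \<in> X interior_of ?g G \<longrightarrow> F \<inter> G \<noteq> {}"
      and FG: "F \<in> elems (RC X)" "G \<in> elems (RC X)" "x \<in> X interior_of F" "y \<in> Y interior_of f G"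
    have "f G \<inter> f F \<noteq> {}"
      using R[rule_format, OF gf(2)[OF FG(2)] gf(2)[OF FG(1)] FG(4)] FG(1,3) gf(1) by simp
    then show "F \<inter> G \<noteq> {}" using contact FG by blast
  next
    fix F G
    assume R: "\<forall>F\<in>elems (RC X). \<forall>G\<in>elems (RC X).
        x \<in> X interior_of F \<longrightarrow> y \<in> Y interior_of f G \<longrightarrow> F \<inter> G \<noteq> {}"
      and FG: "F \<in> elems (RC Y)" "G \<in> elems (RC Y)" "y \<in> Y interior_of F" "x \<in> X interior_of ?g G"
    have "?g G \<inter> ?g F \<noteq> {}"
      using R[rule_format, OF fg(2)[OF FG(2)] fg(2)[OF FG(1)] FG(4)] FG(1,3) fg(1) by simp
    then show "F \<inter> G \<noteq> {}"
      using contact[OF fg(2)[OF FG(1)] fg(2)[OF FG(2)]] FG fg(1) by auto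
  qed
qed

text \<open>The images of the neighbourhoods of \<open>x\<close> have the finite intersection property, since \<open>f\<close> is
  monotone and takes no nonempty set to the empty one.  A common point of them corresponds to \<open>x\<close>.\<close>

lemma corresponding_exists:
  assumes iso: "contact_iso X Y f" and Y: "compact_space Y" and x: "x \<in> topspace X"
  shows "\<exists>y\<in>topspace Y. corresponding X Y f x y"
proof -
  define N where "N = {F \<in> elems (RC X). x \<in> X interior_of F}"
  have f: "bij_betw f (elems (RC X)) (elems (RC Y))" using iso by (simp add: contact_iso_def)
  have mono: "f F \<subseteq> f G" if "F \<in> elems (RC X)" "G \<in> elems (RC X)" "F \<subseteq> G" for F G
    using iso that by (simp add: contact_iso_def)
  have cl: "closedin Y (f F)" if "F \<in> elems (RC X)" for F
    using f that by (meson RC_closedin bij_betw_apply)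
  have ne: "f F \<noteq> {}" if "F \<in> elems (RC X)" "F \<noteq> {}" for F
    using iso that unfolding contact_iso_def by fastforce
  have X_N: "topspace X \<in> N"
    using RC_closure_of_open[of X "topspace X"] x by (simp add: N_def)
  have fip: "\<Inter>\<F> \<noteq> {}" if \<F>: "finite \<F>" "\<F> \<subseteq> f ` N" for \<F>
  proof -
    obtain M where M: "finite M" "M \<subseteq> N" "\<F> = f ` M" using \<F> by (meson finite_subset_image)
    define V where "V = (\<Inter>F\<in>insert (topspace X) M. X interior_of F)"
    have "openin X V" unfolding V_def using M(1) by (intro openin_Inter) auto
    moreover have "x \<in> V" using M(2) X_N by (auto simp: V_def N_def)
    ultimately have V: "openin X V" "x \<in> V" .
    have rc: "X closure_of V \<in> elems (RC X)" using V(1) by (rule RC_closure_of_open)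
    have "f (X closure_of V) \<subseteq> f F" if "F \<in> M" for F
    proof (rule mono[OF rc])
      show "F \<in> elems (RC X)" using that M by (auto simp: N_def)
      then show "X closure_of V \<subseteq> F"
        using that interior_of_subset[of X F]
        by (intro closure_of_minimal RC_closedin) (auto simp: V_def)
    qed
    moreover have "f (X closure_of V) \<noteq> {}"
      using V closure_of_subset[of V X] openin_subset[of X V] by (intro ne[OF rc]) auto
    ultimately show ?thesis using M(3) by blast
  qed
  have "\<Inter>(f ` N) \<noteq> {}"
    using Y[unfolded compact_space_fip, rule_format, of "f ` N"] fip cl by (auto simp: N_def)
  then obtain y where y: "\<And>F. F \<in> N \<Longrightarrow> y \<in> f F" by blast
  have "corresponding X Y f x y"
    unfolding corresponding_def
  proof (intro ballI impI)
    fix F G assume FG: "F \<in> elems (RC X)" "G \<in> elems (RC X)" "x \<in> X interior_of F" "y \<in> Y interior_of f G"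
    have "y \<in> f F \<inter> f G"
      using FG y[of F] interior_of_subset[of Y "f G"] by (auto simp: N_def)
    then show "F \<inter> G \<noteq> {}" using iso FG(1,2) unfolding contact_iso_def by blast
  qed
  moreover have "y \<in> topspace Y"
    using y[OF X_N] cl X_N closedin_subset[of Y] by (auto simp: N_def)
  ultimately show ?thesis by blast
qed

text \<open>Two points of \<open>Y\<close> have disjoint regular closed neighbourhoods; their preimages are disjoint, but a
  point that corresponds to both would have to lie in both preimages.\<close>

lemma corresponding_unique:
  assumes iso: "contact_iso X Y f" and X: "regular_space X" and Y: "regular_space Y" "Hausdorff_space Y"
    and x: "x \<in> topspace X" and y: "y \<in> topspace Y" "y' \<in> topspace Y"
    and R: "corresponding X Y f x y" "corresponding X Y f x y'"
  shows "y = y'"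
proof (rule ccontr)
  assume "y \<noteq> y'"
  then obtain U U' where U: "openin Y U" "openin Y U'" "y \<in> U" "y' \<in> U'" "disjnt U U'"
    using Y(2) y unfolding Hausdorff_space_def by metis
  have f: "bij_betw f (elems (RC X)) (elems (RC Y))" using iso by (simp add: contact_iso_def)
  have pre: "\<exists>G\<in>elems (RC X). z \<in> Y interior_of f G \<and> f G \<subseteq> W" if "openin Y W" "z \<in> W" for W z
    using RC_base[OF Y(1) that] f unfolding bij_betw_def by (metis imageE)
  obtain G where G: "G \<in> elems (RC X)" "y \<in> Y interior_of f G" "f G \<subseteq> U"
    using pre[OF U(1,3)] by blast
  obtain G' where G': "G' \<in> elems (RC X)" "y' \<in> Y interior_of f G'" "f G' \<subseteq> U'"
    using pre[OF U(2,4)] by blast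
  have "f G \<inter> f G' = {}" using G G' U(5) by (auto simp: disjnt_iff)
  then have "G \<inter> G' = {}" using iso G(1) G'(1) by (auto simp: contact_iso_def)
  moreover have "x \<in> K" if K: "K \<in> elems (RC X)" "z \<in> Y interior_of f K" "corresponding X Y f x z" for K z
  proof (rule ccontr)
    assume "x \<notin> K"
    then obtain F where "F \<in> elems (RC X)" "x \<in> X interior_of F" "F \<subseteq> topspace X - K"
      using RC_base[OF X, of "topspace X - K" x] K(1) x RC_closedin by blast
    then show False using K unfolding corresponding_def by blast
  qed
  ultimately show False using G G' R by blast
qed

text \<open>So correspondence is the graph of a bijection.  A map into a compact space is continuous if its
  graph is closed, and a continuous bijection of compact Hausdorff spaces is a homeomorphism.\<close>

lemma contact_iso_imp_homeomorphic:
  assumes iso: "contact_iso X Y f"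
    and X: "compact_space X" "Hausdorff_space X" and Y: "compact_space Y" "Hausdorff_space Y"
  shows "X homeomorphic_space Y"
proof -
  note iso' = contact_iso_inverse[OF iso] and R' = corresponding_inverse[OF iso]
  have reg: "regular_space X" "regular_space Y"
    using X Y by (auto intro: compact_Hausdorff_imp_regular_space)
  define g where "g x = (SOME y. y \<in> topspace Y \<and> corresponding X Y f x y)" for x
  have g: "g x \<in> topspace Y" "corresponding X Y f x (g x)" if "x \<in> topspace X" for x
  proof -
    have "\<exists>y. y \<in> topspace Y \<and> corresponding X Y f x y"
      using corresponding_exists[OF iso Y(1) that] by blast
    then show "g x \<in> topspace Y" "corresponding X Y f x (g x)" unfolding g_def by (metis (lifting) someI_ex)+
  qed
  have g_eq: "g x = y" if "x \<in> topspace X" "y \<in> topspace Y" "corresponding X Y f x y" for x y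
    using corresponding_unique[OF iso reg Y(2) that(1) g(1) that(2) g(2) that(3)] that by simp
  define \<Gamma> where "\<Gamma> = {(x, y). x \<in> topspace X \<and> y \<in> topspace Y \<and> corresponding X Y f x y}"
  have "openin (prod_topology X Y) (topspace X \<times> topspace Y - \<Gamma>)"
    unfolding openin_prod_topology_alt
  proof (intro allI impI)
    fix x y assume xy: "(x, y) \<in> topspace X \<times> topspace Y - \<Gamma>"
    then obtain F G where FG: "F \<in> elems (RC X)" "G \<in> elems (RC X)" "x \<in> X interior_of F"
        "y \<in> Y interior_of f G" "F \<inter> G = {}"
      by (auto simp: \<Gamma>_def corresponding_def)
    have "(X interior_of F) \<times> (Y interior_of f G) \<subseteq> topspace X \<times> topspace Y - \<Gamma>"
      using FG interior_of_subset_topspace[of X F] interior_of_subset_topspace[of Y "f G"]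
      by (fastforce simp: \<Gamma>_def corresponding_def)
    with FG show "\<exists>U V. openin X U \<and> openin Y V \<and> x \<in> U \<and> y \<in> V \<and>
        U \<times> V \<subseteq> topspace X \<times> topspace Y - \<Gamma>"
      by (intro exI[of _ "X interior_of F"] exI[of _ "Y interior_of f G"]) simp
  qed
  then have \<Gamma>: "closedin (prod_topology X Y) \<Gamma>" by (auto simp: closedin_def \<Gamma>_def)
  have "continuous_map X Y g"
    unfolding continuous_map_closedin
  proof (intro conjI ballI allI impI)
    fix C assume C: "closedin Y C"
    \<comment> \<open>The projection along the compact space \<open>Y\<close> is a closed map.\<close>
    have "{x \<in> topspace X. g x \<in> C} = fst ` (\<Gamma> \<inter> topspace X \<times> C)"
    proof (intro equalityI subsetI)
      fix x assume "x \<in> {x \<in> topspace X. g x \<in> C}"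
      then show "x \<in> fst ` (\<Gamma> \<inter> topspace X \<times> C)"
        using g by (intro image_eqI[of _ _ "(x, g x)"]) (auto simp: \<Gamma>_def)
    qed (use g_eq in \<open>auto simp: \<Gamma>_def\<close>)
    moreover have "closedin X (fst ` (\<Gamma> \<inter> topspace X \<times> C))"
      using closed_map_fst[OF Y(1), of X] \<Gamma> C unfolding closed_map_def
      by (simp add: closedin_Int closedin_prod_Times_iff)
    ultimately show "closedin X {x \<in> topspace X. g x \<in> C}" by simp
  qed (use g in auto)
  moreover have "inj_on g (topspace X)"
  proof (rule inj_onI)
    fix x x' assume x: "x \<in> topspace X" "x' \<in> topspace X" "g x = g x'"
    show "x = x'"
      by (rule corresponding_unique[OF iso' reg(2,1) X(2) g(1)[OF x(1)] x(1,2)])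
        (use x g(2)[of x] g(2)[of x'] in \<open>simp_all add: R'\<close>)
  qed
  moreover have "topspace Y \<subseteq> g ` topspace X"
  proof
    fix y assume y: "y \<in> topspace Y"
    obtain x where "x \<in> topspace X" "corresponding X Y f x y"
      using corresponding_exists[OF iso' X(1) y] R' by blast
    then show "y \<in> g ` topspace X" using g_eq y by blast
  qed
  moreover have "g ` topspace X \<subseteq> topspace Y" using g by blast
  ultimately have "homeomorphic_map X Y g"
    using X(1) Y(2) by (intro continuous_imp_homeomorphic_map) auto
  then show ?thesis by (rule homeomorphic_map_imp_homeomorphic_space)
qed

lemma CA_isomorphic_trans_join:
  assumes "CA_isomorphic P C Q D" "CA_isomorphic Q D R E"
  shows "\<exists>f. bij_betw f (elems P) (elems R) \<and>
    (\<forall>x\<in>elems P. \<forall>y\<in>elems P. f (join P x y) = join R (f x) (f y)) \<and>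
    (\<forall>x\<in>elems P. \<forall>y\<in>elems P. C x y \<longleftrightarrow> E (f x) (f y))"
proof -
  obtain f where f: "boolean_isomorphism P Q f"
    "\<forall>a\<in>elems P. \<forall>b\<in>elems P. C a b \<longleftrightarrow> D (f a) (f b)"
    using assms(1) unfolding CA_isomorphic_def by blast
  obtain g where g: "boolean_isomorphism Q R g"
    "\<forall>a\<in>elems Q. \<forall>b\<in>elems Q. D a b \<longleftrightarrow> E (g a) (g b)"
    using assms(2) unfolding CA_isomorphic_def by blast
  have bij: "bij_betw f (elems P) (elems Q)" "bij_betw g (elems Q) (elems R)"
    using f g by (simp_all add: boolean_isomorphism_def)
  have "f x \<in> elems Q" if "x \<in> elems P" for x using bij(1) that by (rule bij_betw_apply)
  then show ?thesis
    using f g bij_betw_trans[OF bij] by (intro exI[of _ "g \<circ> f"]) (simp add: boolean_isomorphism_def)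
qed

theorem theorem5p7:
  shows "complete_normal_contact_algebra (type_balg :: A_tilde balg) sigma' \<and>
    CA_isomorphic type_balg sigma' (RC (top_of_set {0..1::real})) rho \<and>
    (\<forall>Y :: 'y topology. compact_space Y \<and> Hausdorff_space Y \<and>
        CA_isomorphic (RC Y) rho type_balg sigma' \<longrightarrow>
        Y homeomorphic_space top_of_set {0..1::real})"
proof (intro conjI allI impI)
  let ?I = "top_of_set {0..1::real}"
  have I: "compact_space ?I" "Hausdorff_space ?I"
    by (simp_all add: compact_space_subtopology Hausdorff_space_subtopology)
  have sigma': "sigma' = (\<lambda>x y. region x \<inter> region y \<noteq> {})" by (intro ext sigma'_iff)
  show "complete_normal_contact_algebra (type_balg :: A_tilde balg) sigma'"
    unfolding sigma' using unit_cells.bij_betw_region unit_cells.region_le_iff I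
    by (rule order_iso_RC_imp_complete_normal_contact_algebra)
  show iso: "CA_isomorphic type_balg sigma' (RC ?I) rho"
    unfolding CA_isomorphic_def rho_def sigma' using unit_cells.region_isomorphism by blast
  fix Y :: "'y topology"
  assume Y: "compact_space Y \<and> Hausdorff_space Y \<and> CA_isomorphic (RC Y) rho type_balg sigma'"
  have "join (RC Y) F G = F \<union> G" "join (RC ?I) H K = H \<union> K" for F G H K by (simp_all add: RC_def)
  then obtain f where f: "bij_betw f (elems (RC Y)) (elems (RC ?I))"
    "\<And>F G. F \<in> elems (RC Y) \<Longrightarrow> G \<in> elems (RC Y) \<Longrightarrow> f (F \<union> G) = f F \<union> f G"
    "\<And>F G. F \<in> elems (RC Y) \<Longrightarrow> G \<in> elems (RC Y) \<Longrightarrow> rho F G \<longleftrightarrow> rho (f F) (f G)"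
    using CA_isomorphic_trans_join[of "RC Y" rho type_balg sigma' "RC ?I" rho] Y iso by auto
  have "f F \<subseteq> f G \<longleftrightarrow> F \<subseteq> G" if "F \<in> elems (RC Y)" "G \<in> elems (RC Y)" for F G
  proof -
    have "f (F \<union> G) = f G \<longleftrightarrow> F \<union> G = G"
      using bij_betw_imp_inj_on[OF f(1)] RC_Un[OF that] that(2) by (rule inj_on_eq_iff)
    then show ?thesis using f(2)[OF that] by (simp add: subset_Un_eq)
  qed
  then have "contact_iso Y ?I f" using f(1,3) by (simp add: contact_iso_def rho_def)
  then show "Y homeomorphic_space ?I" using Y I by (intro contact_iso_imp_homeomorphic) auto
qed

end
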